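(* Let $n\ge1$, $\alpha\in(0,1)$, and $s_1,\dots,s_n\in(\tfrac12,1)$. Let $H\in C^{2,\alpha}(\mathbb{R}^n)$ be real-valued, let $A$ be a real $n\times n$ matrix, and let $e\in C^{\alpha}(\mathbb{R},\mathbb{R}^n)$ be $2\pi$-periodic with mean $\bar e=\frac1{2\pi}\int_0^{2\pi}e(t)\,dt\in\mathbb{R}^n$. For $u=(u_1,\dots,u_n)$ set $L(u)=((\Delta)^{s_1}u_1,\dots,(\Delta)^{s_n}u_n)$. If $\bar e\in\operatorname{Im}A$ and $$M:=\sup_{|y|=1}\langle Ay,y\rangle<1,$$ then the system $$L(u(t))+\frac{d}{dt}\big(\nabla H(u(t))\big)+Au(t)=e(t),\qquad t\in\mathbb{R},$$ has at least one $2\pi$-periodic classical solution.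
   Context: For $s\in(0,1)$ and a sufficiently regular bounded $v:\mathbb{R}\to\mathbb{R}$, $(-\Delta)^s v(x)=C_{1,s}\,\mathrm{P.V.}\int_{\mathbb{R}}\frac{v(x)-v(z)}{|x-z|^{1+2s}}\,dz$ with $C_{1,s}=\left(\int_{\mathbb{R}}\frac{1-\cos\xi}{|\xi|^{1+2s}}d\xi\right)^{-1}$, and $(\Delta)^s v:=-(-\Delta)^s v$. $\langle\cdot,\cdot\rangle$ is the Euclidean inner product. A classical solution is a sufficiently regular (Hölder) function satisfying the system pointwise. *)

theory Defs
  imports "HOL-Analysis.Analysis"
begin

definition C1 :: "real \<Rightarrow> real" where
  "C1 s = inverse (integral\<^sup>L lborel (\<lambda>\<xi>::real. (1 - cos \<xi>) / \<bar>\<xi>\<bar> powr (1 + 2 * s)))"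

definition trunc_int :: "real \<Rightarrow> (real \<Rightarrow> real) \<Rightarrow> real \<Rightarrow> real \<Rightarrow> real" where
  "trunc_int s v x \<epsilon> =
     (LINT z:{z. \<epsilon> < \<bar>x - z\<bar>}|lborel. (v x - v z) / \<bar>x - z\<bar> powr (1 + 2 * s))"

definition frac_lap_exists :: "real \<Rightarrow> (real \<Rightarrow> real) \<Rightarrow> real \<Rightarrow> bool" where
  "frac_lap_exists s v x \<longleftrightarrow>
     (\<forall>\<epsilon>>0. set_integrable lborel {z. \<epsilon> < \<bar>x - z\<bar>}
                 (\<lambda>z. (v x - v z) / \<bar>x - z\<bar> powr (1 + 2 * s)))
     \<and> (\<exists>l. (trunc_int s v x \<longlongrightarrow> l) (at_right 0))"

definition neg_frac_lap :: "real \<Rightarrow> (real \<Rightarrow> real) \<Rightarrow> real \<Rightarrow> real" where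
  "neg_frac_lap s v x = C1 s * Lim (at_right 0) (trunc_int s v x)"

definition frac_lap :: "real \<Rightarrow> (real \<Rightarrow> real) \<Rightarrow> real \<Rightarrow> real" where
  "frac_lap s v x = - neg_frac_lap s v x"

definition holder :: "real \<Rightarrow> ('a::metric_space \<Rightarrow> 'b::real_normed_vector) \<Rightarrow> bool" where
  "holder \<alpha> f \<longleftrightarrow> (\<exists>C. \<forall>x y. norm (f x - f y) \<le> C * dist x y powr \<alpha>)"

definition grad :: "(real^'n \<Rightarrow> real) \<Rightarrow> real^'n \<Rightarrow> real^'n" where
  "grad H x = (\<chi> i. frechet_derivative H (at x) (axis i 1))"

text \<open>C^{2,alpha}(R^n) in the sense of Gilbarg--Trudinger: twice differentiable,
  second derivative Hoelder continuous on every bounded set.\<close>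
definition C2alpha :: "real \<Rightarrow> (real^'n \<Rightarrow> real) \<Rightarrow> bool" where
  "C2alpha \<alpha> H \<longleftrightarrow>
     (\<forall>x. H differentiable (at x)) \<and>
     (\<forall>x. grad H differentiable (at x)) \<and>
     (\<forall>K. bounded K \<longrightarrow> (\<exists>C. \<forall>x\<in>K. \<forall>y\<in>K.
        onorm (\<lambda>h. frechet_derivative (grad H) (at x) h - frechet_derivative (grad H) (at y) h)
          \<le> C * dist x y powr \<alpha>))"

definition periodic_classical_solution ::
  "('n \<Rightarrow> real) \<Rightarrow> (real^'n \<Rightarrow> real) \<Rightarrow> real^'n^'n \<Rightarrow> (real \<Rightarrow> real^'n) \<Rightarrow> (real \<Rightarrow> real^'n) \<Rightarrow> bool"
  where
  "periodic_classical_solution s H A e u \<longleftrightarrow>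
     (\<forall>t. u (t + 2 * pi) = u t) \<and>
     (\<exists>\<beta>. 0 < \<beta> \<and> \<beta> \<le> 1 \<and> holder \<beta> u) \<and>
     (\<forall>t i. frac_lap_exists (s i) (\<lambda>\<tau>. u \<tau> $ i) t) \<and>
     (\<forall>t. \<exists>D. ((\<lambda>\<tau>. grad H (u \<tau>)) has_vector_derivative D) (at t) \<and>
          (\<chi> i. frac_lap (s i) (\<lambda>\<tau>. u \<tau> $ i) t) + D + A *v u t = e t)"

end

theory Submission
  imports Defs "HOL-Complex_Analysis.Complex_Analysis"
begin

text \<open>
  Averaging the equation forces the mean of \<open>u\<close> to be a solution \<open>y\<close> of \<open>A y = mean e\<close>, so
  one looks for \<open>u = y + w\<close> with \<open>w\<close> of mean zero. Testing with \<open>u\<close> kills the term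
  \<open>d/dt (grad H (u))\<close>, since \<open>\<langle>grad H (u), u'\<rangle>\<close> is the derivative of \<open>H (u)\<close>, and \<open>M < 1\<close>
  together with \<open>\<parallel>w\<parallel> \<le> \<parallel>w\<parallel>\<^sub>H\<^sub>s\<close> gives an energy bound. Brouwer's theorem solves the Galerkin
  systems, and \<open>s > 1/2\<close> makes the energy bound a uniform Hoelder bound, so a subsequence converges
  to a Hoelder weak solution.

  Regularity is obtained by the Hardy--Littlewood method: a periodic function is Hoelder of order
  \<open>q\<close> iff the second derivative of the holomorphic extension \<open>F\<close> of its positive-frequency part to the
  upper half plane is \<open>O(y\<^sup>q\<^sup>-\<^sup>2)\<close>, also for \<open>1 < q < 2\<close>, and the inverse fractional Laplacian acts
  on \<open>F\<close> as \<open>1/\<Gamma>(2s) \<integral> \<tau>\<^sup>2\<^sup>s\<^sup>-\<^sup>1 F(z + i\<tau>) d\<tau>\<close>, hence gains exactly \<open>2s\<close> derivatives while the time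
  derivative costs one. Iterating reaches order above \<open>2s\<close>, where the singular integral converges and
  has the expected Fourier coefficients; uniqueness of Fourier coefficients gives the pointwise equation.
\<close>

no_notation fps_nth (infixl "$" 75)

subsection \<open>Zeros of continuous maps on finite-dimensional spheres\<close>

text \<open>The energy argument needs only continuity of \<open>grad H\<close>; the stronger
  smoothness of \<open>H\<close> serves regularity alone, and the two are kept apart. The number of
  Galerkin unknowns grows with the cutoff, so the dimension is a variable and not a type; zeros of
  vector fields are therefore found on functions of type \<open>nat \<Rightarrow> real\<close>, by
  Kuhn's combinatorial lemma.

  The components may have different orders. Everything runs with one gain \<sigma>, the minimum of 2
  s_i - 1: inverting the fractional Laplacian wins 2 s_i derivatives and d/dt costs one. The link
  between Hoelder order and growth of the second derivative breaks at integer orders, and the bound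
  for the integral over \<tau> is finite only if the growth exponent exceeds 2 s_i. Hence the
  bootstrap stops at order 1 - \<sigma>/2 and jumps from there to 1 + \<sigma>/2, and the order of
  the remaining terms is shrunk until its sum with every 2 s_i is below 2. The mean of
  \<open>e\<close> matters only at frequency 0, which the Galerkin equations never see.\<close>

lemma tendsto_fun_componentwise:
  fixes f :: "'c \<Rightarrow> 'a \<Rightarrow> 'b::topological_space"
  assumes "\<And>i. ((\<lambda>m. f m i) \<longlongrightarrow> l i) F"
  shows "(f \<longlongrightarrow> l) F"
proof -
  have "limitin (product_topology (\<lambda>i::'a. euclidean) UNIV) f l F"
    using assms by (auto simp: limitin_componentwise)
  then show ?thesis by (simp add: euclidean_product_topology)
qed

text \<open>Grid points of the cube are labelled by the sign of each component. Kuhn's lemma yields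
  a cell that shows both labels in every coordinate; as the mesh shrinks, compactness gives a limit
  point at which each component is both nonpositive and nonnegative. Sample points vanish in the
  coordinates from \<open>n\<close> on.\<close>

lemma poincare_miranda:
  fixes F :: "(nat \<Rightarrow> real) \<Rightarrow> nat \<Rightarrow> real"
  assumes cont: "\<And>i. i < n \<Longrightarrow> continuous_on UNIV (\<lambda>x. F x i)"
    and lo: "\<And>x i. i < n \<Longrightarrow> (\<And>j. j < n \<Longrightarrow> 0 \<le> x j \<and> x j \<le> 1) \<Longrightarrow> x i = 0 \<Longrightarrow> F x i \<le> 0"
    and hi: "\<And>x i. i < n \<Longrightarrow> (\<And>j. j < n \<Longrightarrow> 0 \<le> x j \<and> x j \<le> 1) \<Longrightarrow> x i = 1 \<Longrightarrow> 0 \<le> F x i"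
  shows "\<exists>x. \<forall>i<n. F x i = 0"
proof -
  define pt where "pt m q = (\<lambda>i. if i < n then real (q i) / real (Suc m) else 0)" for m and q :: "nat \<Rightarrow> nat"
  \<comment> \<open>On the faces the labels take the values that Kuhn's lemma demands; by
    \<open>lo\<close> and \<open>hi\<close>, label 0 still means F \<le> 0 and label 1 still means 0
    \<le> F.\<close>
  define lab where "lab m q i = (if q i = 0 then 0 else if q i = Suc m then 1
      else if 0 < F (pt m q) i then (1::nat) else 0)" for m q i
  have pt_range: "\<forall>i. 0 \<le> pt m q i \<and> pt m q i \<le> 1" if "\<forall>i<n. q i \<le> Suc m" for m q
    using that by (auto simp: pt_def divide_simps simp del: of_nat_Suc)
  have lab0: "F (pt m q) i \<le> 0" if "\<forall>i<n. q i \<le> Suc m" "i < n" "lab m q i = 0" for m q i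
    using that pt_range[OF that(1)] by (auto simp: lab_def split: if_splits intro!: lo simp: pt_def)
  have lab1: "0 \<le> F (pt m q) i" if "\<forall>i<n. q i \<le> Suc m" "i < n" "lab m q i = 1" for m q i
    using that pt_range[OF that(1)] by (auto simp: lab_def split: if_splits intro!: hi simp: pt_def)
  \<comment> \<open>The two corners with opposite labels depend on \<open>i\<close>, so each
    component has its own pair \<open>a\<close>, \<open>b\<close>, all within one mesh width of the
    common point \<open>X\<close>.\<close>
  have step: "\<exists>X. (\<forall>i. 0 \<le> X i \<and> X i \<le> 1) \<and>
      (\<forall>i. \<exists>a b. i < n \<longrightarrow> F a i \<le> 0 \<and> 0 \<le> F b i \<and>
         (\<forall>j. \<bar>a j - X j\<bar> \<le> 1 / real (Suc m)) \<and> (\<forall>j. \<bar>b j - X j\<bar> \<le> 1 / real (Suc m)))" for m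
  proof -
    obtain q where q: "\<forall>i<n. q i < Suc m"
      and rs: "\<forall>i<n. \<exists>r s. (\<forall>j<n. q j \<le> r j \<and> r j \<le> q j + 1) \<and>
          (\<forall>j<n. q j \<le> s j \<and> s j \<le> q j + 1) \<and> lab m r i \<noteq> lab m s i"
      by (rule kuhn_lemma[of "Suc m" n "lab m"]) (auto simp: lab_def)
    have "\<exists>a b. F a i \<le> 0 \<and> 0 \<le> F b i \<and>
         (\<forall>j. \<bar>a j - pt m q j\<bar> \<le> 1 / real (Suc m)) \<and> (\<forall>j. \<bar>b j - pt m q j\<bar> \<le> 1 / real (Suc m))"
      if i: "i < n" for i
    proof -
      obtain r s where r: "\<forall>j<n. q j \<le> r j \<and> r j \<le> q j + 1"
        and s: "\<forall>j<n. q j \<le> s j \<and> s j \<le> q j + 1" and rs: "lab m r i \<noteq> lab m s i"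
        using rs i by blast
      have close: "\<bar>pt m r j - pt m q j\<bar> \<le> 1 / real (Suc m)"
        if "\<forall>j<n. q j \<le> r j \<and> r j \<le> q j + 1" for r j
        using that[rule_format, of j]
        by (auto simp: pt_def diff_divide_distrib[symmetric] divide_simps abs_if simp del: of_nat_Suc)
      have rl: "\<forall>i<n. r i \<le> Suc m" and sl: "\<forall>i<n. s i \<le> Suc m"
        using r s q by (metis Suc_eq_plus1 Suc_leI Suc_le_mono le_trans less_Suc_eq_le)+
      have "lab m r i \<le> 1" "lab m s i \<le> 1" by (auto simp: lab_def)
      then consider "lab m r i = 0" "lab m s i = 1" | "lab m r i = 1" "lab m s i = 0"
        using rs by linarith
      then show ?thesis
      proof cases
        case 1
        then show ?thesis using lab0[OF rl i] lab1[OF sl i] close[OF r] close[OF s] by blast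
      next
        case 2
        then show ?thesis using lab1[OF rl i] lab0[OF sl i] close[OF r] close[OF s] by blast
      qed
    qed
    moreover have "\<forall>i<n. q i \<le> Suc m" using q by auto
    ultimately show ?thesis
      by (intro exI[of _ "pt m q"] conjI pt_range) blast+
  qed
  obtain X where X: "\<And>m i. 0 \<le> X m i \<and> X m i \<le> 1"
    and AB: "\<And>m i. \<exists>a b. i < n \<longrightarrow> F a i \<le> 0 \<and> 0 \<le> F b i \<and>
         (\<forall>j. \<bar>a j - X m j\<bar> \<le> 1 / real (Suc m)) \<and> (\<forall>j. \<bar>b j - X m j\<bar> \<le> 1 / real (Suc m))"
    using step by metis
  then have "\<forall>m i. \<exists>a b. i < n \<longrightarrow> F a i \<le> 0 \<and> 0 \<le> F b i \<and>
         (\<forall>j. \<bar>a j - X m j\<bar> \<le> 1 / real (Suc m)) \<and> (\<forall>j. \<bar>b j - X m j\<bar> \<le> 1 / real (Suc m))"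
    by blast
  then obtain a b where ab: "\<And>m i. i < n \<Longrightarrow> F (a m i) i \<le> 0 \<and> 0 \<le> F (b m i) i \<and>
         (\<forall>j. \<bar>a m i j - X m j\<bar> \<le> 1 / real (Suc m)) \<and> (\<forall>j. \<bar>b m i j - X m j\<bar> \<le> 1 / real (Suc m))"
    unfolding choice_iff by blast
  \<comment> \<open>Tychonoff for the full product of intervals; a countable product is first
    countable, so compactness passes to sequences.\<close>
  have "compactin (product_topology (\<lambda>i::nat. euclidean) UNIV) (PiE UNIV (\<lambda>i. {0..1::real}))"
    by (simp add: compactin_PiE)
  then have "compact (PiE (UNIV::nat set) (\<lambda>i. {0..1::real}))"
    by (simp add: euclidean_product_topology)
  then have "seq_compact (PiE (UNIV::nat set) (\<lambda>i. {0..1::real}))"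
    by (rule compact_imp_seq_compact)
  moreover have "\<forall>m. X m \<in> PiE (UNIV::nat set) (\<lambda>i. {0..1::real})"
    using X by (auto simp: PiE_def)
  ultimately obtain x k where k: "strict_mono (k :: nat \<Rightarrow> nat)" and lim: "(X \<circ> k) \<longlonglongrightarrow> x"
    unfolding seq_compact_def by blast
  have limj: "(\<lambda>m. X (k m) j) \<longlonglongrightarrow> x j" for j
  proof -
    have "continuous_on UNIV (\<lambda>y::nat\<Rightarrow>real. y j)" by simp
    then have "isCont (\<lambda>y::nat\<Rightarrow>real. y j) x"
      using continuous_on_eq_continuous_at open_UNIV by blast
    from isCont_tendsto_compose[OF this lim] show ?thesis by (simp add: o_def)
  qed
  have zero: "(\<lambda>m. 1 / real (Suc (k m))) \<longlonglongrightarrow> 0"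
    using LIMSEQ_subseq_LIMSEQ[OF LIMSEQ_inverse_real_of_nat k] by (simp add: o_def inverse_eq_divide)
  have limc: "(\<lambda>m. c (k m)) \<longlonglongrightarrow> x" if c: "\<And>m j. \<bar>c m j - X m j\<bar> \<le> 1 / real (Suc m)" for c
  proof (rule tendsto_fun_componentwise)
    fix j
    have "(\<lambda>m. c (k m) j - X (k m) j) \<longlonglongrightarrow> 0"
      by (rule Lim_null_comparison[OF _ zero]) (use c in auto)
    from tendsto_add[OF this limj[of j]] show "(\<lambda>m. c (k m) j) \<longlonglongrightarrow> x j" by simp
  qed
  have "F x i = 0" if i: "i < n" for i
  proof -
    have cF: "isCont (\<lambda>x. F x i) x"
      using cont[OF i] by (simp add: continuous_on_eq_continuous_at)
    have "(\<lambda>m. F (a (k m) i) i) \<longlonglongrightarrow> F x i" "(\<lambda>m. F (b (k m) i) i) \<longlonglongrightarrow> F x i"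
      using ab[OF i] by (auto intro!: isCont_tendsto_compose[OF cF] limc[of "\<lambda>m. a m i"] limc[of "\<lambda>m. b m i"])
    then have "F x i \<le> 0" "0 \<le> F x i"
      using ab[OF i] by (auto intro: LIMSEQ_le_const LIMSEQ_le_const2)
    then show ?thesis by simp
  qed
  then show ?thesis by blast
qed

text \<open>Brouwer by contradiction: without a zero, let \<open>g\<close> send x to -R F(p x)/|F(p
  x)|, with \<open>p\<close> the radial retraction onto the ball of radius R. A fixed point of
  \<open>g\<close> lies on the sphere, where \<open>p\<close> is the identity, and its pairing with
  \<open>F\<close> is -R |F| < 0, against \<open>pos\<close>.\<close>

lemma zero_in_ball_nat:
  fixes F :: "(nat \<Rightarrow> real) \<Rightarrow> nat \<Rightarrow> real"
  assumes cont: "\<And>i. i < n \<Longrightarrow> continuous_on UNIV (\<lambda>x. F x i)" and R: "0 < R"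
    and pos: "\<And>x. (\<Sum>i<n. (x i)\<^sup>2) = R\<^sup>2 \<Longrightarrow> 0 \<le> (\<Sum>i<n. F x i * x i)"
  shows "\<exists>x. \<forall>i<n. F x i = 0"
proof (rule ccontr)
  assume none: "\<nexists>x. \<forall>i<n. F x i = 0"
  define nrm where "nrm x = sqrt (\<Sum>i<n. (x i)\<^sup>2)" for x :: "nat \<Rightarrow> real"
  define p where "p x = (\<lambda>i. R / max R (nrm x) * x i)" for x :: "nat \<Rightarrow> real"
  define g where "g x = (\<lambda>i. - (R * F (p x) i / nrm (F (p x))))" for x
  have nrm_pos: "nrm (F x) > 0" for x
  proof -
    obtain i where "i < n" "F x i \<noteq> 0" using none by blast
    then have "(\<Sum>i<n. (F x i)\<^sup>2) > 0" by (intro sum_pos2[of _ i]) auto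
    then show ?thesis by (simp add: nrm_def)
  qed
  have cx: "continuous_on UNIV (\<lambda>x::nat\<Rightarrow>real. x i)" for i by simp
  have cp: "continuous_on UNIV p"
    unfolding p_def nrm_def
    by (intro continuous_on_coordinatewise_then_product continuous_intros cx) (use R in auto)
  have cFp: "continuous_on UNIV (\<lambda>x. F (p x) i)" if "i < n" for i
    using continuous_on_compose2[OF cont[OF that] cp] by simp
  have cg: "continuous_on UNIV (\<lambda>x. g x i)" if "i < n" for i
    unfolding g_def nrm_def
    using nrm_pos by (intro continuous_intros cFp that ballI) (auto simp: nrm_def less_imp_neq[symmetric])
  have ng: "(\<Sum>i<n. (g x i)\<^sup>2) = R\<^sup>2" for x
  proof -
    have "(\<Sum>i<n. (g x i)\<^sup>2) = R\<^sup>2 / (nrm (F (p x)))\<^sup>2 * (\<Sum>i<n. (F (p x) i)\<^sup>2)"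
      by (simp add: g_def power_divide power_mult_distrib sum_distrib_left)
    also have "(\<Sum>i<n. (F (p x) i)\<^sup>2) = (nrm (F (p x)))\<^sup>2"
      by (simp add: nrm_def sum_nonneg)
    finally show ?thesis using nrm_pos[of "p x"] by simp
  qed
  have gR: "\<bar>g x i\<bar> \<le> R" if "i < n" for x i
  proof -
    have "(g x i)\<^sup>2 \<le> R\<^sup>2" unfolding ng[of x, symmetric]
      by (rule member_le_sum) (use that in auto)
    then show ?thesis using R by (simp add: abs_le_square_iff[symmetric])
  qed
  define sc where "sc x = (\<lambda>i. R * (2 * x i - 1))" for x :: "nat \<Rightarrow> real"
  have csc: "continuous_on UNIV sc"
    unfolding sc_def by (intro continuous_on_coordinatewise_then_product continuous_intros cx)
  \<comment> \<open>\<open>sc\<close> maps the unit cube onto the cube of side 2R centred at 0; the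
    components of \<open>g\<close> are at most R in absolute value, so x - g x has the right sign on
    every face.\<close>
  have "\<exists>x. \<forall>i<n. sc x i - g (sc x) i = 0"
  proof (rule poincare_miranda)
    show "continuous_on UNIV (\<lambda>x. sc x i - g (sc x) i)" if "i < n" for i
      using continuous_on_compose2[OF cg[OF that] csc]
      by (intro continuous_intros continuous_on_product_then_coordinatewise[OF csc]) auto
    show "sc x i - g (sc x) i \<le> 0" if "i < n" "x i = 0" for x i
      using gR[OF that(1), of "sc x"] that by (simp add: sc_def)
    show "0 \<le> sc x i - g (sc x) i" if "i < n" "x i = 1" for x i
      using gR[OF that(1), of "sc x"] that by (simp add: sc_def)
  qed
  then obtain y where y: "\<And>i. i < n \<Longrightarrow> y i = g y i" by auto
  have "(\<Sum>i<n. (y i)\<^sup>2) = R\<^sup>2"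
    using ng[of y] y by (metis (no_types, lifting) lessThan_iff sum.cong)
  then have yR: "nrm y = R" and "p y = y"
    using R by (auto simp: nrm_def p_def)
  then have "0 \<le> (\<Sum>i<n. F y i * y i)" using pos \<open>(\<Sum>i<n. (y i)\<^sup>2) = R\<^sup>2\<close> by blast
  also have "\<dots> = (\<Sum>i<n. - (R / nrm (F y) * (F y i)\<^sup>2))"
    using y \<open>p y = y\<close> by (intro sum.cong) (auto simp: g_def power2_eq_square)
  also have "\<dots> = - (R / nrm (F y) * (\<Sum>i<n. (F y i)\<^sup>2))"
    by (simp add: sum_negf sum_distrib_left)
  also have "(\<Sum>i<n. (F y i)\<^sup>2) = (nrm (F y))\<^sup>2"
    by (simp add: nrm_def sum_nonneg)
  also have "- (R / nrm (F y) * (nrm (F y))\<^sup>2) < 0"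
    using R nrm_pos[of y] by (simp add: power2_eq_square)
  finally show False by simp
qed

text \<open>Enumerating \<open>I\<close> transports the result to any finite index set; the Galerkin
  unknowns are indexed by pairs of a component and a frequency.\<close>

lemma zero_in_ball:
  fixes F :: "('b \<Rightarrow> real) \<Rightarrow> 'b \<Rightarrow> real"
  assumes fin: "finite I" and cont: "\<And>i. i \<in> I \<Longrightarrow> continuous_on UNIV (\<lambda>x. F x i)" and R: "0 < R"
    and pos: "\<And>x. (\<Sum>i\<in>I. (x i)\<^sup>2) = R\<^sup>2 \<Longrightarrow> 0 \<le> (\<Sum>i\<in>I. F x i * x i)"
  shows "\<exists>x. \<forall>i\<in>I. F x i = 0"
proof -
  obtain h where h: "bij_betw h {..<card I} I"
    using ex_bij_betw_nat_finite[OF fin] by (auto simp: lessThan_atLeast0)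
  define h' where "h' = inv_into {..<card I} h"
  have h'h: "h' (h i) = i" if "i < card I" for i
    using that h by (simp add: h'_def bij_betw_inv_into_left)
  define T where "T x = (\<lambda>b. x (h' b))" for x :: "nat \<Rightarrow> real"
  have cT: "continuous_on UNIV T"
    unfolding T_def by (intro continuous_on_coordinatewise_then_product) simp
  have "\<exists>x. \<forall>i<card I. F (T x) (h i) = 0"
  proof (rule zero_in_ball_nat[OF _ R])
    show "continuous_on UNIV (\<lambda>x. F (T x) (h i))" if "i < card I" for i
    proof -
      have "h i \<in> I" using that h by (auto simp: bij_betw_def)
      from continuous_on_compose2[OF cont[OF this] cT] show ?thesis by simp
    qed
    fix x :: "nat \<Rightarrow> real"
    assume x: "(\<Sum>i<card I. (x i)\<^sup>2) = R\<^sup>2"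
    have "(\<Sum>b\<in>I. (T x b)\<^sup>2) = (\<Sum>i<card I. (T x (h i))\<^sup>2)"
      by (rule sum.reindex_bij_betw[OF h, symmetric])
    also have "\<dots> = R\<^sup>2" unfolding x[symmetric] by (intro sum.cong) (auto simp: T_def h'h)
    finally have "0 \<le> (\<Sum>b\<in>I. F (T x) b * T x b)" by (rule pos)
    also have "\<dots> = (\<Sum>i<card I. F (T x) (h i) * T x (h i))"
      by (rule sum.reindex_bij_betw[OF h, symmetric])
    also have "\<dots> = (\<Sum>i<card I. F (T x) (h i) * x i)"
      by (intro sum.cong) (auto simp: T_def h'h)
    finally show "0 \<le> (\<Sum>i<card I. F (T x) (h i) * x i)" .
  qed
  then obtain x where x: "\<And>i. i < card I \<Longrightarrow> F (T x) (h i) = 0" by blast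
  have "F (T x) b = 0" if "b \<in> I" for b
    using that h x by (metis bij_betw_imp_surj_on imageE lessThan_iff)
  then show ?thesis by blast
qed

subsection \<open>Galerkin approximation\<close>

text \<open>Cosines for positive and sines for negative \<open>k\<close>, so that \<open>trig k' = - k trig (- k)\<close>; \<open>trig 0 = 0\<close> is never used.\<close>

definition trig :: "int \<Rightarrow> real \<Rightarrow> real" where
  "trig k t = (if k > 0 then cos (of_int k * t) else - sin (of_int k * t))"

lemma trig_has_derivative:
  "(trig k has_real_derivative - of_int k * trig (- k) t) (at t within S)"
proof (cases "k > 0")
  case True
  then have "trig k = (\<lambda>t. cos (of_int k * t))" "trig (- k) t = sin (of_int k * t)"
    by (auto simp: trig_def fun_eq_iff)
  then show ?thesis by (auto intro!: derivative_eq_intros)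
next
  case False
  then have *: "trig k = (\<lambda>t. - sin (of_int k * t))" by (auto simp: trig_def fun_eq_iff)
  have eq: "- of_int k * trig (- k) t = - (of_int k * cos (of_int k * t))"
    using False by (cases "k = 0") (auto simp: trig_def)
  have "((\<lambda>t. - sin (of_int k * t)) has_real_derivative - (of_int k * cos (of_int k * t))) (at t within S)"
    by (auto intro!: derivative_eq_intros)
  then show ?thesis unfolding * eq .
qed

lemma continuous_on_trig [continuous_intros]:
  "continuous_on S f \<Longrightarrow> continuous_on S (\<lambda>x. trig k (f x))"
  by (rule continuous_on_compose2[of UNIV "trig k"]) (auto intro: DERIV_continuous_on trig_has_derivative)

lemma abs_trig_le_one: "\<bar>trig k t\<bar> \<le> 1"
  by (simp add: trig_def)

lemma trig_periodic: "trig k (t + 2 * pi) = trig k t"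
proof -
  have "of_int k * (t + 2 * pi) = of_int k * t + 2 * pi * of_int k" by (simp add: algebra_simps)
  then show ?thesis
    by (simp only: trig_def sin_add cos_add sin_int_2pin cos_int_2pin) simp
qed

lemma trig_lipschitz: "\<bar>trig k t - trig k u\<bar> \<le> \<bar>of_int k\<bar> * \<bar>t - u\<bar>"
proof -
  have "norm (trig k t - trig k u) \<le> \<bar>of_int k\<bar> * norm (t - u)"
  proof (rule field_differentiable_bound[of UNIV])
    show "norm (- real_of_int k * trig (- k) z) \<le> \<bar>of_int k\<bar>" for z
      using abs_trig_le_one[of "- k" z] by (simp add: abs_mult mult_left_le)
    show "(trig k has_real_derivative - real_of_int k * trig (- k) z) (at z within UNIV)" for z
      by (rule trig_has_derivative)
  qed auto
  then show ?thesis by simp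
qed

text \<open>Interpolation between the Lipschitz bound and the trivial bound 2, split at |k| |t - u|
  = 1.\<close>

lemma trig_holder:
  assumes "0 \<le> \<delta>" "\<delta> \<le> 1"
  shows "\<bar>trig k t - trig k u\<bar> \<le> 2 * \<bar>of_int k\<bar> powr \<delta> * \<bar>t - u\<bar> powr \<delta>"
proof (cases "k = 0 \<or> t = u")
  case True
  then show ?thesis by (auto simp: trig_def)
next
  case False
  define x where "x = \<bar>real_of_int k\<bar> * \<bar>t - u\<bar>"
  have x: "x > 0" using False by (simp add: x_def)
  have "\<bar>trig k t - trig k u\<bar> \<le> 2 * x powr \<delta>"
  proof (cases "x \<le> 1")
    case True
    have "x = x powr 1" using x by simp
    also have "\<dots> \<le> x powr \<delta>" using x True assms by (intro powr_mono') auto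
    finally show ?thesis using trig_lipschitz[of k t u] x by (auto simp: x_def)
  next
    case False
    then have "1 \<le> x powr \<delta>" using assms by (intro ge_one_powr_ge_zero) auto
    then show ?thesis using abs_trig_le_one[of k t] abs_trig_le_one[of k u] by linarith
  qed
  then show ?thesis by (simp add: x_def powr_mult mult.assoc)
qed

lemma integral_deriv_periodic:
  fixes f f' :: "real \<Rightarrow> 'a::banach"
  assumes "\<And>t. (f has_vector_derivative f' t) (at t)" "f (2 * pi) = f 0"
  shows "(f' has_integral 0) {0..2 * pi}"
proof -
  have "(f' has_integral f (2 * pi) - f 0) {0..2 * pi}"
    by (rule fundamental_theorem_of_calculus)
      (auto intro: assms(1)[THEN has_vector_derivative_at_within])
  then show ?thesis using assms(2) by simp
qed

lemma trig_2pi: "trig k (2 * pi) = trig k 0"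
  using trig_periodic[of k 0] by simp

text \<open>Up to constants, each case writes the product as the derivative of a periodic function:
  the Wronskian of \<open>trig j\<close> and \<open>trig k\<close> if the squares of the frequencies
  differ, the square of \<open>trig k\<close> if j = -k, and \<open>trig k * trig (- k)\<close> if j
  = k.\<close>

lemma trig_orthogonal:
  assumes "j \<noteq> 0" "k \<noteq> 0"
  shows "((\<lambda>t. trig j t * trig k t) has_integral (if j = k then pi else 0)) {0..2 * pi}"
proof -
  note d = trig_has_derivative[THEN DERIV_cong]
  consider "\<bar>j\<bar> \<noteq> \<bar>k\<bar>" | "j = - k" | "j = k" by linarith
  then show ?thesis
  proof cases
    case 1
    define c where "c = real_of_int k ^ 2 - real_of_int j ^ 2"
    have c: "c \<noteq> 0" using 1 by (simp add: c_def power2_eq_iff) linarith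
    have "((\<lambda>t. c * (trig j t * trig k t)) has_integral 0) {0..2 * pi}"
    proof (rule integral_deriv_periodic)
      show "((\<lambda>t. - of_int j * trig (- j) t * trig k t + of_int k * trig j t * trig (- k) t)
          has_vector_derivative c * (trig j t * trig k t)) (at t)" for t
        unfolding has_real_derivative_iff_has_vector_derivative[symmetric]
        by (rule derivative_eq_intros trig_has_derivative refl)+
           (simp add: c_def algebra_simps power2_eq_square)
    qed (simp add: trig_2pi)
    from has_integral_mult_right[OF this, of "1 / c"] c 1 show ?thesis by auto
  next
    case 2
    have "((\<lambda>t. - 2 * of_int k * (trig j t * trig k t)) has_integral 0) {0..2 * pi}"
    proof (rule integral_deriv_periodic)
      show "((\<lambda>t. (trig k t)\<^sup>2) has_vector_derivative - 2 * of_int k * (trig j t * trig k t)) (at t)" for t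
        unfolding has_real_derivative_iff_has_vector_derivative[symmetric]
        by (rule derivative_eq_intros trig_has_derivative refl)+ (simp add: 2 algebra_simps)
    qed (simp add: trig_2pi)
    from has_integral_mult_right[OF this, of "- 1 / (2 * of_int k)"] assms 2 show ?thesis by auto
  next
    case 3
    have sq: "(trig k t)\<^sup>2 + (trig (- k) t)\<^sup>2 = 1" for t
      using assms by (simp add: trig_def)
    have "((\<lambda>t. of_int k * (2 * (trig k t)\<^sup>2 - 1)) has_integral 0) {0..2 * pi}"
    proof (rule integral_deriv_periodic)
      show "((\<lambda>t. trig k t * trig (- k) t) has_vector_derivative of_int k * (2 * (trig k t)\<^sup>2 - 1)) (at t)" for t
        unfolding has_real_derivative_iff_has_vector_derivative[symmetric] sq[of t, symmetric]
        by (rule derivative_eq_intros trig_has_derivative refl)+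
          (simp add: algebra_simps power2_eq_square)
    qed (simp add: trig_2pi)
    from has_integral_mult_right[OF this, of "1 / (2 * of_int k)"] assms
    have "((\<lambda>t. (trig k t)\<^sup>2 - 1 / 2) has_integral 0) {0..2 * pi}" by (simp add: diff_divide_distrib)
    from has_integral_add[OF this has_integral_const_real[of "1/2" 0 "2 * pi"]]
    show ?thesis by (simp add: 3 power2_eq_square)
  qed
qed

section \<open>Trigonometric polynomials of mean zero and weighted sums of their
  coefficients\<close>

definition trig_coeff :: "int \<Rightarrow> (real \<Rightarrow> real) \<Rightarrow> real" where
  "trig_coeff k f = (1 / pi) * integral {0..2 * pi} (\<lambda>t. f t * trig k t)"

text \<open>Leaving out frequency 0 builds mean zero into the trial space; the mean of the solution
  is prescribed separately.\<close>

definition freqs :: "nat \<Rightarrow> int set" where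
  "freqs N = {k. k \<noteq> 0 \<and> \<bar>k\<bar> \<le> int N}"

definition tpoly :: "nat \<Rightarrow> ('n \<times> int \<Rightarrow> real) \<Rightarrow> real \<Rightarrow> real^'n::finite" where
  "tpoly N x t = (\<chi> i. \<Sum>k\<in>freqs N. x (i, k) * trig k t)"

lemma finite_freqs [simp]: "finite (freqs N)"
  by (rule finite_subset[of _ "{- int N..int N}"]) (auto simp: freqs_def)

text \<open>Twice a convergent series dominates every cutoff. The bound is uniform in
  \<open>N\<close>, and the exponent above 1 needed here is what \<open>s > 1/2\<close>
  provides.\<close>

lemma sum_freqs_powr_bound:
  fixes r :: real
  assumes "1 < r"
  shows "\<exists>Z\<ge>0. \<forall>N. (\<Sum>k\<in>freqs N. \<bar>of_int k\<bar> powr - r) \<le> Z"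
proof -
  have sm: "summable (\<lambda>n. real n powr - r)"
    using assms by (simp add: summable_real_powr_iff)
  have "(\<Sum>k\<in>freqs N. \<bar>of_int k\<bar> powr - r) \<le> 2 * (\<Sum>n. real n powr - r)" for N
  proof -
    have "freqs N \<subseteq> int ` {..N} \<union> (\<lambda>n. - int n) ` {..N}"
    proof
      fix k assume "k \<in> freqs N"
      then have "nat \<bar>k\<bar> \<le> N" "k = int (nat \<bar>k\<bar>) \<or> k = - int (nat \<bar>k\<bar>)"
        by (auto simp: freqs_def)
      then show "k \<in> int ` {..N} \<union> (\<lambda>n. - int n) ` {..N}"
        by (metis UnI1 UnI2 atMost_iff imageI)
    qed
    then have "(\<Sum>k\<in>freqs N. \<bar>of_int k\<bar> powr - r)
        \<le> (\<Sum>k\<in>int ` {..N} \<union> (\<lambda>n. - int n) ` {..N}. \<bar>real_of_int k\<bar> powr - r)"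
      by (intro sum_mono2) auto
    also have "\<dots> \<le> (\<Sum>k\<in>int ` {..N}. \<bar>real_of_int k\<bar> powr - r) + (\<Sum>k\<in>(\<lambda>n. - int n) ` {..N}. \<bar>real_of_int k\<bar> powr - r)"
      by (subst sum.union_inter[symmetric]) (auto intro!: sum_nonneg)
    also have "\<dots> = 2 * (\<Sum>n\<le>N. real n powr - r)"
      by (simp add: sum.reindex inj_on_def)
    also have "\<dots> \<le> 2 * (\<Sum>n. real n powr - r)"
      using sum_le_suminf[OF sm, of "{..N}"] by simp
    finally show ?thesis .
  qed
  moreover have "0 \<le> 2 * (\<Sum>n. real n powr - r)" using sm by (intro mult_nonneg_nonneg suminf_nonneg) auto
  ultimately show ?thesis by blast
qed

lemma weighted_Cauchy_Schwarz:
  fixes x d w :: "'j \<Rightarrow> real"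
  assumes "\<And>j. j \<in> J \<Longrightarrow> 0 < w j"
  shows "(\<Sum>j\<in>J. x j * d j)\<^sup>2 \<le> (\<Sum>j\<in>J. w j * (x j)\<^sup>2) * (\<Sum>j\<in>J. (d j)\<^sup>2 / w j)"
proof -
  have "(\<Sum>j\<in>J. x j * d j) = (\<Sum>j\<in>J. (sqrt (w j) * x j) * (d j / sqrt (w j)))"
    using assms by (intro sum.cong) (auto simp: less_imp_neq[symmetric])
  also have "\<dots>\<^sup>2 \<le> (\<Sum>j\<in>J. (sqrt (w j) * x j)\<^sup>2) * (\<Sum>j\<in>J. (d j / sqrt (w j))\<^sup>2)"
    by (rule Cauchy_Schwarz_ineq_sum)
  also have "\<dots> = (\<Sum>j\<in>J. w j * (x j)\<^sup>2) * (\<Sum>j\<in>J. (d j)\<^sup>2 / w j)"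
    using assms by (intro arg_cong2[of _ _ _ _ "(*)"] sum.cong)
      (auto simp: power_mult_distrib power_divide less_imp_le)
  finally show ?thesis .
qed

lemma trig_coeff_tpoly:
  assumes "k \<in> freqs N"
  shows "trig_coeff k (\<lambda>t. tpoly N x t $ i) = x (i, k)"
proof -
  have "((\<lambda>t. \<Sum>j\<in>freqs N. x (i, j) * (trig j t * trig k t)) has_integral
      (\<Sum>j\<in>freqs N. x (i, j) * (if j = k then pi else 0))) {0..2 * pi}"
    using assms by (intro has_integral_sum has_integral_mult_right trig_orthogonal finite_freqs) (simp_all add: freqs_def)
  moreover have "(\<Sum>j\<in>freqs N. x (i, j) * (if j = k then pi else 0)) = x (i, k) * pi"
    using assms by (simp add: if_distrib sum.delta cong: if_cong)
  ultimately have "integral {0..2 * pi} (\<lambda>t. tpoly N x t $ i * trig k t) = x (i, k) * pi"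
    by (simp add: tpoly_def sum_distrib_right mult.assoc integral_unique)
  then show ?thesis by (simp add: trig_coeff_def)
qed

lemma integral_tpoly: "integral {0..2 * pi} (\<lambda>t. tpoly N x t $ i) = 0"
proof -
  have t0: "(trig k has_integral 0) {0..2 * pi}" if "k \<noteq> 0" for k
  proof -
    have "((\<lambda>t. of_int k * trig k t) has_integral 0) {0..2 * pi}"
      by (rule integral_deriv_periodic[of "trig (- k)"])
        (use trig_has_derivative[of "- k"] in
          \<open>auto simp: has_real_derivative_iff_has_vector_derivative trig_2pi\<close>)
    from has_integral_mult_right[OF this, of "1 / of_int k"] that show ?thesis by simp
  qed
  have "((\<lambda>t. \<Sum>k\<in>freqs N. x (i, k) * trig k t) has_integral (\<Sum>k\<in>freqs N. x (i, k) * 0)) {0..2 * pi}"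
    by (intro has_integral_sum has_integral_mult_right t0 finite_freqs) (auto simp: freqs_def)
  then show ?thesis by (simp add: tpoly_def integral_unique)
qed

lemma tpoly_periodic: "tpoly N x (t + 2 * pi) = tpoly N x t"
  by (simp add: tpoly_def trig_periodic)

lemma has_vector_derivative_vec:
  fixes f :: "real \<Rightarrow> real^'n::finite"
  shows "(f has_vector_derivative f') (at t within S) \<longleftrightarrow>
    (\<forall>i. ((\<lambda>t. f t $ i) has_real_derivative f' $ i) (at t within S))"
proof -
  have "(f has_vector_derivative f') (at t within S) \<longleftrightarrow>
    (\<forall>b\<in>Basis. ((\<lambda>t. f t \<bullet> b) has_derivative (\<lambda>h. h *\<^sub>R f' \<bullet> b)) (at t within S))"
    unfolding has_vector_derivative_def by (rule has_derivative_componentwise_within)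
  also have "\<dots> \<longleftrightarrow> (\<forall>i. ((\<lambda>t. f t $ i) has_derivative (\<lambda>h. h *\<^sub>R f' $ i)) (at t within S))"
    by (auto simp: Basis_vec_def inner_axis)
  finally show ?thesis
    by (simp add: has_field_derivative_def mult.commute[of _ "f' $ _"])
qed

lemma tpoly_has_derivative:
  "(tpoly N x has_vector_derivative (\<chi> i. \<Sum>k\<in>freqs N. x (i, k) * (- of_int k * trig (- k) t))) (at t within S)"
  unfolding has_vector_derivative_vec tpoly_def vec_lambda_beta
  by (intro allI DERIV_sum DERIV_cmult trig_has_derivative)

text \<open>A Sobolev embedding on the side of the coefficients: by Cauchy--Schwarz with weights
  |k|^p_i, a growth |k|^(\<sigma>/4) of \<open>d\<close> leaves the summable tail |k|^-(1 +
  \<sigma>/2). The choices of \<open>d\<close> are the coefficients of the forcing for the energy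
  estimate, \<open>trig k t\<close> for the sup bound, and its increments for the Hoelder
  bound.\<close>

lemma weighted_coeff_sum_bound:
  fixes p :: "'n::finite \<Rightarrow> real"
  assumes p: "\<And>i. 1 + \<sigma> \<le> p i" and \<sigma>: "0 < \<sigma>" "\<sigma> \<le> 1"
    and Z: "\<And>N. (\<Sum>k\<in>freqs N. \<bar>of_int k\<bar> powr - (1 + \<sigma> / 2)) \<le> Z"
    and S: "(\<Sum>i\<in>UNIV. \<Sum>k\<in>freqs N. \<bar>of_int k\<bar> powr p i * (x (i, k))\<^sup>2) \<le> \<rho>\<^sup>2" and \<rho>: "0 \<le> \<rho>"
    and L: "0 \<le> L" and d: "\<And>k. k \<in> freqs N \<Longrightarrow> \<bar>d k\<bar> \<le> L * \<bar>of_int k\<bar> powr (\<sigma> / 4)"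
  shows "\<bar>\<Sum>k\<in>freqs N. x (i, k) * d k\<bar> \<le> L * \<rho> * sqrt Z"
proof -
  have pos: "1 \<le> \<bar>real_of_int k\<bar>" if "k \<in> freqs N" for k
    using that by (auto simp: freqs_def)
  have "(\<Sum>k\<in>freqs N. x (i, k) * d k)\<^sup>2
      \<le> (\<Sum>k\<in>freqs N. \<bar>of_int k\<bar> powr p i * (x (i, k))\<^sup>2) * (\<Sum>k\<in>freqs N. (d k)\<^sup>2 / \<bar>of_int k\<bar> powr p i)"
    by (rule weighted_Cauchy_Schwarz) (use pos in force)
  also have "\<dots> \<le> \<rho>\<^sup>2 * (L\<^sup>2 * Z)"
  proof (rule mult_mono)
    have "(\<Sum>k\<in>freqs N. \<bar>of_int k\<bar> powr p i * (x (i, k))\<^sup>2)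
        \<le> (\<Sum>i\<in>UNIV. \<Sum>k\<in>freqs N. \<bar>of_int k\<bar> powr p i * (x (i, k))\<^sup>2)"
      by (rule member_le_sum[of i UNIV "\<lambda>i. \<Sum>k\<in>freqs N. \<bar>of_int k\<bar> powr p i * (x (i, k))\<^sup>2"])
        (auto intro!: sum_nonneg)
    then show "(\<Sum>k\<in>freqs N. \<bar>of_int k\<bar> powr p i * (x (i, k))\<^sup>2) \<le> \<rho>\<^sup>2" using S by linarith
    have "(\<Sum>k\<in>freqs N. (d k)\<^sup>2 / \<bar>of_int k\<bar> powr p i)
        \<le> (\<Sum>k\<in>freqs N. L\<^sup>2 * \<bar>of_int k\<bar> powr - (1 + \<sigma> / 2))"
    proof (rule sum_mono)
      fix k assume k: "k \<in> freqs N"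
      have "(d k)\<^sup>2 \<le> (L * \<bar>of_int k\<bar> powr (\<sigma> / 4))\<^sup>2"
        using d[OF k] by (metis abs_ge_zero power2_abs power_mono)
      also have "\<dots> = L\<^sup>2 * \<bar>of_int k\<bar> powr (\<sigma> / 2)"
        by (simp add: power_mult_distrib power2_eq_square flip: powr_add)
      finally have "(d k)\<^sup>2 / \<bar>of_int k\<bar> powr p i \<le> L\<^sup>2 * \<bar>of_int k\<bar> powr (\<sigma> / 2) / \<bar>of_int k\<bar> powr p i"
        by (rule divide_right_mono) auto
      also have "\<dots> = L\<^sup>2 * \<bar>of_int k\<bar> powr (\<sigma> / 2 - p i)"
        by (simp add: powr_diff)
      also have "\<dots> \<le> L\<^sup>2 * \<bar>of_int k\<bar> powr - (1 + \<sigma> / 2)"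
        using pos[OF k] p[of i] by (intro mult_left_mono powr_mono) auto
      finally show "(d k)\<^sup>2 / \<bar>of_int k\<bar> powr p i \<le> L\<^sup>2 * \<bar>of_int k\<bar> powr - (1 + \<sigma> / 2)" .
    qed
    also have "\<dots> \<le> L\<^sup>2 * Z"
      using Z[of N] by (simp add: sum_distrib_left[symmetric] mult_left_mono)
    finally show "(\<Sum>k\<in>freqs N. (d k)\<^sup>2 / \<bar>of_int k\<bar> powr p i) \<le> L\<^sup>2 * Z" .
  qed (auto intro!: sum_nonneg)
  also have "\<dots> = (L * \<rho>)\<^sup>2 * Z" by (simp add: power_mult_distrib)
  finally have "sqrt ((\<Sum>k\<in>freqs N. x (i, k) * d k)\<^sup>2) \<le> sqrt ((L * \<rho>)\<^sup>2 * Z)"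
    by (rule real_sqrt_le_mono)
  then show ?thesis using L \<rho> by (simp add: real_sqrt_mult)
qed

text \<open>The sum is a multiple of the integral of the derivative of \<open>H (y + w)\<close> over a period.\<close>

lemma galerkin_nonlinear_term:
  fixes H :: "real^'n::finite \<Rightarrow> real"
  assumes H: "\<And>x. (H has_derivative (\<lambda>h. G x \<bullet> h)) (at x)" and G: "continuous_on UNIV G"
  shows "(\<Sum>i\<in>UNIV. \<Sum>k\<in>freqs N. of_int k * trig_coeff (- k) (\<lambda>t. G (y + tpoly N x t) $ i) * x (i, k)) = 0"
proof -
  define w' where "w' t = (\<chi> i. \<Sum>k\<in>freqs N. x (i, k) * (- of_int k * trig (- k) t))" for t
  have dw: "(tpoly N x has_vector_derivative w' t) (at t within S)" for t S
    unfolding w'_def by (rule tpoly_has_derivative)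
  have cw: "continuous_on S (tpoly N x)" for S
    using dw by (intro continuous_on_vector_derivative) blast
  have "((\<lambda>t. G (y + tpoly N x t) \<bullet> w' t) has_integral 0) {0..2 * pi}"
  proof (rule integral_deriv_periodic)
    fix t
    have "((\<lambda>t. y + tpoly N x t) has_derivative (\<lambda>h. h *\<^sub>R w' t)) (at t)"
      using dw[of t UNIV] by (auto simp: has_vector_derivative_def intro!: derivative_eq_intros)
    from diff_chain_at[OF this H]
    show "((\<lambda>t. H (y + tpoly N x t)) has_vector_derivative G (y + tpoly N x t) \<bullet> w' t) (at t)"
      by (simp add: has_vector_derivative_def o_def)
  next
    show "H (y + tpoly N x (2 * pi)) = H (y + tpoly N x 0)"
      using tpoly_periodic[of N x 0] by simp
  qed
  moreover have "((\<lambda>t. G (y + tpoly N x t) \<bullet> w' t) has_integral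
     (\<Sum>i\<in>UNIV. \<Sum>k\<in>freqs N. - (of_int k * x (i, k)) * (pi * trig_coeff (- k) (\<lambda>t. G (y + tpoly N x t) $ i)))) {0..2 * pi}"
  proof -
    have "((\<lambda>t. \<Sum>i\<in>UNIV. \<Sum>k\<in>freqs N. - (of_int k * x (i, k)) * (G (y + tpoly N x t) $ i * trig (- k) t)) has_integral
     (\<Sum>i\<in>UNIV. \<Sum>k\<in>freqs N. - (of_int k * x (i, k)) * (pi * trig_coeff (- k) (\<lambda>t. G (y + tpoly N x t) $ i)))) {0..2 * pi}"
    proof (intro has_integral_sum has_integral_mult_right finite finite_freqs)
      fix i k
      have "continuous_on {0..2*pi} (\<lambda>t. G (y + tpoly N x t) $ i * trig (- k) t)"
        by (intro continuous_intros continuous_on_compose2[OF G] cw) auto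
      then show "((\<lambda>t. G (y + tpoly N x t) $ i * trig (- k) t) has_integral
         (pi * trig_coeff (- k) (\<lambda>t. G (y + tpoly N x t) $ i))) {0..2 * pi}"
        by (simp add: trig_coeff_def has_integral_integral[symmetric] integrable_continuous_interval)
    qed
    then show ?thesis
      by (simp add: inner_vec_def w'_def sum_distrib_left algebra_simps)
  qed
  ultimately have "(\<Sum>i\<in>UNIV. \<Sum>k\<in>freqs N. - (of_int k * x (i, k)) * (pi * trig_coeff (- k) (\<lambda>t. G (y + tpoly N x t) $ i))) = 0"
    using has_integral_unique by blast
  then have "- pi * (\<Sum>i\<in>UNIV. \<Sum>k\<in>freqs N. of_int k * trig_coeff (- k) (\<lambda>t. G (y + tpoly N x t) $ i) * x (i, k)) = 0"
    by (simp add: sum_distrib_left algebra_simps sum_negf)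
  then show ?thesis by simp
qed

lemma continuous_on_trig_coeff_tpoly:
  fixes G :: "real^'n::finite \<Rightarrow> real^'n"
  assumes G: "continuous_on UNIV G"
  shows "continuous_on UNIV (\<lambda>x. trig_coeff k (\<lambda>t. G (y + tpoly N x t) $ i))"
proof -
  have cx: "continuous_on (UNIV \<times> cbox 0 (2 * pi)) (\<lambda>z. fst z j)" for j :: "'n \<times> int"
    by (rule continuous_on_compose2[OF continuous_on_product_coordinates continuous_on_fst])
      (auto intro: continuous_intros)
  have "continuous_on (UNIV \<times> cbox 0 (2 * pi)) (\<lambda>(x, t). G (y + tpoly N x t) $ i * trig k t)"
    unfolding tpoly_def case_prod_beta
    by (intro continuous_intros continuous_on_compose2[OF G] cx) auto
  from integral_continuous_on_param[OF this] show ?thesis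
    unfolding trig_coeff_def by (intro continuous_intros) simp
qed

lemma trig_coeff_bounded:
  assumes "continuous_on {0..2 * pi} f"
  shows "\<exists>B. \<forall>k. \<bar>trig_coeff k f\<bar> \<le> B"
proof -
  have "compact (f ` {0..2 * pi})" using assms by (intro compact_continuous_image) auto
  then obtain B where B: "\<And>t. t \<in> {0..2 * pi} \<Longrightarrow> norm (f t) \<le> B"
    by (meson compact_imp_bounded bounded_iff imageI)
  have B0: "0 \<le> B" using B[of 0] by force
  have "norm (integral {0..2 * pi} (\<lambda>t. f t * trig k t)) \<le> B * (2 * pi - 0)" for k
  proof (rule integral_bound)
    show "norm (f t * trig k t) \<le> B" if "t \<in> {0..2 * pi}" for t
      using mult_mono[OF B[OF that] abs_trig_le_one[of k t] B0] by (simp add: abs_mult)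
  qed (auto intro!: continuous_intros assms)
  then have "\<bar>trig_coeff k f\<bar> \<le> 2 * B" for k
    by (simp add: trig_coeff_def abs_mult divide_le_eq field_simps)
  then show ?thesis by blast
qed

text \<open>The residual of the projected system, paired with the unknown, is the weighted energy
  minus the matrix term plus the forcing term, because the nonlinear contribution vanishes. Since M
  < 1 this is nonnegative once the energy is large, so a zero exists, and the same estimate at the
  zero bounds its energy independently of \<open>N\<close>.\<close>

lemma galerkin_solution:
  fixes p :: "'n::finite \<Rightarrow> real" and G :: "real^'n \<Rightarrow> real^'n" and A :: "real^'n^'n"
    and e :: "real \<Rightarrow> real^'n"
  assumes H: "\<And>x. (H has_derivative (\<lambda>h. G x \<bullet> h)) (at x)" and G: "continuous_on UNIV G"
    and p: "\<And>i. 1 + \<sigma> \<le> p i" and \<sigma>: "0 < \<sigma>" "\<sigma> \<le> 1"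
    and Z: "\<And>N. (\<Sum>k\<in>freqs N. \<bar>of_int k\<bar> powr - (1 + \<sigma> / 2)) \<le> Z"
    and A: "\<And>y. (A *v y) \<bullet> y \<le> M * (y \<bullet> y)" and M: "0 \<le> M" "M < 1"
    and e: "continuous_on UNIV e"
  shows "\<exists>\<rho>\<ge>0. \<forall>N. \<exists>x.
     (\<Sum>i\<in>UNIV. \<Sum>k\<in>freqs N. \<bar>of_int k\<bar> powr p i * (x (i, k))\<^sup>2) \<le> \<rho>\<^sup>2 \<and>
     (\<forall>i. \<forall>k\<in>freqs N. \<bar>of_int k\<bar> powr p i * x (i, k) =
        of_int k * trig_coeff (- k) (\<lambda>t. G (y + tpoly N x t) $ i) + (\<Sum>j\<in>UNIV. A $ i $ j * x (j, k)) - trig_coeff k (\<lambda>t. e t $ i))"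
proof -
  have "\<exists>B. \<forall>k. \<bar>trig_coeff k (\<lambda>t. e t $ i)\<bar> \<le> B" for i
    by (intro trig_coeff_bounded continuous_intros continuous_on_subset[OF e]) auto
  then obtain B0 where B0: "\<And>i k. \<bar>trig_coeff k (\<lambda>t. e t $ i)\<bar> \<le> B0 i" by metis
  define B where "B = (\<Sum>i\<in>UNIV. B0 i)"
  have B0_nonneg: "0 \<le> B0 i" for i using B0[of 0 i] by linarith
  have B: "\<bar>trig_coeff k (\<lambda>t. e t $ i)\<bar> \<le> B" for i k
    using B0[of k i] member_le_sum[of i UNIV B0] B0_nonneg by (force simp: B_def)
  have Bnn: "0 \<le> B" unfolding B_def by (intro sum_nonneg B0_nonneg)
  have Znn: "0 \<le> Z" using Z[of 0] by (simp add: freqs_def)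
  \<comment> \<open>The value of r = sqrt S from which (1 - M) r^2 dominates n B sqrt Z r, with n
    the number of components; only M, the embedding constant and the forcing enter, hence nothing
    depends on \<open>N\<close>.\<close>
  define \<rho> where "\<rho> = real CARD('n) * B * sqrt Z / (1 - M)"
  have \<rho>nn: "0 \<le> \<rho>" using Bnn Znn M by (simp add: \<rho>_def)
  show ?thesis
  proof (intro exI[of _ \<rho>] conjI allI \<rho>nn)
    fix N
    define I where "I = (UNIV :: 'n set) \<times> freqs N"
    have sumI: "(\<Sum>b\<in>I. f b) = (\<Sum>i\<in>UNIV. \<Sum>k\<in>freqs N. f (i, k))" for f :: "_ \<Rightarrow> real"
      unfolding I_def by (simp add: sum.cartesian_product)
    define F where "F x b = (case b of (i, k) \<Rightarrow> \<bar>of_int k\<bar> powr p i * x (i, k)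
       - of_int k * trig_coeff (- k) (\<lambda>t. G (y + tpoly N x t) $ i) - (\<Sum>j\<in>UNIV. A $ i $ j * x (j, k))
       + trig_coeff k (\<lambda>t. e t $ i))" for x b
    define S where "S x = (\<Sum>i\<in>UNIV. \<Sum>k\<in>freqs N. \<bar>of_int k\<bar> powr p i * (x (i, k))\<^sup>2)" for x :: "'n \<times> int \<Rightarrow> real"
    have Snn: "0 \<le> S x" for x unfolding S_def by (intro sum_nonneg) auto
    have cF: "continuous_on UNIV (\<lambda>x. F x b)" for b
      unfolding F_def case_prod_beta
      by (intro continuous_intros continuous_on_trig_coeff_tpoly G continuous_on_product_coordinates)
    \<comment> \<open>A Poincare inequality: frequencies have modulus at least 1, so all weights are
      at least 1. It lets the energy absorb the matrix term under M < 1 alone.\<close>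
    have SX: "(\<Sum>b\<in>I. (x b)\<^sup>2) \<le> S x" for x
      unfolding sumI S_def
    proof (intro sum_mono)
      fix i k assume "k \<in> freqs N"
      then have "1 \<le> \<bar>real_of_int k\<bar>" by (auto simp: freqs_def)
      then have "1 \<le> \<bar>real_of_int k\<bar> powr p i"
        using p[of i] \<sigma> by (intro ge_one_powr_ge_zero) auto
      then show "(x (i, k))\<^sup>2 \<le> \<bar>of_int k\<bar> powr p i * (x (i, k))\<^sup>2"
        by (simp add: mult_le_cancel_right1)
    qed
    have energy: "(1 - M) * S x - real CARD('n) * B * sqrt Z * sqrt (S x) \<le> (\<Sum>b\<in>I. F x b * x b)" for x
    proof -
      have "(\<Sum>b\<in>I. F x b * x b) = S x
         - (\<Sum>i\<in>UNIV. \<Sum>k\<in>freqs N. of_int k * trig_coeff (- k) (\<lambda>t. G (y + tpoly N x t) $ i) * x (i, k))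
         - (\<Sum>i\<in>UNIV. \<Sum>k\<in>freqs N. (\<Sum>j\<in>UNIV. A $ i $ j * x (j, k)) * x (i, k))
         + (\<Sum>i\<in>UNIV. \<Sum>k\<in>freqs N. trig_coeff k (\<lambda>t. e t $ i) * x (i, k))"
        unfolding sumI S_def F_def
        by (simp add: sum_subtractf sum.distrib algebra_simps power2_eq_square)
      also have "(\<Sum>i\<in>UNIV. \<Sum>k\<in>freqs N. of_int k * trig_coeff (- k) (\<lambda>t. G (y + tpoly N x t) $ i) * x (i, k)) = 0"
        by (rule galerkin_nonlinear_term[OF H G])
      finally have eq: "(\<Sum>b\<in>I. F x b * x b) = S x
         - (\<Sum>i\<in>UNIV. \<Sum>k\<in>freqs N. (\<Sum>j\<in>UNIV. A $ i $ j * x (j, k)) * x (i, k))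
         + (\<Sum>i\<in>UNIV. \<Sum>k\<in>freqs N. trig_coeff k (\<lambda>t. e t $ i) * x (i, k))" by simp
      have "(\<Sum>i\<in>UNIV. \<Sum>k\<in>freqs N. (\<Sum>j\<in>UNIV. A $ i $ j * x (j, k)) * x (i, k))
          = (\<Sum>k\<in>freqs N. (A *v (\<chi> j. x (j, k))) \<bullet> (\<chi> j. x (j, k)))"
        by (subst sum.swap) (simp add: inner_vec_def matrix_vector_mult_def)
      also have "\<dots> \<le> (\<Sum>k\<in>freqs N. M * ((\<chi> j. x (j, k)) \<bullet> (\<chi> j. x (j, k))))"
        by (intro sum_mono A)
      also have "\<dots> = M * (\<Sum>b\<in>I. (x b)\<^sup>2)"
        unfolding sumI by (subst sum.swap) (simp add: inner_vec_def sum_distrib_left power2_eq_square)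
      also have "\<dots> \<le> M * S x" using SX M by (intro mult_left_mono) auto
      finally have a: "(\<Sum>i\<in>UNIV. \<Sum>k\<in>freqs N. (\<Sum>j\<in>UNIV. A $ i $ j * x (j, k)) * x (i, k)) \<le> M * S x" .
      have "\<bar>\<Sum>k\<in>freqs N. x (i, k) * trig_coeff k (\<lambda>t. e t $ i)\<bar> \<le> B * sqrt (S x) * sqrt Z" for i
      proof (rule weighted_coeff_sum_bound[OF p \<sigma> Z])
        show "(\<Sum>i\<in>UNIV. \<Sum>k\<in>freqs N. \<bar>of_int k\<bar> powr p i * (x (i, k))\<^sup>2) \<le> (sqrt (S x))\<^sup>2"
          using Snn[of x] by (simp add: S_def[symmetric])
        fix k assume "k \<in> freqs N"
        then have "1 \<le> \<bar>real_of_int k\<bar>" by (auto simp: freqs_def)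
        then have "1 \<le> \<bar>real_of_int k\<bar> powr (\<sigma> / 4)"
          using \<sigma> by (intro ge_one_powr_ge_zero) auto
        then have "B * 1 \<le> B * \<bar>real_of_int k\<bar> powr (\<sigma> / 4)" using Bnn by (intro mult_left_mono)
        then show "\<bar>trig_coeff k (\<lambda>t. e t $ i)\<bar> \<le> B * \<bar>of_int k\<bar> powr (\<sigma> / 4)" using B[of k i] by simp
      qed (use Snn Bnn in auto)
      then have "(\<Sum>i\<in>UNIV. \<bar>\<Sum>k\<in>freqs N. trig_coeff k (\<lambda>t. e t $ i) * x (i, k)\<bar>) \<le> (\<Sum>i\<in>(UNIV::'n set). B * sqrt (S x) * sqrt Z)"
        by (intro sum_mono) (simp add: mult.commute)
      then have "\<bar>\<Sum>i\<in>UNIV. \<Sum>k\<in>freqs N. trig_coeff k (\<lambda>t. e t $ i) * x (i, k)\<bar> \<le> (\<Sum>i\<in>(UNIV::'n set). B * sqrt (S x) * sqrt Z)"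
        by (rule order_trans[OF sum_abs])
      then show ?thesis using eq a by (simp add: algebra_simps)
    qed
    have "\<exists>x. \<forall>b\<in>I. F x b = 0"
    proof (rule zero_in_ball)
      show "finite I" by (simp add: I_def)
      \<comment> \<open>The ball needs a positive radius, and \<rho> is 0 when B is. The sharp bound
        \<open>S x \<le> \<rho>\<^sup>2\<close> comes back from the energy inequality at the
        zero.\<close>
      show "0 < \<rho> + 1" using \<rho>nn by simp
      fix x :: "'n \<times> int \<Rightarrow> real" assume "(\<Sum>b\<in>I. (x b)\<^sup>2) = (\<rho> + 1)\<^sup>2"
      then have "(\<rho> + 1)\<^sup>2 \<le> S x" using SX[of x] by simp
      then have "\<rho> + 1 \<le> sqrt (S x)" by (rule real_le_rsqrt)
      then have "\<rho> \<le> sqrt (S x)" by simp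
      then have "real CARD('n) * B * sqrt Z \<le> (1 - M) * sqrt (S x)"
        using M by (simp add: \<rho>_def divide_le_eq mult.commute)
      then have "real CARD('n) * B * sqrt Z * sqrt (S x) \<le> (1 - M) * sqrt (S x) * sqrt (S x)"
        using Snn by (intro mult_right_mono) auto
      moreover have "(1 - M) * sqrt (S x) * sqrt (S x) = (1 - M) * S x"
        using Snn[of x] by (simp add: mult.assoc)
      ultimately show "0 \<le> (\<Sum>b\<in>I. F x b * x b)" using energy[of x] by linarith
    qed (use cF in auto)
    then obtain x where x: "\<And>b. b \<in> I \<Longrightarrow> F x b = 0" by blast
    have "(1 - M) * S x \<le> real CARD('n) * B * sqrt Z * sqrt (S x)"
      using energy[of x] x by simp
    then have "sqrt (S x) \<le> \<rho>"
    proof (cases "S x = 0")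
      case False
      then have "0 < sqrt (S x)" using Snn[of x] by simp
      moreover have "(1 - M) * sqrt (S x) * sqrt (S x) \<le> real CARD('n) * B * sqrt Z * sqrt (S x)"
        using \<open>(1 - M) * S x \<le> _\<close> Snn[of x] by (simp add: mult.assoc)
      ultimately have "(1 - M) * sqrt (S x) \<le> real CARD('n) * B * sqrt Z"
        by (simp only: mult_le_cancel_right_pos)
      then show ?thesis using M by (simp add: \<rho>_def le_divide_eq mult.commute)
    qed (use \<rho>nn in auto)
    then have "S x \<le> \<rho>\<^sup>2" by (rule sqrt_le_D)
    moreover have "F x (i, k) = 0" if "k \<in> freqs N" for i k
      using x[of "(i, k)"] that by (simp add: I_def)
    ultimately show "\<exists>x. (\<Sum>i\<in>UNIV. \<Sum>k\<in>freqs N. \<bar>of_int k\<bar> powr p i * (x (i, k))\<^sup>2) \<le> \<rho>\<^sup>2 \<and>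
       (\<forall>i. \<forall>k\<in>freqs N. \<bar>of_int k\<bar> powr p i * x (i, k) =
        of_int k * trig_coeff (- k) (\<lambda>t. G (y + tpoly N x t) $ i) + (\<Sum>j\<in>UNIV. A $ i $ j * x (j, k)) - trig_coeff k (\<lambda>t. e t $ i))"
      by (intro exI[of _ x] conjI) (auto simp: S_def F_def algebra_simps)
  qed
qed

section \<open>Compactness and passage to the limit\<close>

lemma periodic_reduce:
  fixes f :: "real \<Rightarrow> 'a"
  assumes "\<And>t. f (t + 2 * pi) = f t"
  shows "f (t + of_int n * (2 * pi)) = f t"
proof -
  interpret periodic_fun_simple f "2 * pi" by standard (rule assms)
  show ?thesis by (rule plus_of_int)
qed

lemma mod_2pi_range:
  "\<exists>n::int. t + of_int n * (2 * pi) \<in> {a..<a + 2 * pi}"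
proof -
  define n where "n = \<lfloor>(t - a) / (2 * pi)\<rfloor>"
  have "of_int n \<le> (t - a) / (2 * pi)" "(t - a) / (2 * pi) < of_int n + 1"
    by (auto simp: n_def)
  then have "t + of_int (- n) * (2 * pi) \<in> {a..<a + 2 * pi}"
    by (auto simp: field_simps)
  then show ?thesis by blast
qed

lemma norm_vec_le_card:
  fixes v :: "real^'n::finite"
  assumes "\<And>i. \<bar>v $ i\<bar> \<le> b"
  shows "norm v \<le> real CARD('n) * b"
  using norm_le_l1_cart[of v] sum_bounded_above[of UNIV "\<lambda>i. \<bar>v $ i\<bar>" b] assms by simp

lemma integral_tendsto_bounded:
  fixes f :: "nat \<Rightarrow> real \<Rightarrow> real"
  assumes "\<And>n. continuous_on {a..b} (f n)" "\<And>n t. t \<in> {a..b} \<Longrightarrow> \<bar>f n t\<bar> \<le> B"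
    "\<And>t. t \<in> {a..b} \<Longrightarrow> (\<lambda>n. f n t) \<longlonglongrightarrow> g t"
  shows "(\<lambda>n. integral {a..b} (f n)) \<longlonglongrightarrow> integral {a..b} g"
  by (rule dominated_convergence(2)[where h = "\<lambda>_. B"])
    (use assms in \<open>auto intro: integrable_continuous_interval\<close>)

lemma trig_coeff_tendsto:
  assumes "\<And>n. continuous_on {0..2 * pi} (f n)" "\<And>n t. \<bar>f n t\<bar> \<le> B" "\<And>t. (\<lambda>n. f n t) \<longlonglongrightarrow> g t"
  shows "(\<lambda>n. trig_coeff k (f n)) \<longlonglongrightarrow> trig_coeff k g"
  unfolding trig_coeff_def
proof (intro tendsto_mult_left integral_tendsto_bounded)
  show "\<bar>f n t * trig k t\<bar> \<le> B" for n t
    using assms(2)[of n t] abs_trig_le_one[of k t] mult_mono[of "\<bar>f n t\<bar>" B "\<bar>trig k t\<bar>" 1]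
    by (simp add: abs_mult)
qed (intro continuous_intros tendsto_intros assms)+

text \<open>The Galerkin solutions are bounded and Hoelder of order \<sigma>/4 uniformly in
  \<open>N\<close>, so Arzela--Ascoli gives a subsequence. For each fixed frequency the projected
  equation holds from some cutoff on, and every coefficient in it converges by dominated
  convergence; the nonlinear one needs only continuity of \<open>G\<close>.\<close>

lemma weak_solution_exists:
  fixes p :: "'n::finite \<Rightarrow> real" and G :: "real^'n \<Rightarrow> real^'n" and A :: "real^'n^'n"
    and e :: "real \<Rightarrow> real^'n"
  assumes H: "\<And>x. (H has_derivative (\<lambda>h. G x \<bullet> h)) (at x)" and G: "continuous_on UNIV G"
    and p: "\<And>i. 1 + \<sigma> \<le> p i" and \<sigma>: "0 < \<sigma>" "\<sigma> \<le> 1"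
    and A: "\<And>y. (A *v y) \<bullet> y \<le> M * (y \<bullet> y)" and M: "0 \<le> M" "M < 1"
    and e: "continuous_on UNIV e"
  shows "\<exists>w C. (\<forall>t. w (t + 2 * pi) = w t) \<and>
     (\<forall>t u. norm (w t - w u) \<le> C * \<bar>t - u\<bar> powr (\<sigma> / 4)) \<and>
     (\<forall>i. integral {0..2 * pi} (\<lambda>t. w t $ i) = 0) \<and>
     (\<forall>i k. k \<noteq> 0 \<longrightarrow> \<bar>of_int k\<bar> powr p i * trig_coeff k (\<lambda>t. w t $ i) = of_int k * trig_coeff (- k) (\<lambda>t. G (y + w t) $ i)
        + (\<Sum>j\<in>UNIV. A $ i $ j * trig_coeff k (\<lambda>t. w t $ j)) - trig_coeff k (\<lambda>t. e t $ i))"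
proof -
  have "1 < 1 + \<sigma> / 2" using \<sigma> by simp
  then obtain Z where Znn: "0 \<le> Z" and Z: "\<And>N. (\<Sum>k\<in>freqs N. \<bar>of_int k\<bar> powr - (1 + \<sigma> / 2)) \<le> Z"
    using sum_freqs_powr_bound by blast
  define Q where "Q \<rho> N x \<longleftrightarrow>
     (\<Sum>i\<in>UNIV. \<Sum>k\<in>freqs N. \<bar>of_int k\<bar> powr p i * (x (i, k))\<^sup>2) \<le> \<rho>\<^sup>2 \<and>
     (\<forall>i. \<forall>k\<in>freqs N. \<bar>of_int k\<bar> powr p i * x (i, k) =
        of_int k * trig_coeff (- k) (\<lambda>t. G (y + tpoly N x t) $ i) + (\<Sum>j\<in>UNIV. A $ i $ j * x (j, k)) - trig_coeff k (\<lambda>t. e t $ i))"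
    for \<rho> :: real and N x
  have "\<exists>\<rho>\<ge>0. \<forall>N. \<exists>x. Q \<rho> N x"
    unfolding Q_def by (rule galerkin_solution[where H = H and p = p and A = A and \<sigma> = \<sigma> and Z = Z and M = M]; fact)
  then obtain \<rho> where \<rho>: "0 \<le> \<rho>" and "\<forall>N. \<exists>x. Q \<rho> N x" by blast
  then obtain X where XQ: "\<And>N. Q \<rho> N (X N)" by metis
  then have S: "\<And>N. (\<Sum>i\<in>UNIV. \<Sum>k\<in>freqs N. \<bar>of_int k\<bar> powr p i * (X N (i, k))\<^sup>2) \<le> \<rho>\<^sup>2"
    unfolding Q_def by blast
  have X: "\<bar>of_int k\<bar> powr p i * X N (i, k) =
        of_int k * trig_coeff (- k) (\<lambda>t. G (y + tpoly N (X N) t) $ i) + (\<Sum>j\<in>UNIV. A $ i $ j * X N (j, k)) - trig_coeff k (\<lambda>t. e t $ i)"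
    if "k \<in> freqs N" for N i k
    using XQ[of N] that unfolding Q_def by blast
  define W where "W N = tpoly N (X N)" for N
  have cW: "continuous_on S (W N)" for S N
    unfolding W_def using tpoly_has_derivative by (intro continuous_on_vector_derivative) blast
  define \<delta> where "\<delta> = \<sigma> / 4"
  have \<delta>: "0 < \<delta>" "\<delta> \<le> 1" using \<sigma> by (auto simp: \<delta>_def)
  have bnd: "\<bar>W N t $ i\<bar> \<le> \<rho> * sqrt Z" for N t i
  proof -
    have "\<bar>\<Sum>k\<in>freqs N. X N (i, k) * trig k t\<bar> \<le> 1 * \<rho> * sqrt Z"
    proof (rule weighted_coeff_sum_bound[OF p \<sigma> Z S \<rho>])
      fix k assume "k \<in> freqs N"
      then have "1 \<le> \<bar>real_of_int k\<bar>" by (auto simp: freqs_def)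
      then have "1 \<le> \<bar>real_of_int k\<bar> powr (\<sigma> / 4)"
        using \<sigma> by (intro ge_one_powr_ge_zero) auto
      then show "\<bar>trig k t\<bar> \<le> 1 * \<bar>of_int k\<bar> powr (\<sigma> / 4)"
        using abs_trig_le_one[of k t] by linarith
    qed simp
    then show ?thesis by (simp add: W_def tpoly_def)
  qed
  have hol: "\<bar>(W N t - W N u) $ i\<bar> \<le> 2 * \<rho> * sqrt Z * \<bar>t - u\<bar> powr \<delta>" for N t u i
  proof -
    have "\<bar>\<Sum>k\<in>freqs N. X N (i, k) * (trig k t - trig k u)\<bar> \<le> (2 * \<bar>t - u\<bar> powr \<delta>) * \<rho> * sqrt Z"
    proof (rule weighted_coeff_sum_bound[OF p \<sigma> Z S \<rho>])
      show "\<bar>trig k t - trig k u\<bar> \<le> (2 * \<bar>t - u\<bar> powr \<delta>) * \<bar>of_int k\<bar> powr (\<sigma> / 4)" for k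
        using trig_holder[of \<delta> k t u] \<delta> by (simp add: \<delta>_def mult_ac)
    qed simp
    then show ?thesis by (simp add: W_def tpoly_def right_diff_distrib sum_subtractf mult_ac)
  qed
  define M1 where "M1 = real CARD('n) * (\<rho> * sqrt Z)"
  define C where "C = real CARD('n) * (2 * \<rho> * sqrt Z)"
  have Cnn: "0 \<le> C" using \<rho> Znn by (simp add: C_def)
  have Wb: "norm (W N t) \<le> M1" for N t
    unfolding M1_def by (rule norm_vec_le_card[OF bnd])
  have Wh: "norm (W N t - W N u) \<le> C * \<bar>t - u\<bar> powr \<delta>" for N t u
    using norm_vec_le_card[OF hol, of N t u] by (simp add: C_def mult.assoc)
  obtain g \<kappa> where \<kappa>: "strict_mono (\<kappa> :: nat \<Rightarrow> nat)"
    and conv: "\<And>\<epsilon>. 0 < \<epsilon> \<Longrightarrow> \<exists>N. \<forall>n t. n \<ge> N \<and> t \<in> {0..2 * pi} \<longrightarrow> norm (W (\<kappa> n) t - g t) < \<epsilon>"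
  proof (rule Arzela_Ascoli[of "{0..2 * pi}" W M1])
    fix t \<epsilon> :: real assume "0 < \<epsilon>"
    \<comment> \<open>Chosen so that C d^\<delta> = C \<epsilon>/(C + 1) < \<epsilon>; the added 1
      covers C = 0.\<close>
    define d where "d = (\<epsilon> / (C + 1)) powr (1 / \<delta>)"
    have q: "0 < \<epsilon> / (C + 1)" using \<open>0 < \<epsilon>\<close> Cnn by simp
    have "norm (W n t - W n u) < \<epsilon>" if "norm (t - u) < d" for n u
    proof -
      have "\<bar>t - u\<bar> powr \<delta> \<le> d powr \<delta>" using that \<delta> by (intro powr_mono2) auto
      also have "\<dots> = \<epsilon> / (C + 1)" using \<delta> q Cnn \<open>0 < \<epsilon>\<close> by (simp add: d_def powr_powr)
      finally have "C * \<bar>t - u\<bar> powr \<delta> \<le> C * (\<epsilon> / (C + 1))" using Cnn by (rule mult_left_mono)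
      also have "\<dots> < \<epsilon>" using Cnn \<open>0 < \<epsilon>\<close> by (simp add: field_simps)
      finally show ?thesis using Wh[of n t u] by linarith
    qed
    moreover have "0 < d" unfolding d_def powr_gt_zero using q by linarith
    ultimately show "\<exists>d>0. \<forall>n u. u \<in> {0..2 * pi} \<and> norm (t - u) < d \<longrightarrow> norm (W n t - W n u) < \<epsilon>"
      by blast
  qed (use Wb in auto)
  \<comment> \<open>Arzela--Ascoli controls one period only; \<open>w\<close> is the pointwise limit
    on the whole line, obtained by moving t into that period.\<close>
  have "\<exists>l. (\<lambda>n. W (\<kappa> n) t) \<longlonglongrightarrow> l" for t
  proof -
    obtain m :: int where m: "t + of_int m * (2 * pi) \<in> {0..<0 + 2 * pi}" using mod_2pi_range by blast
    define t' where "t' = t + of_int m * (2 * pi)"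
    have "W N t' = W N t" for N
      unfolding t'_def W_def by (rule periodic_reduce[where f = "tpoly N (X N)", OF tpoly_periodic])
    moreover have "(\<lambda>n. W (\<kappa> n) t') \<longlonglongrightarrow> g t'"
    proof (rule LIMSEQ_I)
      fix \<epsilon> :: real assume "0 < \<epsilon>"
      from conv[OF this] m show "\<exists>no. \<forall>n\<ge>no. norm (W (\<kappa> n) t' - g t') < \<epsilon>"
        unfolding t'_def by (metis atLeastAtMost_iff atLeastLessThan_iff less_imp_le add_0)
    qed
    ultimately show ?thesis by auto
  qed
  then obtain w where w: "\<And>t. (\<lambda>n. W (\<kappa> n) t) \<longlonglongrightarrow> w t" by metis
  have wi: "(\<lambda>n. W (\<kappa> n) t $ i) \<longlonglongrightarrow> w t $ i" for t i
    by (intro tendsto_intros w)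
  obtain BG where BG: "\<And>x. x \<in> cball y M1 \<Longrightarrow> norm (G x) \<le> BG"
  proof -
    have "compact (G ` cball y M1)" by (intro compact_continuous_image continuous_on_subset[OF G]) auto
    then show ?thesis using that by (meson compact_imp_bounded bounded_iff imageI)
  qed
  have limG: "(\<lambda>n. trig_coeff k (\<lambda>t. G (y + W (\<kappa> n) t) $ i)) \<longlonglongrightarrow> trig_coeff k (\<lambda>t. G (y + w t) $ i)" for k i
  proof (rule trig_coeff_tendsto)
    show "\<bar>G (y + W (\<kappa> n) t) $ i\<bar> \<le> BG" for n t
      using component_le_norm_cart[of "G (y + W (\<kappa> n) t)" i] BG[of "y + W (\<kappa> n) t"] Wb[of "\<kappa> n" t]
      by (simp add: dist_norm)
    show "continuous_on {0..2 * pi} (\<lambda>t. G (y + W (\<kappa> n) t) $ i)" for n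
      by (intro continuous_intros continuous_on_compose2[OF G] cW) auto
    have "isCont G x" for x using G by (simp add: continuous_on_eq_continuous_at)
    then show "(\<lambda>n. G (y + W (\<kappa> n) t) $ i) \<longlonglongrightarrow> G (y + w t) $ i" for t
      by (intro tendsto_intros isCont_tendsto_compose[where g = G] w)
  qed
  have limW: "(\<lambda>n. trig_coeff k (\<lambda>t. W (\<kappa> n) t $ i)) \<longlonglongrightarrow> trig_coeff k (\<lambda>t. w t $ i)" for k i
    by (rule trig_coeff_tendsto[OF _ bnd wi]) (intro continuous_intros cW)
  show ?thesis
  proof (intro exI[of _ w] exI[of _ C] conjI allI impI)
    show "w (t + 2 * pi) = w t" for t
      using w[of "t + 2 * pi"] w[of t] by (simp add: W_def tpoly_periodic LIMSEQ_unique)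
    show "norm (w t - w u) \<le> C * \<bar>t - u\<bar> powr (\<sigma> / 4)" for t u
      by (rule tendsto_upperbound[OF tendsto_norm[OF tendsto_diff[OF w w]]])
        (use Wh in \<open>auto simp: \<delta>_def\<close>)
    show "integral {0..2 * pi} (\<lambda>t. w t $ i) = 0" for i
    proof -
      have "(\<lambda>n. integral {0..2 * pi} (\<lambda>t. W (\<kappa> n) t $ i)) \<longlonglongrightarrow> integral {0..2 * pi} (\<lambda>t. w t $ i)"
        by (rule integral_tendsto_bounded[OF _ bnd wi]) (intro continuous_intros cW)
      then show ?thesis by (simp add: W_def integral_tpoly LIMSEQ_const_iff)
    qed
    fix i and k :: int assume k: "k \<noteq> 0"
    define rhs where "rhs n = of_int k * trig_coeff (- k) (\<lambda>t. G (y + W (\<kappa> n) t) $ i)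
      + (\<Sum>j\<in>UNIV. A $ i $ j * trig_coeff k (\<lambda>t. W (\<kappa> n) t $ j)) - trig_coeff k (\<lambda>t. e t $ i)" for n
    have "\<bar>of_int k\<bar> powr p i * trig_coeff k (\<lambda>t. W (\<kappa> n) t $ i) = rhs n" if "n \<ge> nat \<bar>k\<bar>" for n
    proof -
      \<comment> \<open>A strictly increasing index sequence satisfies
        \<open>n \<le> \<kappa> n\<close>, so k is an admissible frequency from n = |k| on.\<close>
      have "nat \<bar>k\<bar> \<le> \<kappa> n" using that seq_suble[OF \<kappa>, of n] by linarith
      then have kf: "k \<in> freqs (\<kappa> n)" using k by (auto simp: freqs_def)
      show ?thesis using X[OF kf] trig_coeff_tpoly[OF kf, of "X (\<kappa> n)"] by (simp add: rhs_def W_def)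
    qed
    then have "eventually (\<lambda>n. rhs n = \<bar>of_int k\<bar> powr p i * trig_coeff k (\<lambda>t. W (\<kappa> n) t $ i)) sequentially"
      by (intro eventually_sequentiallyI[of "nat \<bar>k\<bar>"]) auto
    moreover have "rhs \<longlonglongrightarrow> of_int k * trig_coeff (- k) (\<lambda>t. G (y + w t) $ i)
      + (\<Sum>j\<in>UNIV. A $ i $ j * trig_coeff k (\<lambda>t. w t $ j)) - trig_coeff k (\<lambda>t. e t $ i)"
      unfolding rhs_def by (intro tendsto_intros limG limW)
    ultimately have "(\<lambda>n. \<bar>of_int k\<bar> powr p i * trig_coeff k (\<lambda>t. W (\<kappa> n) t $ i)) \<longlonglongrightarrow> of_int k * trig_coeff (- k) (\<lambda>t. G (y + w t) $ i)
      + (\<Sum>j\<in>UNIV. A $ i $ j * trig_coeff k (\<lambda>t. w t $ j)) - trig_coeff k (\<lambda>t. e t $ i)"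
      by (rule Lim_transform_eventually[rotated])
    moreover have "(\<lambda>n. \<bar>of_int k\<bar> powr p i * trig_coeff k (\<lambda>t. W (\<kappa> n) t $ i)) \<longlonglongrightarrow> \<bar>of_int k\<bar> powr p i * trig_coeff k (\<lambda>t. w t $ i)"
      by (intro tendsto_intros limW)
    ultimately show "\<bar>of_int k\<bar> powr p i * trig_coeff k (\<lambda>t. w t $ i) = of_int k * trig_coeff (- k) (\<lambda>t. G (y + w t) $ i)
        + (\<Sum>j\<in>UNIV. A $ i $ j * trig_coeff k (\<lambda>t. w t $ j)) - trig_coeff k (\<lambda>t. e t $ i)"
      using LIMSEQ_unique by blast
  qed
qed

subsection \<open>Fourier coefficients and exponential series\<close>

lemma integral_periodic_shift:
  fixes g :: "real \<Rightarrow> 'a::banach"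
  assumes c: "continuous_on UNIV g" and per: "\<And>t. g (t + 2 * pi) = g t"
  shows "integral {a..a + 2 * pi} g = integral {0..2 * pi} g"
proof -
  have int: "g integrable_on {u..v}" for u v
    by (intro integrable_continuous_interval continuous_on_subset[OF c]) auto
  have sh: "integral {u + 2 * pi..v + 2 * pi} g = integral {u..v} g" for u v
    using integral_shift_Icc_real[of u v g "2 * pi"] by (simp add: o_def add.commute per)
  show ?thesis
  proof (cases "0 \<le> a")
    case True
    have "integral {0..a} g + integral {a..a + 2 * pi} g = integral {0..a + 2 * pi} g"
      using True by (intro Henstock_Kurzweil_Integration.integral_combine int) auto
    moreover have "integral {0..2 * pi} g + integral {0 + 2 * pi..a + 2 * pi} g = integral {0..a + 2 * pi} g"
      unfolding add_0_left using True by (intro Henstock_Kurzweil_Integration.integral_combine int) auto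
    ultimately show ?thesis unfolding sh by (metis add.commute add_left_cancel)
  next
    case False
    have "integral {a..a + 2 * pi} g + integral {a + 2 * pi..0 + 2 * pi} g = integral {a..2 * pi} g"
      unfolding add_0_left using False by (intro Henstock_Kurzweil_Integration.integral_combine int) auto
    moreover have "integral {a..0} g + integral {0..2 * pi} g = integral {a..2 * pi} g"
      using False by (intro Henstock_Kurzweil_Integration.integral_combine int) auto
    ultimately show ?thesis unfolding sh by (metis add.commute add_left_cancel)
  qed
qed

text \<open>Only k \<ge> 0 is kept: \<open>f\<close> is real, so its coefficients at negative
  frequencies are the conjugates of these.\<close>

definition fourier_coeff :: "nat \<Rightarrow> (real \<Rightarrow> real) \<Rightarrow> complex" where
  "fourier_coeff k f = (1 / (2 * pi)) *\<^sub>R integral {0..2 * pi} (\<lambda>t. of_real (f t) * cis (- (real k * t)))"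

lemma continuous_on_cis_compose [continuous_intros]:
  "continuous_on S f \<Longrightarrow> continuous_on S (\<lambda>x. cis (f x))"
  unfolding cis_conv_exp by (intro continuous_intros)

lemma fourier_coeff_integrable:
  "continuous_on {a..b} f \<Longrightarrow> (\<lambda>t. of_real (f t) * cis (- (real k * t))) integrable_on {a..b}"
  by (intro integrable_continuous_interval continuous_intros)

text \<open>For k > 0, \<open>trig (- int k) t\<close> is sin(kt), so cis(-kt) equals
  \<open>trig (int k) t - \<i> * trig (- int k) t\<close>; the factor 1/2 is the ratio of the two
  normalisations.\<close>

lemma fourier_coeff_eq_trig_coeff:
  assumes "continuous_on {0..2 * pi} f" "0 < k"
  shows "fourier_coeff k f = (of_real (trig_coeff (int k) f) - \<i> * of_real (trig_coeff (- int k) f)) / 2"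
proof -
  have i: "((\<lambda>t. f t * trig j t) has_integral pi * trig_coeff j f) {0..2 * pi}" for j
    unfolding trig_coeff_def using assms(1)
    by (simp add: has_integral_integral[symmetric])
      (intro integrable_continuous_interval continuous_intros)
  have "((\<lambda>t. of_real (f t * trig (int k) t) - \<i> * of_real (f t * trig (- int k) t)) has_integral
     of_real (pi * trig_coeff (int k) f) - \<i> * of_real (pi * trig_coeff (- int k) f)) {0..2 * pi}"
    by (intro has_integral_diff has_integral_mult_right has_integral_of_real i)
  moreover have "of_real (f t * trig (int k) t) - \<i> * of_real (f t * trig (- int k) t)
      = of_real (f t) * cis (- (real k * t))" for t
    using assms(2) by (simp add: trig_def complex_eq_iff)
  ultimately have "integral {0..2 * pi} (\<lambda>t. of_real (f t) * cis (- (real k * t)))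
     = of_real (pi * trig_coeff (int k) f) - \<i> * of_real (pi * trig_coeff (- int k) f)"
    by (simp add: integral_unique)
  then show ?thesis
    by (simp add: fourier_coeff_def scaleR_conv_of_real field_simps)
qed

lemma fourier_coeff_0: "continuous_on {0..2 * pi} f \<Longrightarrow> fourier_coeff 0 f = of_real (integral {0..2 * pi} f / (2 * pi))"
proof -
  assume "continuous_on {0..2 * pi} f"
  then have "(f has_integral integral {0..2 * pi} f) {0..2 * pi}"
    by (intro integrable_integral integrable_continuous_interval)
  from has_integral_of_real[OF this, where 'b = complex] show ?thesis
    by (simp add: fourier_coeff_def integral_unique scaleR_conv_of_real)
qed

lemma norm_fourier_coeff_le:
  assumes "continuous_on {0..2 * pi} f" "\<And>t. t \<in> {0..2 * pi} \<Longrightarrow> \<bar>f t\<bar> \<le> B"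
  shows "norm (fourier_coeff k f) \<le> B"
proof -
  have "norm (integral {0..2 * pi} (\<lambda>t. of_real (f t) * cis (- (real k * t)))) \<le> B * (2 * pi - 0)"
    by (rule integral_bound) (use assms in \<open>auto intro!: continuous_intros simp: norm_mult\<close>)
  then show ?thesis by (simp add: fourier_coeff_def field_simps)
qed

lemma fourier_coeff_bounded:
  assumes "continuous_on {0..2 * pi} f"
  shows "\<exists>B. \<forall>k. norm (fourier_coeff k f) \<le> B"
proof -
  have "compact (f ` {0..2 * pi})" using assms by (intro compact_continuous_image) auto
  then obtain B where "\<And>t. t \<in> {0..2 * pi} \<Longrightarrow> norm (f t) \<le> B"
    by (meson compact_imp_bounded bounded_iff imageI)
  then show ?thesis using norm_fourier_coeff_le[OF assms, of B] by auto
qed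

text \<open>Radius of convergence at least 1, in absolute form: the condition survives
  multiplication by k and passes to coefficients of smaller modulus.\<close>

definition disc_summable :: "(nat \<Rightarrow> complex) \<Rightarrow> bool" where
  "disc_summable a \<longleftrightarrow> (\<forall>r. 0 \<le> r \<and> r < 1 \<longrightarrow> summable (\<lambda>k. norm (a k) * r ^ k))"

text \<open>For \<open>a = fourier_coeff f\<close> this is the holomorphic extension to the upper half plane of the
  nonnegative-frequency part of \<open>f\<close>.\<close>

definition exp_series :: "(nat \<Rightarrow> complex) \<Rightarrow> complex \<Rightarrow> complex" where
  "exp_series a z = (\<Sum>k. a k * exp (\<i> * z) ^ k)"

lemma disc_summable_bounded:
  assumes "\<And>k. norm (a k) \<le> B"
  shows "disc_summable a"
  unfolding disc_summable_def
proof (intro allI impI)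
  fix r :: real assume r: "0 \<le> r \<and> r < 1"
  then have "summable (\<lambda>k. B * r ^ k)" by (intro summable_mult summable_geometric) auto
  then show "summable (\<lambda>k. norm (a k) * r ^ k)"
    by (rule summable_comparison_test') (use r assms in \<open>auto intro!: mult_right_mono\<close>)
qed

lemma disc_summable_mono:
  assumes "disc_summable b" "\<And>k. norm (a k) \<le> norm (b k)"
  shows "disc_summable a"
  unfolding disc_summable_def
proof (intro allI impI)
  fix r :: real assume r: "0 \<le> r \<and> r < 1"
  then have "summable (\<lambda>k. norm (b k) * r ^ k)" using assms(1) by (auto simp: disc_summable_def)
  then show "summable (\<lambda>k. norm (a k) * r ^ k)"
    by (rule summable_comparison_test') (use r assms in \<open>auto intro!: mult_right_mono\<close>)
qed

text \<open>Termwise differentiation keeps the radius of convergence; the extra factor r undoes the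
  index shift in \<open>diffs\<close>.\<close>

lemma disc_summable_of_nat_mult:
  assumes "disc_summable a"
  shows "disc_summable (\<lambda>k. of_nat k * a k)"
  unfolding disc_summable_def
proof (intro allI impI)
  fix r :: real assume r: "0 \<le> r \<and> r < 1"
  have "summable (\<lambda>n. diffs (\<lambda>k. norm (a k)) n * r ^ n)"
  proof (rule termdiff_converges[of r 1])
    fix x :: real assume "norm x < 1"
    then have "summable (\<lambda>k. norm (a k) * \<bar>x\<bar> ^ k)" using assms by (auto simp: disc_summable_def)
    then show "summable (\<lambda>k. norm (a k) * x ^ k)"
      by (rule summable_comparison_test') (auto simp: abs_mult power_abs)
  qed (use r in auto)
  then have "summable (\<lambda>n. r * (diffs (\<lambda>k. norm (a k)) n * r ^ n))" by (rule summable_mult)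
  then have "summable (\<lambda>n. norm (of_nat (Suc n) * a (Suc n)) * r ^ Suc n)"
    by (rule back_subst[where P = summable]) (auto simp: diffs_def norm_mult simp del: of_nat_Suc)
  then show "summable (\<lambda>k. norm (of_nat k * a k) * r ^ k)"
    by (subst (asm) summable_Suc_iff)
qed

lemma disc_summable_fourier_coeff: "continuous_on {0..2 * pi} f \<Longrightarrow> disc_summable (\<lambda>k. fourier_coeff k f)"
  using fourier_coeff_bounded disc_summable_bounded by metis

lemma norm_exp_ii: "norm (exp (\<i> * z)) = exp (- Im z)"
  by (simp add: norm_exp_eq_Re)

lemma exp_series_abs_summable:
  assumes "disc_summable a" "0 < Im z"
  shows "summable (\<lambda>k. norm (a k * exp (\<i> * z) ^ k))"
  using assms by (simp add: disc_summable_def norm_mult norm_power norm_exp_ii)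

text \<open>Chain rule through q = exp(iz), which maps the upper half plane into the unit disc:
  differentiation multiplies the k-th coefficient by ik.\<close>

lemma exp_series_has_derivative:
  assumes "disc_summable a" "0 < Im z"
  shows "(exp_series a has_field_derivative \<i> * exp_series (\<lambda>k. of_nat k * a k) z) (at z)"
proof -
  define q where "q = exp (\<i> * z)"
  have q: "norm q < 1" using assms by (simp add: q_def norm_exp_ii)
  have "((\<lambda>w. \<Sum>k. a k * w ^ k) has_field_derivative (\<Sum>k. diffs a k * q ^ k)) (at q)"
  proof (rule termdiffs_strong'[of 1])
    fix w :: complex assume "norm w < 1"
    then have "summable (\<lambda>k. norm (a k * w ^ k))"
      using assms(1) by (auto simp: disc_summable_def norm_mult norm_power)
    then show "summable (\<lambda>k. a k * w ^ k)" by (rule summable_norm_cancel)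
  qed (rule q)
  moreover have "((\<lambda>z. exp (\<i> * z)) has_field_derivative \<i> * q) (at z)"
    by (auto intro!: derivative_eq_intros simp: q_def)
  ultimately have "((\<lambda>z. \<Sum>k. a k * exp (\<i> * z) ^ k) has_field_derivative (\<Sum>k. diffs a k * q ^ k) * (\<i> * q)) (at z)"
    unfolding q_def by (rule DERIV_chain2)
  moreover have "(\<Sum>k. diffs a k * q ^ k) * (\<i> * q) = \<i> * exp_series (\<lambda>k. of_nat k * a k) z"
  proof -
    have s: "summable (\<lambda>k. of_nat k * a k * q ^ k)"
      unfolding q_def by (rule summable_norm_cancel[OF exp_series_abs_summable[OF disc_summable_of_nat_mult[OF assms(1)] assms(2)]])
    have "exp_series (\<lambda>k. of_nat k * a k) z = (\<Sum>k. of_nat (Suc k) * a (Suc k) * q ^ Suc k)"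
      unfolding exp_series_def q_def[symmetric] using suminf_split_head[OF s] by simp
    also have "\<dots> = (\<Sum>k. q * (diffs a k * q ^ k))"
      by (simp add: diffs_def mult_ac)
    also have "\<dots> = q * (\<Sum>k. diffs a k * q ^ k)"
    proof (rule suminf_mult)
      show "summable (\<lambda>k. diffs a k * q ^ k)"
      proof (rule termdiff_converges[OF q])
        fix w :: complex assume "norm w < 1"
        then have "summable (\<lambda>k. norm (a k * w ^ k))"
          using assms(1) by (auto simp: disc_summable_def norm_mult norm_power)
        then show "summable (\<lambda>k. a k * w ^ k)" by (rule summable_norm_cancel)
      qed
    qed
    finally show ?thesis by (simp add: mult_ac)
  qed
  ultimately show ?thesis by (simp add: exp_series_def[abs_def])
qed

text \<open>Cauchy's estimate on the disc of radius Im z / 2, in which the height stays at least Im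
  z / 2. The constant collects 2^p from halving the height and 2 from the radius.\<close>

lemma exp_series_bound_of_nat_mult:
  assumes a: "disc_summable a" and p: "0 \<le> p" and C: "\<And>z. 0 < Im z \<Longrightarrow> norm (exp_series a z) \<le> C * Im z powr - p"
    and z: "0 < Im z"
  shows "norm (exp_series (\<lambda>k. of_nat k * a k) z) \<le> 2 powr (p + 1) * C * Im z powr - (p + 1)"
proof -
  define r where "r = Im z / 2"
  have r: "0 < r" using z by (simp add: r_def)
  \<comment> \<open>At z = i the power of Im z is 1, so the hypothesis itself forces
    \<open>C\<close> to be nonnegative.\<close>
  have "norm (exp_series a \<i>) \<le> C" using C[of \<i>] by simp
  then have Cnn: "0 \<le> C" by (rule order_trans[OF norm_ge_zero])
  have Im_ge: "r \<le> Im w" if "w \<in> cball z r" for w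
  proof -
    have "\<bar>Im (z - w)\<bar> \<le> r" using that abs_Im_le_cmod[of "z - w"] by (auto simp: dist_norm)
    then show ?thesis unfolding r_def minus_complex.sel by linarith
  qed
  have hol: "exp_series a holomorphic_on {w. 0 < Im w}"
    using exp_series_has_derivative[OF a] by (auto simp: holomorphic_on_def field_differentiable_def intro: has_field_derivative_at_within)
  have sub: "cball z r \<subseteq> {w. 0 < Im w}" using Im_ge r by force
  have "norm ((deriv ^^ 1) (exp_series a) z) \<le> fact 1 * (C * r powr - p) / r ^ 1"
  proof (rule Cauchy_inequality)
    show "exp_series a holomorphic_on ball z r"
      using holomorphic_on_subset[OF hol] sub ball_subset_cball by blast
    show "continuous_on (cball z r) (exp_series a)"
      using holomorphic_on_imp_continuous_on[OF hol] sub continuous_on_subset by blast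
    fix x assume "norm (z - x) = r"
    then have x: "r \<le> Im x" by (intro Im_ge) (auto simp: dist_norm)
    then have "norm (exp_series a x) \<le> C * Im x powr - p" using r by (intro C) auto
    also have "\<dots> \<le> C * r powr - p" using x r p Cnn by (intro mult_left_mono powr_mono2') auto
    finally show "norm (exp_series a x) \<le> C * r powr - p" .
  qed (rule r)
  moreover have "deriv (exp_series a) z = \<i> * exp_series (\<lambda>k. of_nat k * a k) z"
    by (rule DERIV_imp_deriv[OF exp_series_has_derivative[OF a z]])
  moreover have "C * r powr - p / r = 2 powr (p + 1) * C * Im z powr - (p + 1)"
  proof -
    have "r powr - p / r = r powr - (p + 1)" using r powr_diff[of r "- p" 1] by simp
    also have "\<dots> = Im z powr - (p + 1) / 2 powr - (p + 1)" using z by (simp only: r_def powr_divide)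
    also have "\<dots> = 2 powr (p + 1) * Im z powr - (p + 1)" unfolding powr_minus[of 2] by (simp add: field_simps)
    finally have "r powr - p / r = 2 powr (p + 1) * Im z powr - (p + 1)" .
    then show ?thesis by (metis mult.assoc mult.commute times_divide_eq_right)
  qed
  ultimately show ?thesis by (simp add: norm_mult)
qed

text \<open>A multiplier \<open>p\<close> acts as convolution with the kernel
  \<open>exp_series p\<close>. Sum and integral commute because |exp(i(z - t))| does not depend on
  the real number t, which gives a summable majorant. \<open>p = of_nat\<close> yields the
  derivative kernel, and constant 1 the Cauchy kernel behind Poisson's.\<close>

lemma fourier_coeff_series:
  assumes f: "continuous_on {0..2 * pi} f" and p: "disc_summable p" and z: "0 < Im z"
  shows "exp_series (\<lambda>k. p k * fourier_coeff k f) z = (1 / (2 * pi)) *\<^sub>R integral {0..2 * pi} (\<lambda>t. of_real (f t) * exp_series p (z - of_real t))"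
proof -
  have e: "exp (\<i> * (z - of_real t)) ^ k = exp (\<i> * z) ^ k * cis (- (real k * t))" for t k
  proof -
    have "exp (\<i> * (z - of_real t)) = exp (\<i> * z) * cis (- t)"
      by (simp add: cis_conv_exp exp_add[symmetric] algebra_simps)
    moreover have "cis (- t) ^ k = cis (- (real k * t))"
      by (metis Complex.DeMoivre mult_minus_right)
    ultimately show ?thesis by (simp add: power_mult_distrib)
  qed
  have "compact (f ` {0..2 * pi})" using f by (intro compact_continuous_image) auto
  then obtain B where B: "\<And>t. t \<in> {0..2 * pi} \<Longrightarrow> norm (f t) \<le> B"
    by (meson compact_imp_bounded bounded_iff imageI)
  have u: "uniform_limit {0..2 * pi} (\<lambda>n t. \<Sum>k<n. of_real (f t) * (p k * exp (\<i> * (z - of_real t)) ^ k))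
     (\<lambda>t. \<Sum>k. of_real (f t) * (p k * exp (\<i> * (z - of_real t)) ^ k)) sequentially"
  proof (rule Weierstrass_m_test)
    show "norm (of_real (f t) * (p k * exp (\<i> * (z - of_real t)) ^ k)) \<le> B * norm (p k * exp (\<i> * z) ^ k)"
      if "t \<in> {0..2 * pi}" for k t
      unfolding norm_mult norm_power norm_exp_ii norm_of_real using B[OF that]
      by (auto intro!: mult_right_mono)
    show "summable (\<lambda>k. B * norm (p k * exp (\<i> * z) ^ k))"
      by (intro summable_mult exp_series_abs_summable p z)
  qed
  obtain I J where I: "\<And>n. ((\<lambda>t. \<Sum>k<n. of_real (f t) * (p k * exp (\<i> * (z - of_real t)) ^ k)) has_integral I n) {0..2 * pi}"
    and J: "((\<lambda>t. \<Sum>k. of_real (f t) * (p k * exp (\<i> * (z - of_real t)) ^ k)) has_integral J) {0..2 * pi}"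
    and IJ: "I \<longlonglongrightarrow> J"
    by (rule uniform_limit_integral[OF u]) (auto intro!: continuous_intros f)
  have "I n = (\<Sum>k<n. (2 * pi) *\<^sub>R (p k * fourier_coeff k f * exp (\<i> * z) ^ k))" for n
  proof -
    have "((\<lambda>t. \<Sum>k<n. (p k * exp (\<i> * z) ^ k) * (of_real (f t) * cis (- (real k * t)))) has_integral
       (\<Sum>k<n. (p k * exp (\<i> * z) ^ k) * integral {0..2 * pi} (\<lambda>t. of_real (f t) * cis (- (real k * t))))) {0..2 * pi}"
      by (intro has_integral_sum has_integral_mult_right integrable_integral fourier_coeff_integrable f) auto
    moreover have "(\<Sum>k<n. (p k * exp (\<i> * z) ^ k) * (of_real (f t) * cis (- (real k * t)))) =
       (\<Sum>k<n. of_real (f t) * (p k * exp (\<i> * (z - of_real t)) ^ k))" for t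
      unfolding e by (intro sum.cong) (auto simp: mult_ac)
    ultimately have "I n = (\<Sum>k<n. (p k * exp (\<i> * z) ^ k) * integral {0..2 * pi} (\<lambda>t. of_real (f t) * cis (- (real k * t))))"
      using I[of n] by (simp add: has_integral_unique)
    then show ?thesis by (simp add: fourier_coeff_def mult_ac)
  qed
  then have Ieq: "I = (\<lambda>n. \<Sum>k<n. (2 * pi) *\<^sub>R (p k * fourier_coeff k f * exp (\<i> * z) ^ k))" by blast
  have "(\<lambda>k. (2 * pi) *\<^sub>R (p k * fourier_coeff k f * exp (\<i> * z) ^ k)) sums J"
    unfolding sums_def Ieq[symmetric] by (rule IJ)
  then have "(\<lambda>k. (1 / (2 * pi)) *\<^sub>R (2 * pi) *\<^sub>R (p k * fourier_coeff k f * exp (\<i> * z) ^ k)) sums ((1 / (2 * pi)) *\<^sub>R J)"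
    by (rule sums_scaleR_right)
  then have "(\<Sum>k. p k * fourier_coeff k f * exp (\<i> * z) ^ k) = (1 / (2 * pi)) *\<^sub>R J"
    by (intro sums_unique[symmetric]) simp
  then have "exp_series (\<lambda>k. p k * fourier_coeff k f) z = (1 / (2 * pi)) *\<^sub>R J" by (simp only: exp_series_def)
  moreover have "(\<Sum>k. of_real (f t) * (p k * exp (\<i> * (z - of_real t)) ^ k)) = of_real (f t) * exp_series p (z - of_real t)" for t
    unfolding exp_series_def
    by (rule suminf_mult) (rule summable_norm_cancel[OF exp_series_abs_summable[OF p]], use z in simp)
  ultimately show ?thesis using J by (simp add: integral_unique)
qed

subsection \<open>Hardy--Littlewood estimates and the Poisson kernel\<close>

lemma sin_ge_linear:
  fixes x :: real
  assumes "0 \<le> x" "x \<le> pi / 2"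
  shows "2 * x / pi \<le> sin x"
proof -
  have "concave_on {0..pi / 2} sin"
    by (rule f''_le0_imp_concave[where f' = cos and f'' = "\<lambda>x. - sin x"])
      (auto intro!: derivative_eq_intros sin_ge_zero)
  from concave_onD[OF this, of "2 * x / pi" 0 "pi / 2"] assms show ?thesis
    by (simp add: field_simps)
qed

text \<open>Jordan's inequality in 1 - cos h = 2 sin^2(h/2); pi < 4 trades the factor 2/pi for a
  rational one.\<close>

lemma one_minus_cos_ge:
  assumes "\<bar>h\<bar> \<le> pi"
  shows "h\<^sup>2 / 4 \<le> 2 * (1 - cos h)"
proof -
  have "2 * (\<bar>h\<bar> / 2) / pi \<le> sin (\<bar>h\<bar> / 2)" using assms by (intro sin_ge_linear) auto
  moreover have "\<bar>h\<bar> / 4 \<le> 2 * (\<bar>h\<bar> / 2) / pi" using mult_right_mono[of pi 4 "\<bar>h\<bar>"] pi_less_4 by (simp add: field_simps)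
  ultimately have "\<bar>h\<bar> / 4 \<le> sin (\<bar>h\<bar> / 2)" by linarith
  then have "(\<bar>h\<bar> / 4)\<^sup>2 \<le> (sin (\<bar>h\<bar> / 2))\<^sup>2" by (intro power_mono) auto
  moreover have "cos \<bar>h\<bar> = 1 - 2 * (sin (\<bar>h\<bar> / 2))\<^sup>2" using cos_double_sin[of "\<bar>h\<bar> / 2"] by simp
  ultimately show ?thesis by (simp add: power2_eq_square)
qed

text \<open>After division by exp(-y) this is the square of y \<le> 2 sinh(y/2).\<close>

lemma exp_gap:
  fixes y :: real
  assumes "0 \<le> y"
  shows "exp (- y) * y\<^sup>2 \<le> (1 - exp (- y))\<^sup>2"
proof -
  define x where "x = y / 2"
  have x: "0 \<le> x" using assms by (simp add: x_def)
  have e: "1 + x + x\<^sup>2 / 2 \<le> exp x" using x by (rule exp_lower_Taylor_quadratic)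
  have p: "0 < 1 + x + x\<^sup>2 / 2" using x by (intro add_pos_nonneg) auto
  have "exp (- x) = 1 / exp x" by (simp add: exp_minus field_simps)
  also have "\<dots> \<le> 1 / (1 + x + x\<^sup>2 / 2)" using e p by (intro divide_left_mono) auto
  \<comment> \<open>The product of the two quadratics is 1 + x^4/4.\<close>
  also have "\<dots> \<le> 1 - x + x\<^sup>2 / 2"
  proof -
    have "1 \<le> (1 - x + x\<^sup>2 / 2) * (1 + x + x\<^sup>2 / 2)"
      using x by (simp add: algebra_simps power2_eq_square)
    then show ?thesis using p by (simp add: divide_le_eq)
  qed
  finally have "2 * x \<le> exp x - exp (- x)" using e by linarith
  then have "exp (- x) * y \<le> exp (- x) * (exp x - exp (- x))" by (intro mult_left_mono) (auto simp: x_def)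
  also have "\<dots> = 1 - exp (- y)" by (simp add: right_diff_distrib exp_add[symmetric] x_def)
  finally have "(exp (- x) * y)\<^sup>2 \<le> (1 - exp (- y))\<^sup>2" using assms by (intro power_mono) auto
  moreover have "(exp (- x))\<^sup>2 = exp (- y)" by (simp add: x_def power2_eq_square exp_add[symmetric])
  ultimately show ?thesis by (simp add: power_mult_distrib)
qed

lemma norm_one_minus_exp:
  "(norm (1 - exp (\<i> * z)))\<^sup>2 = (1 - exp (- Im z))\<^sup>2 + 2 * exp (- Im z) * (1 - cos (Re z))"
proof -
  have "exp (\<i> * z) = of_real (exp (- Im z)) * cis (Re z)"
    by (simp add: exp_eq_polar)
  then have "(norm (1 - exp (\<i> * z)))\<^sup>2 = (1 - exp (- Im z) * cos (Re z))\<^sup>2 + (exp (- Im z) * sin (Re z))\<^sup>2"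
    by (simp add: cmod_power2)
  also have "\<dots> = 1 - 2 * exp (- Im z) * cos (Re z) + (exp (- Im z))\<^sup>2 * ((cos (Re z))\<^sup>2 + (sin (Re z))\<^sup>2)"
    by algebra
  finally show ?thesis by (simp add: power2_eq_square algebra_simps)
qed

text \<open>The factor exp(- Im z) on the left is the modulus of the numerator in q/(1 - q)^2, where
  q = exp(iz); keeping it makes the resulting kernel bound valid at every height.\<close>

lemma norm_one_minus_exp_ge:
  assumes "0 < Im z" "\<bar>Re z\<bar> \<le> pi"
  shows "exp (- Im z) * (Im z + \<bar>Re z\<bar>)\<^sup>2 / 8 \<le> (norm (1 - exp (\<i> * z)))\<^sup>2"
proof -
  have "(Im z + \<bar>Re z\<bar>)\<^sup>2 \<le> 2 * ((Im z)\<^sup>2 + (Re z)\<^sup>2)"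
    using sum_squares_bound[of "Im z" "\<bar>Re z\<bar>"] by (simp add: power2_sum)
  then have "(Im z + \<bar>Re z\<bar>)\<^sup>2 / 8 \<le> (Im z)\<^sup>2 + 2 * (1 - cos (Re z))"
  proof -
    have "P / 8 \<le> u + w" if "P \<le> 2 * (u + v)" "v / 4 \<le> w" "0 \<le> u" for P u v w :: real
      using that by (simp add: field_simps)
    from this[OF _ one_minus_cos_ge[OF assms(2)] zero_le_power2] \<open>_ \<le> 2 * _\<close> show ?thesis by blast
  qed
  then have "exp (- Im z) * ((Im z + \<bar>Re z\<bar>)\<^sup>2 / 8) \<le> exp (- Im z) * ((Im z)\<^sup>2 + 2 * (1 - cos (Re z)))"
    by (intro mult_left_mono) auto
  also have "\<dots> \<le> (1 - exp (- Im z))\<^sup>2 + 2 * exp (- Im z) * (1 - cos (Re z))"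
    using exp_gap[of "Im z"] assms by (simp add: algebra_simps)
  finally show ?thesis by (simp add: norm_one_minus_exp)
qed

lemma exp_ii_neq_1: "0 < Im z \<Longrightarrow> exp (\<i> * z) \<noteq> 1"
  using norm_exp_ii[of z] by (metis exp_less_one_iff less_irrefl neg_less_0_iff_less norm_one)

lemma exp_series_of_nat:
  assumes "0 < Im z"
  shows "exp_series of_nat z = exp (\<i> * z) / (1 - exp (\<i> * z))\<^sup>2"
proof -
  define q where "q = exp (\<i> * z)"
  have q: "norm q < 1" using assms by (simp add: q_def norm_exp_ii)
  have "(\<lambda>k. q * (of_nat (Suc k) * q ^ k)) sums (q * (1 / (1 - q)\<^sup>2))"
    by (intro sums_mult geometric_deriv_sums q)
  then have "(\<lambda>k. of_nat (Suc k) * q ^ Suc k) sums (q / (1 - q)\<^sup>2)"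
    by (simp add: mult_ac)
  then have "(\<lambda>k. of_nat k * q ^ k) sums (q / (1 - q)\<^sup>2)"
    by (subst (asm) sums_Suc_iff) simp
  then show ?thesis by (simp add: exp_series_def q_def sums_iff)
qed

lemma exp_series_one:
  assumes "0 < Im z"
  shows "exp_series (\<lambda>_. 1) z = 1 / (1 - exp (\<i> * z))"
  using suminf_geometric[of "exp (\<i> * z)"] assms by (simp add: exp_series_def norm_exp_ii)

lemma norm_exp_series_of_nat_le:
  assumes "0 < Im z" "\<bar>Re z\<bar> \<le> pi"
  shows "norm (exp_series of_nat z) \<le> 8 / (Im z + \<bar>Re z\<bar>)\<^sup>2"
proof -
  have "0 < (Im z + \<bar>Re z\<bar>)\<^sup>2" using assms by (intro zero_less_power) auto
  moreover have "0 < (norm (1 - exp (\<i> * z)))\<^sup>2" using exp_ii_neq_1[OF assms(1)] by simp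
  moreover have "norm (exp_series of_nat z) = exp (- Im z) / (norm (1 - exp (\<i> * z)))\<^sup>2"
    using assms by (simp add: exp_series_of_nat norm_divide norm_power norm_exp_ii)
  moreover have "u / n \<le> 8 / d" if "0 < d" "0 < n" "u * d / 8 \<le> n" for u d n :: real
    using that by (simp add: field_simps)
  ultimately show ?thesis
    using norm_one_minus_exp_ge[OF assms] by metis
qed

lemma exp_series_periodic: "exp_series a (z + 2 * of_real pi) = exp_series a z"
proof -
  have "exp (\<i> * (z + 2 * of_real pi)) = exp (\<i> * z) * exp (2 * of_real pi * \<i>)"
    unfolding exp_add[symmetric] by (rule arg_cong[where f = exp]) (simp add: algebra_simps)
  then show ?thesis by (simp add: exp_series_def)
qed

lemma continuous_on_exp_series:
  assumes "disc_summable a" "continuous_on S g" "\<And>x. x \<in> S \<Longrightarrow> 0 < Im (g x)"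
  shows "continuous_on S (\<lambda>x. exp_series a (g x))"
proof (rule continuous_on_compose2[OF _ assms(2)])
  show "continuous_on {z. 0 < Im z} (exp_series a)"
    using exp_series_has_derivative[OF assms(1)]
    by (intro continuous_at_imp_continuous_on ballI) (auto intro: DERIV_isCont)
qed (use assms(3) in auto)

lemma fourier_coeff_const: "0 < k \<Longrightarrow> fourier_coeff k (\<lambda>_. c) = 0"
proof -
  assume k: "0 < k"
  have "((\<lambda>t. of_real c * cis (- (real k * t))) has_integral 0) {0..2 * pi}"
  proof (rule integral_deriv_periodic)
    show "((\<lambda>t. of_real c * (\<i> / of_nat k * cis (- (real k * t)))) has_vector_derivative
        of_real c * cis (- (real k * t))) (at t)" for t
    proof -
      define A where "A = - \<i> * of_nat k"
      have e: "cis (- (real k * t)) = exp (t *\<^sub>R A)" for t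
        by (simp add: cis_conv_exp A_def scaleR_conv_of_real mult_ac)
      have "((\<lambda>t. of_real c * (\<i> / of_nat k * exp (t *\<^sub>R A))) has_vector_derivative
         of_real c * (\<i> / of_nat k * (exp (t *\<^sub>R A) * A))) (at t)"
        by (intro has_vector_derivative_mult_right exp_scaleR_has_vector_derivative_right)
      moreover have "of_real c * (\<i> / of_nat k * (exp (t *\<^sub>R A) * A)) = of_real c * exp (t *\<^sub>R A) * (\<i> / of_nat k * A)"
        by (simp only: mult_ac)
      moreover have "\<i> / of_nat k * A = 1" using k by (simp add: A_def)
      ultimately show ?thesis unfolding e by (simp only: mult_1_right)
    qed
    have "cis (- (real k * (2 * pi))) = 1"
      using cis_multiple_2pi[of "- real k"] by (simp add: mult_ac)
    then show "of_real c * (\<i> / of_nat k * cis (- (real k * (2 * pi)))) = of_real c * (\<i> / of_nat k * cis (- (real k * 0)))"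
      by simp
  qed
  from integral_unique[OF this] show ?thesis by (simp only: fourier_coeff_def scaleR_zero_right)
qed

lemma fourier_coeff_add:
  assumes "continuous_on {0..2 * pi} f" "continuous_on {0..2 * pi} g"
  shows "fourier_coeff k (\<lambda>t. f t + g t) = fourier_coeff k f + fourier_coeff k g"
  using fourier_coeff_integrable[OF assms(1), of k] fourier_coeff_integrable[OF assms(2), of k]
  by (simp add: fourier_coeff_def ring_distribs integral_add scaleR_add_right)

lemma fourier_coeff_cmult: "fourier_coeff k (\<lambda>t. c * f t) = of_real c * fourier_coeff k f"
  by (simp add: fourier_coeff_def mult.assoc)

lemma integral_powr_abs:
  fixes y b l t :: real
  assumes y: "0 < y" and b: "b < 1" and l: "0 \<le> l"
  shows "((\<lambda>\<tau>. (y + \<bar>t - \<tau>\<bar>) powr (b - 2)) has_integral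
      2 * (y powr (b - 1) - (y + l) powr (b - 1)) / (1 - b)) {t - l..t + l}"
proof -
  have d1: "((\<lambda>\<tau>. (y + (t - \<tau>)) powr (b - 1) / (1 - b)) has_real_derivative (y + (t - \<tau>)) powr (b - 2)) (at \<tau> within S)"
    if "\<tau> \<le> t" for \<tau> S
  proof -
    have "((\<lambda>\<tau>. (y + (t - \<tau>)) powr (b - 1)) has_real_derivative (1 - b) * (y + (t - \<tau>)) powr (b - 2)) (at \<tau> within S)"
      using that y by (auto intro!: derivative_eq_intros simp: algebra_simps)
    from DERIV_cdivide[OF this, of "1 - b"] b show ?thesis by simp
  qed
  have d2: "((\<lambda>\<tau>. - ((y + (\<tau> - t)) powr (b - 1) / (1 - b))) has_real_derivative (y + (\<tau> - t)) powr (b - 2)) (at \<tau> within S)"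
    if "t \<le> \<tau>" for \<tau> S
  proof -
    have "((\<lambda>\<tau>. - ((y + (\<tau> - t)) powr (b - 1))) has_real_derivative (1 - b) * (y + (\<tau> - t)) powr (b - 2)) (at \<tau> within S)"
      using that y by (auto intro!: derivative_eq_intros simp: algebra_simps)
    from DERIV_cdivide[OF this, of "1 - b"] b show ?thesis by simp
  qed
  have 1: "((\<lambda>\<tau>. (y + \<bar>t - \<tau>\<bar>) powr (b - 2)) has_integral
     (y + (t - t)) powr (b - 1) / (1 - b) - (y + (t - (t - l))) powr (b - 1) / (1 - b)) {t - l..t}"
  proof (rule has_integral_eq[rotated])
    show "((\<lambda>\<tau>. (y + (t - \<tau>)) powr (b - 2)) has_integral
     (y + (t - t)) powr (b - 1) / (1 - b) - (y + (t - (t - l))) powr (b - 1) / (1 - b)) {t - l..t}"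
      using l by (intro fundamental_theorem_of_calculus)
        (auto simp flip: has_real_derivative_iff_has_vector_derivative intro!: d1)
  qed auto
  have 2: "((\<lambda>\<tau>. (y + \<bar>t - \<tau>\<bar>) powr (b - 2)) has_integral
     - ((y + (t + l - t)) powr (b - 1) / (1 - b)) - - ((y + (t - t)) powr (b - 1) / (1 - b))) {t..t + l}"
  proof (rule has_integral_eq[rotated])
    show "((\<lambda>\<tau>. (y + (\<tau> - t)) powr (b - 2)) has_integral
     - ((y + (t + l - t)) powr (b - 1) / (1 - b)) - - ((y + (t - t)) powr (b - 1) / (1 - b))) {t..t + l}"
      using l by (intro fundamental_theorem_of_calculus[where f = "\<lambda>\<tau>. - ((y + (\<tau> - t)) powr (b - 1) / (1 - b))"])
        (auto simp flip: has_real_derivative_iff_has_vector_derivative intro!: d2)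
  qed auto
  from has_integral_combine[OF _ _ 1 2] l show ?thesis
    by (simp add: diff_divide_distrib)
qed

text \<open>The derivative kernel has no zero frequency, so the constant f(Re z) can be subtracted
  from \<open>f\<close>. With t = Re z and y = Im z, the Hoelder bound K (y + |t - \<tau>|)^b
  against the kernel bound 8/(y + |t - \<tau>|)^2 leaves an integral of size y^(b - 1); b < 1 makes
  its constant finite.\<close>

lemma hardy_littlewood:
  assumes c: "continuous_on UNIV f" and per: "\<And>t. f (t + 2 * pi) = f t"
    and hol: "\<And>t u. \<bar>f t - f u\<bar> \<le> K * \<bar>t - u\<bar> powr b" and b: "0 < b" "b < 1" and z: "0 < Im z"
  shows "norm (exp_series (\<lambda>k. of_nat k * fourier_coeff k f) z) \<le> 8 * K / (pi * (1 - b)) * Im z powr - (1 - b)"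
proof -
  define t y where "t = Re z" and "y = Im z"
  have y: "0 < y" using z by (simp add: y_def)
  define g where "g = (\<lambda>\<tau>. f \<tau> + (- f t))"
  have cf: "continuous_on S f" for S using c continuous_on_subset by blast
  have cg: "continuous_on S g" for S unfolding g_def by (intro continuous_intros cf)
  have Knn: "0 \<le> K" using hol[of 1 0] abs_ge_zero order_trans by fastforce
  have "fourier_coeff k g = fourier_coeff k f" if "0 < k" for k
    unfolding g_def using that by (subst fourier_coeff_add) (auto intro!: cf simp: fourier_coeff_const)
  then have "(\<lambda>k. of_nat k * fourier_coeff k f) = (\<lambda>k. of_nat k * fourier_coeff k g)" by (metis gr0I mult_eq_0_iff of_nat_0)
  moreover have "disc_summable of_nat" using disc_summable_of_nat_mult[OF disc_summable_bounded[of "\<lambda>_. 1" 1]] by simp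
  ultimately have "exp_series (\<lambda>k. of_nat k * fourier_coeff k f) z = (1 / (2 * pi)) *\<^sub>R integral {0..2 * pi} (\<lambda>\<tau>. of_real (g \<tau>) * exp_series of_nat (z - of_real \<tau>))"
    using fourier_coeff_series[OF cg _ z, of of_nat] by simp
  \<comment> \<open>The period is centred at t because the kernel bound requires horizontal distance
    at most pi.\<close>
  also have "integral {0..2 * pi} (\<lambda>\<tau>. of_real (g \<tau>) * exp_series of_nat (z - of_real \<tau>)) =
     integral {t - pi..t - pi + 2 * pi} (\<lambda>\<tau>. of_real (g \<tau>) * exp_series of_nat (z - of_real \<tau>))"
  proof (rule integral_periodic_shift[symmetric])
    show "continuous_on UNIV (\<lambda>\<tau>. of_real (g \<tau>) * exp_series of_nat (z - of_real \<tau>))"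
      unfolding g_def using z by (intro continuous_intros cf continuous_on_exp_series \<open>disc_summable of_nat\<close>) auto
    have "exp_series of_nat (z - of_real (\<tau> + 2 * pi)) = exp_series of_nat (z - of_real \<tau>)" for \<tau>
      using exp_series_periodic[of of_nat "z - of_real (\<tau> + 2 * pi)"] by (simp add: algebra_simps)
    then show "of_real (g (\<tau> + 2 * pi)) * exp_series of_nat (z - of_real (\<tau> + 2 * pi)) = of_real (g \<tau>) * exp_series of_nat (z - of_real \<tau>)" for \<tau>
      by (simp add: g_def per)
  qed
  also have "t - pi + 2 * pi = t + pi" by simp
  finally have eq: "norm (exp_series (\<lambda>k. of_nat k * fourier_coeff k f) z) =
     (1 / (2 * pi)) * norm (integral {t - pi..t + pi} (\<lambda>\<tau>. of_real (g \<tau>) * exp_series of_nat (z - of_real \<tau>)))"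
    by simp
  have "norm (integral {t - pi..t + pi} (\<lambda>\<tau>. of_real (g \<tau>) * exp_series of_nat (z - of_real \<tau>)))
      \<le> integral {t - pi..t + pi} (\<lambda>\<tau>. 8 * K * (y + \<bar>t - \<tau>\<bar>) powr (b - 2))"
  proof (rule integral_norm_bound_integral)
    show "(\<lambda>\<tau>. of_real (g \<tau>) * exp_series of_nat (z - of_real \<tau>)) integrable_on {t - pi..t + pi}"
      unfolding g_def using z by (intro integrable_continuous_interval continuous_intros cf continuous_on_exp_series \<open>disc_summable of_nat\<close>) auto
    show "(\<lambda>\<tau>. 8 * K * (y + \<bar>t - \<tau>\<bar>) powr (b - 2)) integrable_on {t - pi..t + pi}"
      using has_integral_mult_right[OF integral_powr_abs[OF y b(2), of pi t], of "8 * K"] by (auto intro: has_integral_integrable)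
    fix \<tau> assume \<tau>: "\<tau> \<in> {t - pi..t + pi}"
    have "norm (exp_series of_nat (z - of_real \<tau>)) \<le> 8 / (y + \<bar>t - \<tau>\<bar>)\<^sup>2"
      using norm_exp_series_of_nat_le[of "z - of_real \<tau>"] z \<tau> by (auto simp: t_def y_def)
    moreover have "\<bar>g \<tau>\<bar> \<le> K * (y + \<bar>t - \<tau>\<bar>) powr b"
    proof -
      have "\<bar>g \<tau>\<bar> \<le> K * \<bar>t - \<tau>\<bar> powr b" using hol[of \<tau> t] by (simp add: g_def abs_minus_commute)
      also have "\<dots> \<le> K * (y + \<bar>t - \<tau>\<bar>) powr b" using b y Knn by (intro mult_left_mono powr_mono2) auto
      finally show ?thesis .
    qed
    ultimately have "\<bar>g \<tau>\<bar> * norm (exp_series of_nat (z - of_real \<tau>)) \<le> (K * (y + \<bar>t - \<tau>\<bar>) powr b) * (8 / (y + \<bar>t - \<tau>\<bar>)\<^sup>2)"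
      using Knn by (intro mult_mono) auto
    also have "\<dots> = 8 * K * (y + \<bar>t - \<tau>\<bar>) powr (b - 2)"
      using y by (simp add: powr_diff)
    finally show "norm (of_real (g \<tau>) * exp_series of_nat (z - of_real \<tau>)) \<le> 8 * K * (y + \<bar>t - \<tau>\<bar>) powr (b - 2)"
      by (simp add: norm_mult)
  qed
  also have "\<dots> = 8 * K * (2 * (y powr (b - 1) - (y + pi) powr (b - 1)) / (1 - b))"
    by (intro integral_unique has_integral_mult_right integral_powr_abs y b) simp
  also have "\<dots> \<le> 8 * K * (2 * y powr (b - 1) / (1 - b))"
    using b Knn by (intro mult_left_mono divide_right_mono) auto
  finally have "norm (exp_series (\<lambda>k. of_nat k * fourier_coeff k f) z) \<le> (1 / (2 * pi)) * (8 * K * (2 * y powr (b - 1) / (1 - b)))"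
    unfolding eq by (intro mult_left_mono) auto
  then show ?thesis by (simp add: y_def mult_ac)
qed

text \<open>Twice the real part adds the conjugate negative frequencies; frequency 0 is then counted
  twice and one copy is removed. The result is the classical Poisson extension of
  \<open>f\<close>.\<close>

definition poisson :: "(real \<Rightarrow> real) \<Rightarrow> real \<Rightarrow> real \<Rightarrow> real" where
  "poisson f t y = 2 * Re (exp_series (\<lambda>k. fourier_coeff k f) (Complex t y)) - Re (fourier_coeff 0 f)"

lemma poisson_integral:
  assumes c: "continuous_on {0..2 * pi} f" and y: "0 < y"
  shows "((\<lambda>\<tau>. f \<tau> * (2 * Re (exp_series (\<lambda>_. 1) (Complex (t - \<tau>) y)) - 1)) has_integral 2 * pi * poisson f t y) {0..2 * pi}"
proof -
  have a: "disc_summable (\<lambda>_. 1)" by (rule disc_summable_bounded[of _ 1]) simp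
  have sub: "Complex t y - of_real \<tau> = Complex (t - \<tau>) y" for \<tau> by (simp add: complex_eq_iff)
  have eq: "exp_series (\<lambda>k. fourier_coeff k f) (Complex t y) = (1 / (2 * pi)) *\<^sub>R
      integral {0..2 * pi} (\<lambda>\<tau>. of_real (f \<tau>) * exp_series (\<lambda>_. 1) (Complex (t - \<tau>) y))"
    using fourier_coeff_series[OF c a, of "Complex t y"] y sub by simp
  have "continuous_on {0..2 * pi} (\<lambda>\<tau>. of_real (f \<tau>) * exp_series (\<lambda>_. 1) (Complex (t - \<tau>) y))"
    using y by (intro continuous_intros c continuous_on_exp_series a) (auto simp: Complex_eq intro!: continuous_intros)
  then have "((\<lambda>\<tau>. of_real (f \<tau>) * exp_series (\<lambda>_. 1) (Complex (t - \<tau>) y)) has_integral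
      (2 * pi) *\<^sub>R exp_series (\<lambda>k. fourier_coeff k f) (Complex t y)) {0..2 * pi}"
    unfolding eq by (simp add: has_integral_integral[symmetric] integrable_continuous_interval)
  from has_integral_mult_right[OF has_integral_Re[OF this], of 2]
  have 1: "((\<lambda>\<tau>. 2 * (f \<tau> * Re (exp_series (\<lambda>_. 1) (Complex (t - \<tau>) y)))) has_integral
      2 * (2 * pi * Re (exp_series (\<lambda>k. fourier_coeff k f) (Complex t y)))) {0..2 * pi}" by simp
  have "(f has_integral 2 * pi * Re (fourier_coeff 0 f)) {0..2 * pi}"
    using c by (simp add: fourier_coeff_0 has_integral_integral[symmetric] integrable_continuous_interval)
  from has_integral_diff[OF 1 this] show ?thesis
    by (simp add: poisson_def algebra_simps)
qed

lemma poisson_kernel_eq: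
  assumes "0 < y"
  shows "2 * Re (exp_series (\<lambda>_. 1) (Complex h y)) - 1 = (1 - (exp (- y))\<^sup>2) / (norm (1 - exp (\<i> * Complex h y)))\<^sup>2"
proof -
  define q where "q = exp (\<i> * Complex h y)"
  have q1: "1 - q \<noteq> 0" using exp_ii_neq_1[of "Complex h y"] assms by (simp add: q_def)
  have "2 * Re (1 / (1 - q)) - 1 = (2 * Re (1 - q) - (norm (1 - q))\<^sup>2) / (norm (1 - q))\<^sup>2"
    using q1 by (simp add: Re_divide cmod_power2 diff_divide_distrib[symmetric] field_simps)
      (auto simp: complex_eq_iff sum_power2_eq_zero_iff field_simps)
  also have "2 * Re (1 - q) - (norm (1 - q))\<^sup>2 = 1 - (norm q)\<^sup>2"
    unfolding cmod_power2 by (simp add: power2_eq_square algebra_simps)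
  finally show ?thesis using assms by (simp add: exp_series_one q_def norm_exp_ii)
qed

lemma poisson_const: "poisson (\<lambda>_. c) t y = c"
proof -
  have "fourier_coeff 0 (\<lambda>_. c) = of_real c" by (subst fourier_coeff_0) auto
  then have "(\<lambda>k. fourier_coeff k (\<lambda>_. c) * w ^ k) = (\<lambda>k. if k = 0 then of_real c else 0)" for w
    by (auto simp: fun_eq_iff fourier_coeff_const)
  moreover have "(\<Sum>k. if k = 0 then complex_of_real c else 0) = of_real c"
    using sums_single[of 0 "\<lambda>_. complex_of_real c"] by (simp add: sums_iff eq_commute)
  ultimately show ?thesis by (simp add: poisson_def exp_series_def \<open>fourier_coeff 0 (\<lambda>_. c) = of_real c\<close>)
qed

text \<open>Both follow from the closed form (1 - r^2)/|1 - q|^2 with r = exp(-y), since |1 - q|^2 =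
  (1 - r)^2 + 2r(1 - cos h) is positive and at least 2r(1 - cos h).\<close>

lemma poisson_kernel_bounds:
  assumes y: "0 < y"
  defines "P \<equiv> \<lambda>h. 2 * Re (exp_series (\<lambda>_. 1) (Complex h y)) - 1"
  shows "0 \<le> P h" and "(1 - cos h) * P h \<le> (1 - (exp (- y))\<^sup>2) / (2 * exp (- y))"
proof -
  define r where "r = exp (- y)"
  define D where "D = (norm (1 - exp (\<i> * Complex h y)))\<^sup>2"
  have r: "0 < r" "r < 1" using y by (auto simp: r_def)
  have D: "0 < D" using exp_ii_neq_1[of "Complex h y"] y by (simp add: D_def)
  have P: "P h = (1 - r\<^sup>2) / D" using poisson_kernel_eq[OF y, of h] by (simp add: P_def D_def r_def)
  have r2: "0 \<le> 1 - r\<^sup>2" using r by (simp add: power_le_one)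
  show "0 \<le> P h" using r2 D by (simp add: P)
  have "2 * r * (1 - cos h) \<le> D"
    using norm_one_minus_exp[of "Complex h y"] by (simp add: D_def r_def)
  then have "(1 - cos h) / D \<le> 1 / (2 * r)" using D r by (simp add: field_simps)
  then have "(1 - r\<^sup>2) * ((1 - cos h) / D) \<le> (1 - r\<^sup>2) * (1 / (2 * r))" using r2 by (rule mult_left_mono)
  then show "(1 - cos h) * P h \<le> (1 - (exp (- y))\<^sup>2) / (2 * exp (- y))"
    by (simp add: P r_def mult.commute)
qed

text \<open>Korovkin's device: the Poisson kernel integrates \<open>1 - cos\<close> to \<open>O(1 - exp (- y))\<close>, so this modulus
  replaces a splitting of the Poisson integral into near and far parts.\<close>

lemma periodic_modulus:
  assumes c: "continuous_on UNIV f" and per: "\<And>t. f (t + 2 * pi) = (f t :: real)" and e: "0 < e"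
  shows "\<exists>M\<ge>0. \<forall>\<tau>. \<bar>f \<tau> - f t\<bar> \<le> e + M * (1 - cos (t - \<tau>))"
proof -
  have "isCont f t" using c by (simp add: continuous_on_eq_continuous_at)
  then obtain d where d: "0 < d" and fd: "\<And>\<tau>. \<bar>\<tau> - t\<bar> < d \<Longrightarrow> \<bar>f \<tau> - f t\<bar> < e"
    using e unfolding continuous_at_eps_delta dist_real_def by metis
  define d' where "d' = min d pi"
  have d': "0 < d'" "d' \<le> pi" "d' \<le> d" using d by (auto simp: d'_def)
  have "cos d' < cos 0" using d' by (intro cos_monotone_0_pi) auto
  then have cd: "0 < 1 - cos d'" by simp
  have "compact (f ` {t - pi..t + pi})" by (intro compact_continuous_image continuous_on_subset[OF c]) auto
  then obtain B where B: "\<And>\<tau>. \<tau> \<in> {t - pi..t + pi} \<Longrightarrow> norm (f \<tau>) \<le> B"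
    by (meson compact_imp_bounded bounded_iff imageI)
  define M where "M = 2 * B / (1 - cos d')"
  have B0: "0 \<le> B" using B[of t] by force
  have M0: "0 \<le> M" using B0 cd by (simp add: M_def)
  have near: "\<bar>f \<tau> - f t\<bar> \<le> e + M * (1 - cos (t - \<tau>))" if \<tau>: "\<tau> \<in> {t - pi..t + pi}" for \<tau>
  proof (cases "\<bar>\<tau> - t\<bar> < d'")
    case True
    then have "\<bar>f \<tau> - f t\<bar> < e" using d' by (intro fd) auto
    moreover have "0 \<le> M * (1 - cos (t - \<tau>))" using M0 by simp
    ultimately show ?thesis by linarith
  next
    case False
    have "cos (t - \<tau>) = cos \<bar>t - \<tau>\<bar>" by simp
    also have "\<dots> \<le> cos d'" using False \<tau> d' by (intro cos_monotone_0_pi_le) auto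
    finally have "M * (1 - cos d') \<le> M * (1 - cos (t - \<tau>))" using M0 by (intro mult_left_mono) auto
    moreover have "M * (1 - cos d') = 2 * B" using cd by (simp add: M_def)
    moreover have "\<bar>f \<tau> - f t\<bar> \<le> 2 * B" using B[OF \<tau>] B[of t] by force
    ultimately show ?thesis using e by linarith
  qed
  have "\<bar>f \<tau> - f t\<bar> \<le> e + M * (1 - cos (t - \<tau>))" for \<tau>
  proof -
    obtain n :: int where n: "\<tau> + of_int n * (2 * pi) \<in> {t - pi..<t - pi + 2 * pi}" using mod_2pi_range by blast
    have "f (\<tau> + of_int n * (2 * pi)) = f \<tau>" by (rule periodic_reduce[where f = f, OF per])
    moreover have "cos (t - \<tau> - of_int n * (2 * pi)) = cos (t - \<tau>)"
      using periodic_reduce[where f = cos and t = "t - \<tau> - of_int n * (2 * pi)" and n = n] by simp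
    ultimately show ?thesis using near[of "\<tau> + of_int n * (2 * pi)"] n by (auto simp: algebra_simps)
  qed
  then show ?thesis using M0 by blast
qed

text \<open>The kernel is nonnegative with mean 1, so the deviation from f(t) is at most the kernel
  average of the modulus of continuity: e/2 plus a multiple of \<open>b y\<close>, which tends to 0
  with y.\<close>

lemma poisson_tendsto:
  assumes c: "continuous_on UNIV f" and per: "\<And>t. f (t + 2 * pi) = f t"
  shows "(poisson f t \<longlongrightarrow> f t) (at_right 0)"
proof (rule tendstoI)
  fix e :: real assume e: "0 < e"
  then have e2: "0 < e / 2" by simp
  obtain M where M: "0 \<le> M" and fM: "\<And>\<tau>. \<bar>f \<tau> - f t\<bar> \<le> e / 2 + M * (1 - cos (t - \<tau>))"
    using periodic_modulus[OF c per e2] by blast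
  have cf: "continuous_on S f" for S using c continuous_on_subset by blast
  define b where "b y = (1 - (exp (- y))\<^sup>2) / (2 * exp (- y))" for y :: real
  have bound: "\<bar>poisson f t y - f t\<bar> \<le> e / 2 + M * b y" if y: "0 < y" for y
  proof -
    define P where "P h = 2 * Re (exp_series (\<lambda>_. 1) (Complex h y)) - 1" for h
    have P: "0 \<le> P h" "(1 - cos h) * P h \<le> b y" for h
      unfolding P_def b_def by (rule poisson_kernel_bounds[OF y])+
    have i1: "((\<lambda>\<tau>. P (t - \<tau>)) has_integral 2 * pi) {0..2 * pi}"
      using poisson_integral[of "\<lambda>_. 1" y t] y by (simp add: poisson_const P_def)
    have if': "((\<lambda>\<tau>. f \<tau> * P (t - \<tau>)) has_integral 2 * pi * poisson f t y) {0..2 * pi}"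
      unfolding P_def by (rule poisson_integral[OF cf y])
    have i: "((\<lambda>\<tau>. (f \<tau> - f t) * P (t - \<tau>)) has_integral 2 * pi * (poisson f t y - f t)) {0..2 * pi}"
      using has_integral_diff[OF if' has_integral_mult_right[OF i1, of "f t"]] by (simp add: algebra_simps)
    have i2: "((\<lambda>\<tau>. e / 2 * P (t - \<tau>) + M * b y) has_integral e / 2 * (2 * pi) + 2 * pi * (M * b y)) {0..2 * pi}"
      using has_integral_add[OF has_integral_mult_right[OF i1, of "e / 2"] has_integral_const_real[of "M * b y" 0 "2 * pi"]] by simp
    have "norm (integral {0..2 * pi} (\<lambda>\<tau>. (f \<tau> - f t) * P (t - \<tau>))) \<le> integral {0..2 * pi} (\<lambda>\<tau>. e / 2 * P (t - \<tau>) + M * b y)"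
    proof (rule integral_norm_bound_integral)
      fix \<tau>
      have "\<bar>f \<tau> - f t\<bar> * P (t - \<tau>) \<le> (e / 2 + M * (1 - cos (t - \<tau>))) * P (t - \<tau>)"
        by (intro mult_right_mono fM P)
      also have "\<dots> = e / 2 * P (t - \<tau>) + M * ((1 - cos (t - \<tau>)) * P (t - \<tau>))" by (simp add: algebra_simps)
      also have "\<dots> \<le> e / 2 * P (t - \<tau>) + M * b y" by (intro add_left_mono mult_left_mono P M)
      finally show "norm ((f \<tau> - f t) * P (t - \<tau>)) \<le> e / 2 * P (t - \<tau>) + M * b y"
        using P(1)[of "t - \<tau>"] by (simp add: abs_mult)
    qed (use i i2 in \<open>auto intro: has_integral_integrable\<close>)
    then have "norm (2 * pi * (poisson f t y - f t)) \<le> e / 2 * (2 * pi) + 2 * pi * (M * b y)"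
      unfolding integral_unique[OF i] integral_unique[OF i2] .
    moreover have "norm (2 * pi * (poisson f t y - f t)) = 2 * pi * \<bar>poisson f t y - f t\<bar>" by (simp add: abs_mult)
    moreover have "e / 2 * (2 * pi) + 2 * pi * (M * b y) = 2 * pi * (e / 2 + M * b y)" by (simp add: algebra_simps)
    ultimately have "2 * pi * \<bar>poisson f t y - f t\<bar> \<le> 2 * pi * (e / 2 + M * b y)" by linarith
    then show ?thesis by (simp only: mult_le_cancel_left_pos[of "2 * pi"] pi_gt_zero mult_pos_pos zero_less_numeral)
  qed
  have "isCont b 0" unfolding b_def by (intro continuous_intros) auto
  then have "(b \<longlongrightarrow> b 0) (at_right 0)"
    unfolding continuous_at by (rule tendsto_mono[OF at_le[OF subset_UNIV]])
  moreover have "b 0 = 0" by (simp add: b_def)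
  ultimately have "((\<lambda>y. M * b y) \<longlongrightarrow> M * 0) (at_right 0)" by (intro tendsto_intros) simp
  then have "\<forall>\<^sub>F y in at_right 0. dist (M * b y) (M * 0) < e / 2" using e2 by (rule tendstoD)
  moreover have "\<forall>\<^sub>F y in at_right (0::real). 0 < y" by (rule eventually_at_right_less)
  ultimately show "\<forall>\<^sub>F y in at_right 0. dist (poisson f t y) (f t) < e"
  proof eventually_elim
    case (elim y)
    then have "\<bar>M * b y\<bar> < e / 2" by (simp add: dist_real_def)
    then show ?case using bound[OF elim(2)] by (simp only: dist_real_def)
  qed
qed

text \<open>All Poisson means vanish, and \<open>f\<close> is their limit.\<close>

lemma fourier_coeff_eq_0_imp_zero:
  assumes "continuous_on UNIV f" "\<And>t. f (t + 2 * pi) = f t" "\<And>k. fourier_coeff k f = 0"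
  shows "f t = 0"
proof -
  have "poisson f t = (\<lambda>_. 0)" by (simp add: fun_eq_iff poisson_def exp_series_def assms(3))
  then show ?thesis
    using tendsto_unique[OF _ poisson_tendsto[OF assms(1,2), of t], of 0] by simp
qed

text \<open>Closed forms come as gauge integrals; for nonnegative integrands they carry over to
  Lebesgue integrals, integrability included.\<close>

lemma has_bochner_integral_nonneg:
  fixes f :: "real \<Rightarrow> real"
  assumes "\<And>x. 0 \<le> f x" "(f has_integral I) S" "f \<in> borel_measurable borel" "S \<in> sets borel"
  shows "has_bochner_integral lborel (\<lambda>x. indicator S x * f x) I"
proof (rule has_bochner_integral_nn_integral)
  show "(\<lambda>x. indicator S x * f x) \<in> borel_measurable lborel" using assms(3,4) by measurable
  show "0 \<le> I" using has_integral_nonneg[OF assms(2)] assms(1) by blast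
  show "(\<integral>\<^sup>+ x. ennreal (indicator S x * f x) \<partial>lborel) = ennreal I"
    by (rule nn_integral_has_integral_lebesgue[OF assms(1,2)])
qed (use assms(1) in auto)

lemma Gamma_scaled_integral:
  assumes q: "0 < q" and k: "0 < (k::real)"
  shows "has_bochner_integral lborel (\<lambda>x. indicator {0..} x * (x powr (q - 1) * exp (- (k * x)))) (Gamma q * k powr - q)"
proof -
  have "has_bochner_integral lborel (\<lambda>x. indicator {0..} x * (x powr (q - 1) / exp x)) (Gamma q)"
    by (rule has_bochner_integral_nonneg[OF _ Gamma_integral_real[OF q]]) auto
  then have "has_bochner_integral lborel (\<lambda>x. indicator {0..} (0 + k * x) * ((0 + k * x) powr (q - 1) / exp (0 + k * x))) (Gamma q /\<^sub>R \<bar>k\<bar>)"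
    using k by (subst (asm) lborel_has_bochner_integral_real_affine_iff[of k _ _ 0]) auto
  then have "has_bochner_integral lborel (\<lambda>x. k powr - (q - 1) * (indicator {0..} (0 + k * x) * ((0 + k * x) powr (q - 1) / exp (0 + k * x)))) (k powr - (q - 1) * (Gamma q /\<^sub>R \<bar>k\<bar>))"
    by (rule has_bochner_integral_mult_right)
  moreover have "k powr - (q - 1) * (indicator {0..} (0 + k * x) * ((0 + k * x) powr (q - 1) / exp (0 + k * x)))
     = indicator {0..} x * (x powr (q - 1) * exp (- (k * x)))" for x
  proof (cases "0 \<le> x")
    case True
    then have "(k * x) powr (q - 1) = k powr (q - 1) * x powr (q - 1)" using k by (simp add: powr_mult)
    moreover have "k powr - (q - 1) * k powr (q - 1) = 1" using k by (simp flip: powr_add)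
    then have "k powr - (q - 1) * (k powr (q - 1) * v) = v" for v by (metis mult.assoc mult_1_left)
    ultimately show ?thesis using True k by (simp add: exp_minus divide_inverse mult.assoc)
  qed (use k in \<open>simp add: zero_le_mult_iff\<close>)
  moreover have "k powr - (q - 1) * (Gamma q /\<^sub>R \<bar>k\<bar>) = Gamma q * k powr - q"
    using k by (simp add: powr_diff powr_minus powr_add field_simps)
  ultimately show ?thesis by (simp only:)
qed

lemma powr_tail_integral:
  fixes y m :: real
  assumes "0 < y" "m < -1"
  shows "has_bochner_integral lborel (\<lambda>x. indicator {0..} x * (y + x) powr m) (y powr (m + 1) / - (m + 1))"
proof -
  have "has_bochner_integral lborel (\<lambda>x. indicator {y..} x * x powr m) (- (y powr (m + 1)) / (m + 1))"
    using assms by (intro has_bochner_integral_nonneg has_integral_powr_to_inf) auto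
  then have "has_bochner_integral lborel (\<lambda>x. indicator {y..} (y + 1 * x) * (y + 1 * x) powr m) ((- (y powr (m + 1)) / (m + 1)) /\<^sub>R \<bar>1\<bar>)"
    by (subst (asm) lborel_has_bochner_integral_real_affine_iff[of 1 _ _ y]) auto
  moreover have "indicator {y..} (y + 1 * x) = (indicator {0..} x :: real)" for x by (simp add: indicator_def)
  moreover have "- (y powr (m + 1)) / (m + 1) = y powr (m + 1) / - (m + 1)"
    using minus_divide_right[of "y powr (m + 1)" "m + 1"] by simp
  ultimately show ?thesis by simp
qed

text \<open>The factor k^-q is 1/Gamma(q) times the integral of x^(q-1) exp(-kx), and exp(-kx) moves
  z to z + ix; so the series is an integral of \<open>exp_series a\<close> along the vertical ray
  above z. As q \<ge> 1, x^(q-1) \<le> (y + x)^(q-1), and the remaining integral of (y + x)^(q-1-p)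
  converges because p > q.\<close>

lemma exp_series_fractional_integral_bound:
  assumes a: "disc_summable a" and a0: "a 0 = 0" and q: "1 \<le> q" "q < p"
    and C: "\<And>z. 0 < Im z \<Longrightarrow> norm (exp_series a z) \<le> C * Im z powr - p" and z: "0 < Im z"
  shows "norm (exp_series (\<lambda>k. of_real (real k powr - q) * a k) z) \<le> C / (Gamma q * (p - q)) * Im z powr (q - p)"
proof -
  define y where "y = Im z"
  have y: "0 < y" using z by (simp add: y_def)
  define w where "w k x = indicator {0..} x * (x powr (q - 1) * exp (- (real k * x)))" for k and x :: real
  define F where "F k x = w k x *\<^sub>R (a k * exp (\<i> * z) ^ k)" for k x
  have Gq: "0 < Gamma q" using q by (intro Gamma_real_pos) auto
  have W: "has_bochner_integral lborel (w k) (Gamma q * real k powr - q)" if "0 < k" for k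
    unfolding w_def using Gamma_scaled_integral[of q "real k"] q that by simp
  have w0: "0 \<le> w k x" for k x by (simp add: w_def)
  have F: "has_bochner_integral lborel (F k) ((Gamma q * real k powr - q) *\<^sub>R (a k * exp (\<i> * z) ^ k))" for k
  \<comment> \<open>At k = 0 the Gamma integral diverges; \<open>a 0 = 0\<close> removes this
    term.\<close>
  proof (cases "k = 0")
    case True
    then show ?thesis using a0 by (simp add: F_def[abs_def] has_bochner_integral_zero)
  next
    case False
    then show ?thesis unfolding F_def by (intro has_bochner_integral_scaleR_left W) auto
  qed
  have nF: "has_bochner_integral lborel (\<lambda>x. norm (F k x)) ((Gamma q * real k powr - q) * norm (a k * exp (\<i> * z) ^ k))" for k
  proof (cases "k = 0")
    case True
    then show ?thesis using a0 by (simp add: F_def has_bochner_integral_zero)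
  next
    case False
    have "norm (F k x) = w k x * norm (a k * exp (\<i> * z) ^ k)" for x
      unfolding F_def using w0[of k x] by (simp del: norm_mult)
    then show ?thesis using False W[of k] by (simp only:) (intro has_bochner_integral_mult_left, auto)
  qed
  have series: "(\<Sum>k. F k x) = indicator {0..} x *\<^sub>R (x powr (q - 1) *\<^sub>R exp_series a (z + \<i> * of_real x))"
      "summable (\<lambda>k. norm (F k x))" for x
  proof -
    have e: "exp (\<i> * (z + \<i> * of_real x)) ^ k = exp (- (real k * x)) *\<^sub>R exp (\<i> * z) ^ k" for k
    proof -
      have "exp (\<i> * (z + \<i> * of_real x)) = exp (\<i> * z) * of_real (exp (- x))"
        by (simp add: exp_add[symmetric] algebra_simps flip: exp_of_real)
      moreover have "exp (- x) ^ k = exp (- (real k * x))" by (simp add: exp_of_nat_mult[symmetric])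
      ultimately show ?thesis by (simp add: power_mult_distrib scaleR_conv_of_real flip: of_real_power)
    qed
    have Fe: "F k x = (indicator {0..} x * x powr (q - 1)) *\<^sub>R (a k * exp (\<i> * (z + \<i> * of_real x)) ^ k)" for k
      unfolding e F_def w_def by simp
    show "summable (\<lambda>k. norm (F k x))"
    proof (cases "0 \<le> x")
      case True
      have "summable (\<lambda>k. norm (a k * exp (\<i> * (z + \<i> * of_real x)) ^ k))"
        by (rule exp_series_abs_summable[OF a]) (use z True in simp)
      from summable_mult[OF this, of "\<bar>indicator {0..} x * x powr (q - 1)\<bar>"] show ?thesis unfolding Fe norm_scaleR .
    qed (simp add: F_def w_def)
    show "(\<Sum>k. F k x) = indicator {0..} x *\<^sub>R (x powr (q - 1) *\<^sub>R exp_series a (z + \<i> * of_real x))"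
    proof (cases "0 \<le> x")
      case True
      have "summable (\<lambda>k. a k * exp (\<i> * (z + \<i> * of_real x)) ^ k)"
        by (rule summable_norm_cancel[OF exp_series_abs_summable[OF a]]) (use z True in simp)
      then show ?thesis unfolding Fe exp_series_def by (subst suminf_scaleR_right[symmetric]) auto
    qed (simp add: F_def w_def)
  qed
  have sm: "summable (\<lambda>k. \<integral>x. norm (F k x) \<partial>lborel)"
  proof -
    have "summable (\<lambda>k. Gamma q * norm (a k * exp (\<i> * z) ^ k))" by (intro summable_mult exp_series_abs_summable a z)
    moreover have "norm (\<integral>x. norm (F k x) \<partial>lborel) \<le> Gamma q * norm (a k * exp (\<i> * z) ^ k)" for k
    proof -
      have "real k powr - q \<le> 1" using q by (cases "k = 0") (auto simp: powr_minus intro!: ge_one_powr_ge_zero inverse_le_1_iff[THEN iffD2])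
      then have "Gamma q * real k powr - q * norm (a k * exp (\<i> * z) ^ k) \<le> Gamma q * 1 * norm (a k * exp (\<i> * z) ^ k)"
        using Gq by (intro mult_right_mono mult_left_mono) auto
      then show ?thesis using Gq by (simp add: has_bochner_integral_integral_eq[OF nF] abs_mult)
    qed
    ultimately show ?thesis by (rule summable_comparison_test'[where N = 0])
  qed
  have iF: "integrable lborel (F k)" for k using F by (rule integrable.intros)
  have "(\<lambda>k. integral\<^sup>L lborel (F k)) sums (\<integral>x. (\<Sum>k. F k x) \<partial>lborel)"
    by (rule sums_integral[OF iF _ sm]) (use series(2) in auto)
  then have "(\<lambda>k. Gamma q *\<^sub>R (of_real (real k powr - q) * a k * exp (\<i> * z) ^ k)) sums (\<integral>x. (\<Sum>k. F k x) \<partial>lborel)"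
    by (simp add: has_bochner_integral_integral_eq[OF F] scaleR_conv_of_real mult_ac)
  from sums_scaleR_right[OF this, of "inverse (Gamma q)"] Gq
  have "(\<lambda>k. of_real (real k powr - q) * a k * exp (\<i> * z) ^ k) sums (inverse (Gamma q) *\<^sub>R (\<integral>x. (\<Sum>k. F k x) \<partial>lborel))"
    by simp
  then have eq: "exp_series (\<lambda>k. of_real (real k powr - q) * a k) z = inverse (Gamma q) *\<^sub>R (\<integral>x. (\<Sum>k. F k x) \<partial>lborel)"
    by (simp add: exp_series_def sums_iff)
  have isum: "integrable lborel (\<lambda>x. \<Sum>k. F k x)"
    by (rule integrable_suminf[OF iF _ sm]) (use series(2) in auto)
  have T: "has_bochner_integral lborel (\<lambda>x. C * (indicator {0..} x * (y + x) powr (q - 1 - p))) (C * (y powr (q - 1 - p + 1) / - (q - 1 - p + 1)))"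
    using q y by (intro has_bochner_integral_mult_right powr_tail_integral) auto
  have "norm (exp_series a \<i>) \<le> C" using C[of \<i>] by simp
  then have Cnn: "0 \<le> C" by (rule order_trans[OF norm_ge_zero])
  have "norm (\<integral>x. (\<Sum>k. F k x) \<partial>lborel) \<le> (\<integral>x. norm (\<Sum>k. F k x) \<partial>lborel)" by (rule integral_norm_bound)
  also have "\<dots> \<le> (\<integral>x. C * (indicator {0..} x * (y + x) powr (q - 1 - p)) \<partial>lborel)"
  proof (rule integral_mono)
    show "integrable lborel (\<lambda>x. norm (\<Sum>k. F k x))" using isum by (rule integrable_norm)
    show "integrable lborel (\<lambda>x. C * (indicator {0..} x * (y + x) powr (q - 1 - p)))" using T by (rule integrable.intros)
    fix x
    show "norm (\<Sum>k. F k x) \<le> C * (indicator {0..} x * (y + x) powr (q - 1 - p))"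
    proof (cases "0 \<le> x")
      case True
      have "norm (exp_series a (z + \<i> * of_real x)) \<le> C * Im (z + \<i> * of_real x) powr - p" using z True by (intro C) auto
      then have "x powr (q - 1) * norm (exp_series a (z + \<i> * of_real x)) \<le> (y + x) powr (q - 1) * (C * (y + x) powr - p)"
        using True y q by (intro mult_mono powr_mono2) (auto simp: y_def)
      also have "\<dots> = C * (y + x) powr (q - 1 - p)"
        using powr_add[of "y + x" "q - 1" "- p"] by (simp add: mult.left_commute)
      finally show ?thesis using True by (simp add: series(1))
    qed (simp add: series(1))
  qed
  also have "\<dots> = C * (y powr (q - p) / (p - q))"
    unfolding has_bochner_integral_integral_eq[OF T] by simp
  finally have "norm (\<integral>x. (\<Sum>k. F k x) \<partial>lborel) \<le> C * (y powr (q - p) / (p - q))" .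
  then have "norm (exp_series (\<lambda>k. of_real (real k powr - q) * a k) z) \<le> inverse (Gamma q) * (C * (y powr (q - p) / (p - q)))"
    unfolding eq norm_scaleR abs_inverse abs_of_pos[OF Gq] using Gq by (intro mult_left_mono) auto
  then show ?thesis by (simp add: y_def field_simps)
qed

subsection \<open>Recovering Hoelder regularity from the second derivative\<close>

text \<open>Integration along a vertical segment against the primitive C y^m / m. Negative
  \<open>m\<close> measures growth towards the real line, positive \<open>m\<close> convergence to
  boundary values; both signs occur below.\<close>

lemma vertical_bound:
  assumes d: "\<And>z. 0 < Im z \<Longrightarrow> (F has_field_derivative F' z) (at z)"
    and b: "\<And>z. 0 < Im z \<Longrightarrow> Im z \<le> 1 \<Longrightarrow> norm (F' z) \<le> C * Im z powr (m - 1)"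
    and m: "m \<noteq> 0" and y: "0 < y1" "y1 \<le> y2" "y2 \<le> 1"
  shows "norm (F (Complex t y2) - F (Complex t y1)) \<le> C / m * y2 powr m - C / m * y1 powr m"
proof (cases "y1 = y2")
  case False
  then have less: "y1 < y2" using y by simp
  have dF: "((\<lambda>y. F (Complex t y)) has_vector_derivative \<i> * F' (Complex t y)) (at y)" if "0 < y" for y
  proof -
    have "((\<lambda>y. Complex t y) has_vector_derivative \<i>) (at y)"
      unfolding Complex_eq by (auto intro!: derivative_eq_intros)
    from field_vector_diff_chain_at[OF this d] that show ?thesis by (simp add: o_def)
  qed
  have dp: "((\<lambda>y. C / m * y powr m) has_vector_derivative C * y powr (m - 1)) (at y)" if "0 < y" for y
    unfolding has_real_derivative_iff_has_vector_derivative[symmetric]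
    using that m by (auto intro!: derivative_eq_intros)
  show ?thesis
  proof (rule differentiable_bound_general[OF less])
    show "continuous_on {y1..y2} (\<lambda>y. F (Complex t y))"
      using dF y by (intro continuous_at_imp_continuous_on ballI has_vector_derivative_continuous[OF dF]) auto
    show "continuous_on {y1..y2} (\<lambda>y. C / m * y powr m)"
      using dp y by (intro continuous_at_imp_continuous_on ballI has_vector_derivative_continuous[OF dp]) auto
    fix y assume "y1 < y" "y < y2"
    then have "0 < y" "y \<le> 1" using y by auto
    then show "((\<lambda>y. F (Complex t y)) has_vector_derivative \<i> * F' (Complex t y)) (at y)"
       "((\<lambda>y. C / m * y powr m) has_vector_derivative C * y powr (m - 1)) (at y)"
       "norm (\<i> * F' (Complex t y)) \<le> C * y powr (m - 1)"
      using dF dp b[of "Complex t y"] by (auto simp: norm_mult)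
  qed
qed simp

lemma horizontal_bound:
  assumes d: "\<And>z. 0 < Im z \<Longrightarrow> (F has_field_derivative F' z) (at z)"
    and b: "\<And>z. Im z = y \<Longrightarrow> norm (F' z) \<le> B" and y: "0 < y"
  shows "norm (F (Complex t y) - F (Complex u y)) \<le> B * \<bar>t - u\<bar>"
proof -
  have "norm (F (Complex t y) - F (Complex u y)) \<le> B * norm (Complex t y - Complex u y)"
  proof (rule field_differentiable_bound[of "{z. Im z = y}" F F'])
    have "\<And>u v. u + v = 1 \<Longrightarrow> u * y + v * y = y" by (metis distrib_right mult_1)
    then show "convex {z. Im z = y}" by (auto simp: convex_def)
  qed (use d b y in \<open>auto intro: has_field_derivative_at_within\<close>)
  also have "norm (Complex t y - Complex u y) = \<bar>t - u\<bar>" by (simp add: cmod_def)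
  finally show ?thesis .
qed

text \<open>At heights from h = |t - u| on, the horizontal segment is good enough. Below, the path
  rises to height h, crosses and descends: two vertical legs of size C h^m / m and a crossing of
  size C h^m give the constant C (2/m + 1).\<close>

lemma horizontal_holder:
  assumes d: "\<And>z. 0 < Im z \<Longrightarrow> (F has_field_derivative F' z) (at z)"
    and b: "\<And>z. 0 < Im z \<Longrightarrow> Im z \<le> 1 \<Longrightarrow> norm (F' z) \<le> C * Im z powr (m - 1)"
    and m: "0 < m" "m \<le> 1" and y: "0 < y" "y \<le> 1" and tu: "\<bar>t - u\<bar> \<le> 1"
  shows "norm (F (Complex t y) - F (Complex u y)) \<le> C * (2 / m + 1) * \<bar>t - u\<bar> powr m"
proof (cases "t = u")
  case False
  define h where "h = \<bar>t - u\<bar>"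
  have h: "0 < h" "h \<le> 1" using False tu by (auto simp: h_def)
  have "norm (F' \<i>) \<le> C" using b[of \<i>] by simp
  then have C: "0 \<le> C" by (rule order_trans[OF norm_ge_zero])
  have hm: "h powr (m - 1) * h = h powr m" using h by (simp add: powr_diff)
  show ?thesis
  proof (cases "h \<le> y")
    case True
    have "norm (F (Complex t y) - F (Complex u y)) \<le> C * y powr (m - 1) * h"
      unfolding h_def by (rule horizontal_bound[OF d]) (use b y in auto)
    also have "\<dots> \<le> C * h powr (m - 1) * h"
      using h True m C by (intro mult_right_mono mult_left_mono powr_mono2') auto
    also have "\<dots> = C * 1 * h powr m" using hm by (simp add: mult.assoc)
    also have "\<dots> \<le> C * (2 / m + 1) * h powr m" using C m by (intro mult_right_mono mult_left_mono) auto
    finally show ?thesis by (simp add: h_def)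
  next
    case False
    have v: "norm (F (Complex x h) - F (Complex x y)) \<le> C / m * h powr m" for x
    proof -
      have "norm (F (Complex x h) - F (Complex x y)) \<le> C / m * h powr m - C / m * y powr m"
        by (rule vertical_bound[OF d b]) (use False h y m in auto)
      moreover have "0 \<le> C / m * y powr m" using C m by simp
      ultimately show ?thesis by linarith
    qed
    have hb: "norm (F' z) \<le> C * h powr (m - 1)" if "Im z = h" for z using b[of z] h that by simp
    have "norm (F (Complex t h) - F (Complex u h)) \<le> C * h powr (m - 1) * \<bar>t - u\<bar>"
      by (rule horizontal_bound[OF d hb]) (use h in auto)
    also have "C * h powr (m - 1) * \<bar>t - u\<bar> = C * h powr m" using hm by (simp add: mult.assoc flip: h_def)
    finally have hz: "norm (F (Complex t h) - F (Complex u h)) \<le> C * h powr m" .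
    have "F (Complex t y) - F (Complex u y) = (F (Complex t h) - F (Complex u h))
       - (F (Complex t h) - F (Complex t y)) + (F (Complex u h) - F (Complex u y))" by simp
    also have "norm \<dots> \<le> C * h powr m + C / m * h powr m + C / m * h powr m"
      by (intro norm_triangle_mono norm_triangle_le_diff add_mono hz v order_trans[OF norm_triangle_ineq4])
    also have "\<dots> = C * (2 / m + 1) * h powr m" by (simp add: algebra_simps)
    finally show ?thesis by (simp add: h_def)
  qed
qed simp

lemma holder_local_to_global:
  fixes f :: "real \<Rightarrow> 'a::real_normed_vector"
  assumes loc: "\<And>t u. \<bar>t - u\<bar> \<le> 1 \<Longrightarrow> norm (f t - f u) \<le> K * \<bar>t - u\<bar> powr b"
    and B: "\<And>t. norm (f t) \<le> B" and b: "0 \<le> b"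
  shows "norm (f t - f u) \<le> (max K (2 * B)) * \<bar>t - u\<bar> powr b"
proof (cases "\<bar>t - u\<bar> \<le> 1")
  case True
  have "K * \<bar>t - u\<bar> powr b \<le> max K (2 * B) * \<bar>t - u\<bar> powr b" by (intro mult_right_mono) auto
  then show ?thesis using loc[OF True] by linarith
next
  case False
  have "norm (f t - f u) \<le> 2 * B" using norm_triangle_ineq4[of "f t" "f u"] B[of t] B[of u] by linarith
  moreover have "1 \<le> \<bar>t - u\<bar> powr b" using False b by (intro ge_one_powr_ge_zero) auto
  moreover have "0 \<le> B" using B[of t] norm_ge_zero order_trans by blast
  ultimately have "norm (f t - f u) * 1 \<le> max K (2 * B) * \<bar>t - u\<bar> powr b"
    by (intro mult_mono) auto
  then show ?thesis by simp
qed

lemma periodic_continuous_bounded: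
  fixes f :: "real \<Rightarrow> 'a::real_normed_vector"
  assumes c: "continuous_on UNIV f" and per: "\<And>t. f (t + 2 * pi) = f t"
  shows "\<exists>B. \<forall>t. norm (f t) \<le> B"
proof -
  have "compact (f ` {0..2 * pi})" by (intro compact_continuous_image continuous_on_subset[OF c]) auto
  then obtain B where B: "\<And>t. t \<in> {0..2 * pi} \<Longrightarrow> norm (f t) \<le> B"
    by (meson compact_imp_bounded bounded_iff imageI)
  have "norm (f t) \<le> B" for t
  proof -
    obtain n :: int where n: "t + of_int n * (2 * pi) \<in> {0..<0 + 2 * pi}" using mod_2pi_range by blast
    then show ?thesis using B[of "t + of_int n * (2 * pi)"] periodic_reduce[where f = f, OF per] by simp
  qed
  then show ?thesis by blast
qed

lemma holder_continuous_on:
  fixes f :: "real \<Rightarrow> 'a::real_normed_vector"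
  assumes "\<And>t u. \<bar>t - u\<bar> \<le> 1 \<Longrightarrow> norm (f t - f u) \<le> K * \<bar>t - u\<bar> powr b" "0 < b"
  shows "continuous_on UNIV f"
proof (intro continuous_at_imp_continuous_on ballI)
  fix u
  have "((\<lambda>t. K * \<bar>t - u\<bar> powr b) \<longlongrightarrow> K * \<bar>u - u\<bar> powr b) (at u)"
    using assms(2) by (intro tendsto_intros) auto
  then have "((\<lambda>t. K * \<bar>t - u\<bar> powr b) \<longlongrightarrow> 0) (at u)" by simp
  moreover have "\<forall>\<^sub>F t in at u. norm (f t - f u) \<le> K * \<bar>t - u\<bar> powr b"
    using eventually_at[of _ u UNIV] by (rule iffD2) (auto intro!: exI[of _ 1] assms simp: dist_real_def)
  ultimately have "((\<lambda>t. f t - f u) \<longlongrightarrow> 0) (at u)" by (rule Lim_null_comparison[rotated])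
  then show "isCont f u" by (simp add: isCont_def LIM_zero_iff)
qed

lemma exp_series_bound_height_one:
  assumes "disc_summable a"
  shows "\<exists>B. \<forall>t. norm (exp_series a (Complex t 1)) \<le> B"
proof (intro exI allI)
  fix t
  have "norm (exp_series a (Complex t 1)) \<le> (\<Sum>k. norm (a k * exp (\<i> * Complex t 1) ^ k))"
    unfolding exp_series_def by (intro summable_norm exp_series_abs_summable assms) simp
  also have "\<dots> = (\<Sum>k. norm (a k) * exp (- 1) ^ k)"
    by (simp add: norm_mult norm_power norm_exp_ii)
  finally show "norm (exp_series a (Complex t 1)) \<le> (\<Sum>k. norm (a k) * exp (- 1) ^ k)" .
qed

text \<open>Integrating down from height 1 turns O(y^(q-2)) for the second derivative into
  O(y^(q-1)) for the first. Hence the extension is Hoelder of order \<open>q\<close> along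
  horizontal lines, uniformly in the height, and the Poisson limit hands the estimate to
  \<open>f\<close>.\<close>

lemma holder_from_second_derivative:
  assumes c: "continuous_on UNIV f" and per: "\<And>t. f (t + 2 * pi) = f t"
    and q: "0 < q" "q < 1"
    and b: "\<And>z. 0 < Im z \<Longrightarrow> Im z \<le> 1 \<Longrightarrow> norm (exp_series (\<lambda>k. of_nat k * (of_nat k * fourier_coeff k f)) z) \<le> C * Im z powr (q - 2)"
  shows "\<exists>K. \<forall>t u. \<bar>f t - f u\<bar> \<le> K * \<bar>t - u\<bar> powr q"
proof -
  have a0: "disc_summable (\<lambda>k. fourier_coeff k f)" by (intro disc_summable_fourier_coeff continuous_on_subset[OF c]) auto
  note a1 = disc_summable_of_nat_mult[OF a0]
  define V where "V = exp_series (\<lambda>k. of_nat k * fourier_coeff k f)"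
  obtain B0 where B0: "\<And>t. norm (V (Complex t 1)) \<le> B0"
    unfolding V_def using exp_series_bound_height_one[OF a1] by blast
  have B0nn: "0 \<le> B0" using B0[of 0] norm_ge_zero order_trans by blast
  define C' where "C' = B0 + C / (1 - q)"
  have V: "norm (V z) \<le> C' * Im z powr (q - 1)" if z: "0 < Im z" "Im z \<le> 1" for z
  proof -
    define t y where "t = Re z" and "y = Im z"
    have zeq: "z = Complex t y" by (simp add: t_def y_def)
    have "norm (V (Complex t 1) - V (Complex t y)) \<le> C / (q - 1) * 1 powr (q - 1) - C / (q - 1) * y powr (q - 1)"
      unfolding V_def by (rule vertical_bound[OF exp_series_has_derivative[OF a1]])
        (use b q z in \<open>auto simp: y_def norm_mult\<close>)
    moreover have "norm (V z) \<le> norm (V (Complex t 1)) + norm (V (Complex t 1) - V (Complex t y))"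
      unfolding zeq using norm_triangle_ineq4[of "V (Complex t 1)" "V (Complex t 1) - V (Complex t y)"] by simp
    moreover have "norm (exp_series (\<lambda>k. of_nat k * (of_nat k * fourier_coeff k f)) \<i>) \<le> C" using b[of \<i>] by simp
    then have "0 \<le> C" by (rule order_trans[OF norm_ge_zero])
    then have "C / (q - 1) \<le> 0" using q by (simp add: divide_nonneg_neg)
    moreover have "1 \<le> y powr (q - 1)" using q z by (intro order_trans[OF _ powr_mono2'[of "q - 1" y 1]]) (auto simp: y_def)
    then have "B0 * 1 \<le> B0 * y powr (q - 1)" using B0nn by (rule mult_left_mono)
    ultimately have "norm (V z) \<le> B0 * y powr (q - 1) + - (C / (q - 1)) * y powr (q - 1)"
      using B0[of t] by simp
    also have "- (C / (q - 1)) = C / (1 - q)" using minus_divide_right[of C "q - 1"] by simp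
    finally show ?thesis by (simp add: C'_def y_def algebra_simps)
  qed
  define K where "K = 2 * (C' * (2 / q + 1))"
  have P: "\<bar>poisson f t y - poisson f u y\<bar> \<le> K * \<bar>t - u\<bar> powr q" if y: "0 < y" "y \<le> 1" and tu: "\<bar>t - u\<bar> \<le> 1" for y t u
  proof -
    have "norm (exp_series (\<lambda>k. fourier_coeff k f) (Complex t y) - exp_series (\<lambda>k. fourier_coeff k f) (Complex u y)) \<le> C' * (2 / q + 1) * \<bar>t - u\<bar> powr q"
      by (rule horizontal_holder[OF exp_series_has_derivative[OF a0]])
        (use V y tu q in \<open>auto simp: norm_mult V_def\<close>)
    moreover have "\<bar>Re (exp_series (\<lambda>k. fourier_coeff k f) (Complex t y) - exp_series (\<lambda>k. fourier_coeff k f) (Complex u y))\<bar>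
      \<le> norm (exp_series (\<lambda>k. fourier_coeff k f) (Complex t y) - exp_series (\<lambda>k. fourier_coeff k f) (Complex u y))" by (rule abs_Re_le_cmod)
    ultimately show ?thesis by (simp add: poisson_def K_def)
  qed
  have loc: "norm (f t - f u) \<le> K * \<bar>t - u\<bar> powr q" if tu: "\<bar>t - u\<bar> \<le> 1" for t u
  proof (rule tendsto_upperbound[OF tendsto_norm[OF tendsto_diff[OF poisson_tendsto[OF c per] poisson_tendsto[OF c per]]]])
    have "\<forall>\<^sub>F y in at_right (0::real). y \<in> {0<..<1}" by (rule eventually_at_right_real) simp
    then show "\<forall>\<^sub>F y in at_right 0. norm (poisson f t y - poisson f u y) \<le> K * \<bar>t - u\<bar> powr q"
      by eventually_elim (use P tu in auto)
  qed simp
  obtain B where "\<And>t. norm (f t) \<le> B" using periodic_continuous_bounded[OF c per] by blast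
  from holder_local_to_global[OF loc this] q show ?thesis by auto
qed

text \<open>Here m = q - 1 for an order q between 1 and 2. The first derivative, which is
  \<open>V\<close> up to the factor i, now converges at the real line with error O(y^m) uniform in
  t; so the t-derivatives of the Poisson means converge uniformly, and their limit is
  \<open>f'\<close>.\<close>

lemma C1_from_second_derivative:
  assumes c: "continuous_on UNIV f" and per: "\<And>t. f (t + 2 * pi) = f t"
    and m: "0 < m" "m < 1"
    and b: "\<And>z. 0 < Im z \<Longrightarrow> Im z \<le> 1 \<Longrightarrow> norm (exp_series (\<lambda>k. of_nat k * (of_nat k * fourier_coeff k f)) z) \<le> C * Im z powr (m - 1)"
  shows "\<exists>f' K. (\<forall>t. (f has_real_derivative f' t) (at t)) \<and> (\<forall>t. f' (t + 2 * pi) = f' t) \<and>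
    (\<forall>t u. \<bar>f' t - f' u\<bar> \<le> K * \<bar>t - u\<bar> powr m)"
proof -
  have a0: "disc_summable (\<lambda>k. fourier_coeff k f)" by (intro disc_summable_fourier_coeff continuous_on_subset[OF c]) auto
  note a1 = disc_summable_of_nat_mult[OF a0]
  define V where "V = exp_series (\<lambda>k. of_nat k * fourier_coeff k f)"
  have dV: "(V has_field_derivative \<i> * exp_series (\<lambda>k. of_nat k * (of_nat k * fourier_coeff k f)) z) (at z)" if "0 < Im z" for z
    unfolding V_def by (rule exp_series_has_derivative[OF a1 that])
  have bV: "norm (\<i> * exp_series (\<lambda>k. of_nat k * (of_nat k * fourier_coeff k f)) z) \<le> C * Im z powr (m - 1)" if "0 < Im z" "Im z \<le> 1" for z
    using b[OF that] by (simp add: norm_mult)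
  have "norm (exp_series (\<lambda>k. of_nat k * (of_nat k * fourier_coeff k f)) \<i>) \<le> C" using b[of \<i>] by simp
  then have C: "0 \<le> C" by (rule order_trans[OF norm_ge_zero])
  define y where "y n = inverse (real (Suc n))" for n
  have y: "0 < y n" "y n \<le> 1" for n by (auto simp: y_def inverse_le_1_iff)
  have y0: "y \<longlonglongrightarrow> 0" unfolding y_def by (rule LIMSEQ_inverse_real_of_nat)
  have yr: "filterlim y (at_right 0) sequentially"
    using y0 y(1) by (auto simp: filterlim_at less_imp_neq[symmetric])
  \<comment> \<open>The t-derivative of 2 Re F, where F is the series of \<open>f\<close> and F' = i
    V.\<close>
  define g where "g n t = - 2 * Im (V (Complex t (y n)))" for n t
  have dP: "((\<lambda>t. poisson f t (y n)) has_real_derivative g n t) (at t)" for n t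
  proof -
    have "((\<lambda>t. Complex t (y n)) has_vector_derivative 1) (at t)"
      unfolding Complex_eq by (auto intro!: derivative_eq_intros)
    from field_vector_diff_chain_at[OF this exp_series_has_derivative[OF a0]] y[of n]
    have "((\<lambda>t. exp_series (\<lambda>k. fourier_coeff k f) (Complex t (y n))) has_vector_derivative \<i> * V (Complex t (y n))) (at t)"
      by (simp add: o_def V_def)
    from has_vector_derivative_complex_iff[THEN iffD1, OF this]
    have "((\<lambda>t. Re (exp_series (\<lambda>k. fourier_coeff k f) (Complex t (y n)))) has_real_derivative - Im (V (Complex t (y n)))) (at t)" by simp
    from DERIV_diff[OF DERIV_cmult[OF this, of 2] DERIV_const[of "Re (fourier_coeff 0 f)"]] show ?thesis
      by (simp add: poisson_def g_def)
  qed
  have vert: "\<bar>g n t - g n' t\<bar> \<le> 2 * (C / m * (max (y n) (y n')) powr m)" for n n' t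
  proof -
    have "norm (V (Complex t y2) - V (Complex t y1)) \<le> C / m * y2 powr m" if "0 < y1" "y1 \<le> y2" "y2 \<le> 1" for y1 y2
    proof -
      have "norm (V (Complex t y2) - V (Complex t y1)) \<le> C / m * y2 powr m - C / m * y1 powr m"
        by (rule vertical_bound[OF dV bV]) (use that m in auto)
      moreover have "0 \<le> C / m * y1 powr m" using C m by simp
      ultimately show ?thesis by linarith
    qed
    from this[of "y n" "y n'"] this[of "y n'" "y n"] y
    have "norm (V (Complex t (y n)) - V (Complex t (y n'))) \<le> C / m * (max (y n) (y n')) powr m"
      by (cases "y n \<le> y n'") (auto simp: max_def norm_minus_commute)
    moreover have "\<bar>Im (V (Complex t (y n)) - V (Complex t (y n')))\<bar> \<le> norm (V (Complex t (y n)) - V (Complex t (y n')))"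
      by (rule abs_Im_le_cmod)
    ultimately show ?thesis by (simp add: g_def)
  qed
  have ym: "(\<lambda>n. 2 * (C / m * y n powr m)) \<longlonglongrightarrow> 2 * (C / m * 0 powr m)"
    using m y by (intro tendsto_intros y0) (auto intro!: always_eventually simp: less_imp_le)
  have "\<exists>l. (\<lambda>n. g n t) \<longlonglongrightarrow> l" for t
  proof -
    have "Cauchy (\<lambda>n. g n t)"
    proof (rule CauchyI)
      fix e :: real assume "0 < e"
      with ym have "\<forall>\<^sub>F n in sequentially. dist (2 * (C / m * y n powr m)) (2 * (C / m * 0 powr m)) < e" by (rule tendstoD)
      then obtain N where N: "\<And>n. n \<ge> N \<Longrightarrow> \<bar>2 * (C / m * y n powr m)\<bar> < e"
        using m by (auto simp: eventually_sequentially)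
      have "norm (g n t - g n' t) < e" if "n \<ge> N" "n' \<ge> N" for n n'
      proof (cases "y n \<le> y n'")
        case True
        then have mx: "max (y n) (y n') = y n'" by simp
        have "\<bar>g n t - g n' t\<bar> \<le> 2 * (C / m * y n' powr m)" using vert[of n t n'] unfolding mx .
        also have "\<dots> \<le> \<bar>2 * (C / m * y n' powr m)\<bar>" by (rule abs_ge_self)
        finally show ?thesis using N[OF that(2)] by simp
      next
        case False
        then have mx: "max (y n) (y n') = y n" by simp
        have "\<bar>g n t - g n' t\<bar> \<le> 2 * (C / m * y n powr m)" using vert[of n t n'] unfolding mx .
        also have "\<dots> \<le> \<bar>2 * (C / m * y n powr m)\<bar>" by (rule abs_ge_self)
        finally show ?thesis using N[OF that(1)] by simp
      qed
      then show "\<exists>N. \<forall>n\<ge>N. \<forall>n'\<ge>N. norm (g n t - g n' t) < e" by blast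
    qed
    then show ?thesis using Cauchy_convergent convergent_def by blast
  qed
  then obtain f' where f': "\<And>t. (\<lambda>n. g n t) \<longlonglongrightarrow> f' t" by metis
  have unif: "\<bar>g n t - f' t\<bar> \<le> 2 * (C / m * y n powr m)" for n t
  proof -
    have "\<forall>\<^sub>F n' in sequentially. norm (g n t - g n' t) \<le> 2 * (C / m * y n powr m)"
    proof (rule eventually_sequentiallyI[of n])
      fix n' assume "n \<le> n'"
      then have "y n' \<le> y n" by (auto simp: y_def intro!: le_imp_inverse_le)
      then show "norm (g n t - g n' t) \<le> 2 * (C / m * y n powr m)" using vert[of n t n'] by (simp add: max_def)
    qed
    from tendsto_upperbound[OF tendsto_norm[OF tendsto_diff[OF tendsto_const f']] this] show ?thesis by simp
  qed
  have "\<exists>F. \<forall>t\<in>UNIV. (\<lambda>n. poisson f t (y n)) \<longlonglongrightarrow> F t \<and> (F has_derivative (\<lambda>h. f' t * h)) (at t within UNIV)"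
  proof (rule has_derivative_sequence[where f' = "\<lambda>n t h. g n t * h"])
    show "((\<lambda>t. poisson f t (y n)) has_derivative (\<lambda>h. g n t * h)) (at t within UNIV)" for n t
      using dP[of n t] by (simp add: has_field_derivative_def)
    show "(\<lambda>n. poisson f 0 (y n)) \<longlonglongrightarrow> f 0" by (rule filterlim_compose[OF poisson_tendsto[OF c per] yr])
    fix e :: real assume "0 < e"
    with ym have "\<forall>\<^sub>F n in sequentially. dist (2 * (C / m * y n powr m)) (2 * (C / m * 0 powr m)) < e" by (rule tendstoD)
    then show "\<forall>\<^sub>F n in sequentially. \<forall>t\<in>UNIV. \<forall>h. norm (g n t * h - f' t * h) \<le> e * norm h"
    proof eventually_elim
      case (elim n)
      then have "\<bar>2 * (C / m * y n powr m)\<bar> < e" using m by simp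
      then have "\<bar>g n t - f' t\<bar> \<le> e" for t using unif[of n t] by linarith
      then show ?case by (auto simp: left_diff_distrib[symmetric] abs_mult intro!: mult_right_mono)
    qed
  qed auto
  then obtain F where F: "\<And>t. (\<lambda>n. poisson f t (y n)) \<longlonglongrightarrow> F t" "\<And>t. (F has_real_derivative f' t) (at t)"
    by (auto simp: has_field_derivative_def)
  have "F = f"
    using F(1) filterlim_compose[OF poisson_tendsto[OF c per] yr] LIMSEQ_unique by blast
  with F(2) have df: "(f has_real_derivative f' t) (at t)" for t by simp
  have per': "f' (t + 2 * pi) = f' t" for t
  proof -
    have "((\<lambda>t. f (t + 2 * pi)) has_real_derivative f' (t + 2 * pi)) (at t)"
      using df[of "t + 2 * pi"] by (simp add: DERIV_shift)
    then show ?thesis using df[of t] by (simp add: per DERIV_unique)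
  qed
  define K where "K = 2 * (C * (2 / m + 1))"
  have loc: "norm (f' t - f' u) \<le> K * \<bar>t - u\<bar> powr m" if tu: "\<bar>t - u\<bar> \<le> 1" for t u
  proof (rule tendsto_upperbound[OF tendsto_norm[OF tendsto_diff[OF f' f']]])
    have "norm (g n t - g n u) \<le> K * \<bar>t - u\<bar> powr m" for n
    proof -
      have "norm (V (Complex t (y n)) - V (Complex u (y n))) \<le> C * (2 / m + 1) * \<bar>t - u\<bar> powr m"
        by (rule horizontal_holder[OF dV bV]) (use y tu m in auto)
      moreover have "\<bar>Im (V (Complex t (y n)) - V (Complex u (y n)))\<bar> \<le> norm (V (Complex t (y n)) - V (Complex u (y n)))"
        by (rule abs_Im_le_cmod)
      ultimately show ?thesis by (simp add: g_def K_def)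
    qed
    then show "\<forall>\<^sub>F n in sequentially. norm (g n t - g n u) \<le> K * \<bar>t - u\<bar> powr m" by simp
  qed simp
  obtain B where "\<And>t. norm (f' t) \<le> B"
    using periodic_continuous_bounded[OF holder_continuous_on[OF loc m(1)] per'] by blast
  from holder_local_to_global[OF loc this] m df per' show ?thesis
    by (intro exI[of _ f'] exI[of _ "max K (2 * B)"]) auto
qed

subsection \<open>The fractional Laplacian of a periodic function\<close>

lemma integrable_even:
  fixes g :: "real \<Rightarrow> real"
  assumes i: "integrable lborel (\<lambda>h. indicator {0..} h * g h)" and even: "\<And>h. g (- h) = g h"
    and m: "g \<in> borel_measurable borel"
  shows "integrable lborel g"
proof -
  have i': "integrable lborel (\<lambda>h. indicator {0..} (- h) * g (- h))"
    using lborel_integrable_real_affine[OF i, of "- 1" 0] by simp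
  have "integrable lborel (\<lambda>h. \<bar>indicator {0..} h * g h\<bar> + \<bar>indicator {0..} (- h) * g (- h)\<bar>)"
    using i i' by (intro Bochner_Integration.integrable_add integrable_abs)
  then show ?thesis
    by (rule Bochner_Integration.integrable_bound) (use m in \<open>auto simp: even indicator_def abs_mult\<close>)
qed

lemma integrable_abs_powr_near:
  fixes a :: real
  assumes "-1 < a"
  shows "integrable lborel (\<lambda>h. indicator {- 1..1} h * \<bar>h\<bar> powr a)"
proof (rule integrable_even)
  have "has_bochner_integral lborel (\<lambda>h. indicator {0..1} h * h powr a) (1 powr (a + 1) / (a + 1))"
    by (rule has_bochner_integral_nonneg[OF _ has_integral_powr_from_0]) (use assms in auto)
  then have "integrable lborel (\<lambda>h. indicator {0..1} h * h powr a)" by (rule integrable.intros)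
  then show "integrable lborel (\<lambda>h. indicator {0..} h * (indicator {- 1..1} h * \<bar>h\<bar> powr a))"
    by (rule back_subst[where P = "integrable lborel"]) (auto simp: indicator_def fun_eq_iff)
qed (auto simp: indicator_def)

lemma integrable_abs_powr_tail:
  fixes a d :: real
  assumes "a < -1" "0 < d"
  shows "integrable lborel (\<lambda>h. indicator {h. d \<le> \<bar>h\<bar>} h * \<bar>h\<bar> powr a)"
proof (rule integrable_even)
  have "has_bochner_integral lborel (\<lambda>h. indicator {d..} h * h powr a) (- (d powr (a + 1)) / (a + 1))"
    by (rule has_bochner_integral_nonneg[OF _ has_integral_powr_to_inf]) (use assms in auto)
  then have "integrable lborel (\<lambda>h. indicator {d..} h * h powr a)" by (rule integrable.intros)
  then show "integrable lborel (\<lambda>h. indicator {0..} h * (indicator {h. d \<le> \<bar>h\<bar>} h * \<bar>h\<bar> powr a))"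
    by (rule back_subst[where P = "integrable lborel"]) (use assms in \<open>auto simp: indicator_def fun_eq_iff\<close>)
qed (auto simp: indicator_def)

text \<open>The sign is that of the negative Laplacian: on frequency k this is multiplication by 2(1
  - cos kh) \<ge> 0.\<close>

definition second_diff :: "(real \<Rightarrow> real) \<Rightarrow> real \<Rightarrow> real \<Rightarrow> real" where
  "second_diff f x h = 2 * f x - f (x + h) - f (x - h)"

text \<open>The principal value with the contributions of \<open>x + h\<close> and \<open>x - h\<close> averaged, which converges absolutely.\<close>

definition sym_frac :: "real \<Rightarrow> (real \<Rightarrow> real) \<Rightarrow> real \<Rightarrow> real" where
  "sym_frac s f x = (1 / 2) * (\<integral>h. second_diff f x h / \<bar>h\<bar> powr (1 + 2 * s) \<partial>lborel)"

text \<open>Mean value theorems on either side of x give h times a difference of values of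
  \<open>f'\<close> at distance at most 2h; 2^g \<le> 2 yields the constant.\<close>

lemma second_diff_bound:
  assumes d: "\<And>t. (f has_real_derivative f' t) (at t)"
    and hol: "\<And>t u. \<bar>f' t - f' u\<bar> \<le> K * \<bar>t - u\<bar> powr g" and g: "0 < g" "g \<le> 1"
  shows "\<bar>second_diff f x h\<bar> \<le> 2 * K * \<bar>h\<bar> powr (1 + g)"
proof -
  have Knn: "0 \<le> K" using hol[of 1 0] abs_ge_zero order_trans by fastforce
  have pos: "\<bar>second_diff f x h\<bar> \<le> 2 * K * h powr (1 + g)" if h: "0 < h" for h
  proof -
    obtain \<xi> where \<xi>: "x < \<xi>" "\<xi> < x + h" "f (x + h) - f x = h * f' \<xi>"
      using MVT2[of x "x + h" f f'] d h by auto
    obtain \<eta> where \<eta>: "x - h < \<eta>" "\<eta> < x" "f x - f (x - h) = h * f' \<eta>"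
      using MVT2[of "x - h" x f f'] d h by auto
    have "second_diff f x h = h * (f' \<eta> - f' \<xi>)" using \<xi>(3) \<eta>(3) by (simp add: second_diff_def algebra_simps)
    then have "\<bar>second_diff f x h\<bar> = h * \<bar>f' \<eta> - f' \<xi>\<bar>" using h by (simp add: abs_mult)
    also have "\<dots> \<le> h * (K * (2 * h) powr g)"
    proof (rule mult_left_mono)
      have "\<bar>f' \<eta> - f' \<xi>\<bar> \<le> K * \<bar>\<eta> - \<xi>\<bar> powr g" by (rule hol)
      also have "\<dots> \<le> K * (2 * h) powr g" using \<xi> \<eta> g Knn by (intro mult_left_mono powr_mono2) auto
      finally show "\<bar>f' \<eta> - f' \<xi>\<bar> \<le> K * (2 * h) powr g" .
    qed (use h in auto)
    also have "\<dots> = K * (2 powr g) * h powr (1 + g)" using h by (simp add: powr_mult powr_add)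
    also have "\<dots> \<le> K * 2 powr 1 * h powr (1 + g)"
      using g Knn by (intro mult_right_mono mult_left_mono powr_mono) auto
    finally show ?thesis by simp
  qed
  consider "h = 0" | "0 < h" | "h < 0" by linarith
  then show ?thesis
  proof cases
    case 1
    then show ?thesis by (simp add: second_diff_def)
  next
    case 2
    then show ?thesis using pos[OF 2] by simp
  next
    case 3
    have "second_diff f x h = second_diff f x (- h)" by (simp add: second_diff_def)
    then show ?thesis using pos[of "- h"] 3 by simp
  qed
qed

text \<open>Near 0 the majorant is a multiple of |h|^(g - 2s), integrable because 2s < 1 + g; away
  from 0 boundedness gives |h|^-(1 + 2s). Since \<open>D\<close> does not depend on x, it serves the
  truncation limit, continuity in x and Fubini alike.\<close>

lemma second_diff_dominated:
  fixes s :: real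
  assumes d: "\<And>t. (f has_real_derivative f' t) (at t)"
    and hol: "\<And>t u. \<bar>f' t - f' u\<bar> \<le> K * \<bar>t - u\<bar> powr g" and g: "0 < g" "g \<le> 1" "2 * s < 1 + g"
    and s: "0 < s" and B: "\<And>t. \<bar>f t\<bar> \<le> B"
  shows "\<exists>D. integrable lborel D \<and> (\<forall>x h. \<bar>second_diff f x h / \<bar>h\<bar> powr (1 + 2 * s)\<bar> \<le> D h)"
proof (intro exI conjI allI)
  let ?D = "\<lambda>h. 2 * K * (indicator {- 1..1} h * \<bar>h\<bar> powr (g - 2 * s)) +
     4 * B * (indicator {h. 1 \<le> \<bar>h\<bar>} h * \<bar>h\<bar> powr - (1 + 2 * s))"
  show "integrable lborel ?D"
    using g s by (intro Bochner_Integration.integrable_add integrable_mult_right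
        integrable_abs_powr_near integrable_abs_powr_tail) auto
  fix x h :: real
  have Knn: "0 \<le> K" using hol[of 1 0] abs_ge_zero order_trans by fastforce
  have Bnn: "0 \<le> B" using B[of 0] by linarith
  show "\<bar>second_diff f x h / \<bar>h\<bar> powr (1 + 2 * s)\<bar> \<le> ?D h"
  proof (cases "\<bar>h\<bar> \<le> 1")
    case True
    have "\<bar>second_diff f x h / \<bar>h\<bar> powr (1 + 2 * s)\<bar> = \<bar>second_diff f x h\<bar> / \<bar>h\<bar> powr (1 + 2 * s)" by simp
    also have "\<dots> \<le> 2 * K * \<bar>h\<bar> powr (1 + g) / \<bar>h\<bar> powr (1 + 2 * s)"
      by (intro divide_right_mono second_diff_bound[OF d hol] g) auto
    also have "\<dots> = 2 * K * (\<bar>h\<bar> powr (1 + g) / \<bar>h\<bar> powr (1 + 2 * s))" by simp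
    also have "\<bar>h\<bar> powr (1 + g) / \<bar>h\<bar> powr (1 + 2 * s) = \<bar>h\<bar> powr (g - 2 * s)"
      unfolding powr_diff[symmetric] by simp
    also have "2 * K * \<bar>h\<bar> powr (g - 2 * s) \<le> ?D h"
      using True Bnn by (auto simp: indicator_def abs_le_iff)
    finally show ?thesis .
  next
    case False
    have "\<bar>second_diff f x h\<bar> \<le> 4 * B"
      using B[of x] B[of "x + h"] B[of "x - h"] unfolding second_diff_def by linarith
    then have "\<bar>second_diff f x h\<bar> / \<bar>h\<bar> powr (1 + 2 * s) \<le> 4 * B / \<bar>h\<bar> powr (1 + 2 * s)"
      by (intro divide_right_mono) auto
    moreover have "\<bar>h\<bar> powr - (1 + 2 * s) = 1 / \<bar>h\<bar> powr (1 + 2 * s)" by (rule powr_minus_divide)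
    ultimately show ?thesis using False Knn by (auto simp: indicator_def simp del: minus_add_distrib)
  qed
qed

lemma truncated_integrable:
  fixes s :: real
  assumes c: "continuous_on UNIV f" and B: "\<And>t. \<bar>f t\<bar> \<le> B" and s: "0 < s" and e: "0 < e"
    and \<sigma>: "\<sigma> = 1 \<or> \<sigma> = - 1"
  shows "integrable lborel (\<lambda>h. indicator {h. e < \<bar>h\<bar>} h *\<^sub>R ((f x - f (x + \<sigma> * h)) / \<bar>h\<bar> powr (1 + 2 * s)))"
proof -
  have m: "f \<in> borel_measurable borel" using c by (rule borel_measurable_continuous_onI)
  have "integrable lborel (\<lambda>h. 2 * B * (indicator {h. e \<le> \<bar>h\<bar>} h * \<bar>h\<bar> powr - (1 + 2 * s)))"
    using s e by (intro integrable_mult_right integrable_abs_powr_tail) auto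
  then show ?thesis
  proof (rule Bochner_Integration.integrable_bound)
    show "(\<lambda>h. indicator {h. e < \<bar>h\<bar>} h *\<^sub>R ((f x - f (x + \<sigma> * h)) / \<bar>h\<bar> powr (1 + 2 * s))) \<in> borel_measurable lborel"
      using m by measurable
    show "AE h in lborel. norm (indicator {h. e < \<bar>h\<bar>} h *\<^sub>R ((f x - f (x + \<sigma> * h)) / \<bar>h\<bar> powr (1 + 2 * s)))
        \<le> norm (2 * B * (indicator {h. e \<le> \<bar>h\<bar>} h * \<bar>h\<bar> powr - (1 + 2 * s)))"
    proof (rule AE_I2)
      fix h
      have "\<bar>f x - f (x + \<sigma> * h)\<bar> \<le> 2 * B" using B[of x] B[of "x + \<sigma> * h"] by linarith
      then have "\<bar>f x - f (x + \<sigma> * h)\<bar> / \<bar>h\<bar> powr (1 + 2 * s) \<le> \<bar>2 * B\<bar> / \<bar>h\<bar> powr (1 + 2 * s)"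
        by (intro divide_right_mono) auto
      moreover have "\<bar>h\<bar> powr - (1 + 2 * s) = 1 / \<bar>h\<bar> powr (1 + 2 * s)" by (rule powr_minus_divide)
      ultimately show "norm (indicator {h. e < \<bar>h\<bar>} h *\<^sub>R ((f x - f (x + \<sigma> * h)) / \<bar>h\<bar> powr (1 + 2 * s)))
        \<le> norm (2 * B * (indicator {h. e \<le> \<bar>h\<bar>} h * \<bar>h\<bar> powr - (1 + 2 * s)))"
        by (auto simp: indicator_def abs_mult simp del: minus_add_distrib)
    qed
  qed
qed

lemma truncated_set_integrable:
  fixes s :: real
  assumes c: "continuous_on UNIV f" and B: "\<And>t. \<bar>f t\<bar> \<le> B" and s: "0 < s" and e: "0 < e"
  shows "set_integrable lborel {z. e < \<bar>x - z\<bar>} (\<lambda>z. (f x - f z) / \<bar>x - z\<bar> powr (1 + 2 * s))"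
proof -
  from truncated_integrable[OF c B s e, of 1 x]
  have "integrable lborel (\<lambda>h. indicator {h. e < \<bar>h\<bar>} (- x + 1 * h) *\<^sub>R ((f x - f (x + 1 * (- x + 1 * h))) / \<bar>- x + 1 * h\<bar> powr (1 + 2 * s)))"
    by (intro lborel_integrable_real_affine) auto
  then show ?thesis unfolding set_integrable_def
    by (rule back_subst[where P = "integrable lborel"]) (auto simp: indicator_def fun_eq_iff abs_minus_commute)
qed

text \<open>The truncated domain is symmetric about x, so z = x + h and z = x - h give the same
  integral; averaging the two produces the second difference.\<close>

lemma trunc_int_eq:
  fixes s :: real
  assumes c: "continuous_on UNIV f" and B: "\<And>t. \<bar>f t\<bar> \<le> B" and s: "0 < s" and e: "0 < e"
  shows "trunc_int s f x e = (1 / 2) * (\<integral>h. indicator {h. e < \<bar>h\<bar>} h * (second_diff f x h / \<bar>h\<bar> powr (1 + 2 * s)) \<partial>lborel)"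
proof -
  let ?g = "\<lambda>\<sigma> h. indicator {h. e < \<bar>h\<bar>} h *\<^sub>R ((f x - f (x + \<sigma> * h)) / \<bar>h\<bar> powr (1 + 2 * s))"
  have t: "trunc_int s f x e = (\<integral>h. ?g \<sigma> h \<partial>lborel)" if \<sigma>: "\<sigma> = 1 \<or> \<sigma> = - 1" for \<sigma> :: real
  proof -
    have "trunc_int s f x e = \<bar>\<sigma>\<bar> *\<^sub>R (\<integral>h. indicator {z. e < \<bar>x - z\<bar>} (x + \<sigma> * h) *\<^sub>R
        ((f x - f (x + \<sigma> * h)) / \<bar>x - (x + \<sigma> * h)\<bar> powr (1 + 2 * s)) \<partial>lborel)"
      unfolding trunc_int_def set_lebesgue_integral_def using \<sigma>
      by (intro lborel_integral_real_affine) auto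
    also have "\<dots> = (\<integral>h. ?g \<sigma> h \<partial>lborel)"
      using \<sigma> by (auto simp: indicator_def intro!: Bochner_Integration.integral_cong)
    finally show ?thesis .
  qed
  have "2 * trunc_int s f x e = (\<integral>h. ?g 1 h \<partial>lborel) + (\<integral>h. ?g (- 1) h \<partial>lborel)"
    using t[of 1] t[of "- 1"] by simp
  also have "\<dots> = (\<integral>h. ?g 1 h + ?g (- 1) h \<partial>lborel)"
    by (intro Bochner_Integration.integral_add[symmetric] truncated_integrable[OF c B s e]) auto
  also have "\<dots> = (\<integral>h. indicator {h. e < \<bar>h\<bar>} h * (second_diff f x h / \<bar>h\<bar> powr (1 + 2 * s)) \<partial>lborel)"
    by (intro Bochner_Integration.integral_cong) (auto simp: second_diff_def indicator_def add_divide_distrib[symmetric])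
  finally show ?thesis by simp
qed

lemma second_diff_measurable [measurable]:
  fixes s :: real
  assumes "f \<in> borel_measurable borel"
  shows "(\<lambda>(x, h). second_diff f x h / \<bar>h\<bar> powr (1 + 2 * s)) \<in> borel_measurable (borel \<Otimes>\<^sub>M borel)"
    and "(\<lambda>h. second_diff f x h / \<bar>h\<bar> powr (1 + 2 * s)) \<in> borel_measurable borel"
  unfolding second_diff_def using assms by measurable

lemma trunc_int_tendsto:
  fixes s :: real
  assumes c: "continuous_on UNIV f" and B: "\<And>t. \<bar>f t\<bar> \<le> B" and s: "0 < s"
    and D: "integrable lborel D" "\<And>x h. \<bar>second_diff f x h / \<bar>h\<bar> powr (1 + 2 * s)\<bar> \<le> D h"
  shows "(trunc_int s f x \<longlongrightarrow> sym_frac s f x) (at_right 0)"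
proof (rule tendsto_at_right_sequentially[of 0 1])
  have m: "f \<in> borel_measurable borel" using c by (rule borel_measurable_continuous_onI)
  note mm = second_diff_measurable(2)[OF m, of x s]
  fix S :: "nat \<Rightarrow> real"
  assume S: "\<And>n. 0 < S n" "S \<longlonglongrightarrow> 0"
  have "(\<lambda>n. \<integral>h. indicator {h. S n < \<bar>h\<bar>} h * (second_diff f x h / \<bar>h\<bar> powr (1 + 2 * s)) \<partial>lborel)
      \<longlonglongrightarrow> (\<integral>h. second_diff f x h / \<bar>h\<bar> powr (1 + 2 * s) \<partial>lborel)"
  proof (rule integral_dominated_convergence[where w = D])
    show "(\<lambda>h. indicator {h. S n < \<bar>h\<bar>} h * (second_diff f x h / \<bar>h\<bar> powr (1 + 2 * s))) \<in> borel_measurable lborel" for n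
      using mm by measurable
    show "AE h in lborel. norm (indicator {h. S n < \<bar>h\<bar>} h * (second_diff f x h / \<bar>h\<bar> powr (1 + 2 * s))) \<le> D h" for n
    proof (rule AE_I2)
      fix h
      have "norm (indicator {h. S n < \<bar>h\<bar>} h * (second_diff f x h / \<bar>h\<bar> powr (1 + 2 * s))) \<le> \<bar>second_diff f x h / \<bar>h\<bar> powr (1 + 2 * s)\<bar>"
        by (auto simp: indicator_def)
      then show "norm (indicator {h. S n < \<bar>h\<bar>} h * (second_diff f x h / \<bar>h\<bar> powr (1 + 2 * s))) \<le> D h" using D(2)[of x h] by linarith
    qed
    show "AE h in lborel. (\<lambda>n. indicator {h. S n < \<bar>h\<bar>} h * (second_diff f x h / \<bar>h\<bar> powr (1 + 2 * s))) \<longlonglongrightarrow> second_diff f x h / \<bar>h\<bar> powr (1 + 2 * s)"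
    proof (rule AE_I2)
      fix h
      show "(\<lambda>n. indicator {h. S n < \<bar>h\<bar>} h * (second_diff f x h / \<bar>h\<bar> powr (1 + 2 * s))) \<longlonglongrightarrow> second_diff f x h / \<bar>h\<bar> powr (1 + 2 * s)"
      proof (cases "h = 0")
        case False
        then have "\<forall>\<^sub>F n in sequentially. S n < \<bar>h\<bar>" using S(2) by (intro order_tendstoD(2)) auto
        then have "\<forall>\<^sub>F n in sequentially. indicator {h. S n < \<bar>h\<bar>} h * (second_diff f x h / \<bar>h\<bar> powr (1 + 2 * s)) = second_diff f x h / \<bar>h\<bar> powr (1 + 2 * s)"
          by eventually_elim (auto simp: indicator_def)
        then show ?thesis by (rule tendsto_eventually)
      qed (simp add: second_diff_def)
    qed
  qed (use mm D in auto)
  from tendsto_mult_left[OF this, of "1 / 2"]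
  show "(\<lambda>n. trunc_int s f x (S n)) \<longlonglongrightarrow> sym_frac s f x"
    unfolding sym_frac_def trunc_int_eq[OF c B s S(1)] .
qed simp

lemma sym_frac_continuous:
  fixes s :: real
  assumes c: "continuous_on UNIV f"
    and D: "integrable lborel D" "\<And>x h. \<bar>second_diff f x h / \<bar>h\<bar> powr (1 + 2 * s)\<bar> \<le> D h"
  shows "continuous_on UNIV (sym_frac s f)"
proof (intro continuous_at_imp_continuous_on ballI)
  fix x
  have m: "f \<in> borel_measurable borel" using c by (rule borel_measurable_continuous_onI)
  have ct: "isCont f y" for y using c by (simp add: continuous_on_eq_continuous_at)
  show "isCont (sym_frac s f) x"
    unfolding continuous_at_sequentially
  proof (intro allI impI)
    fix X assume X: "X \<longlonglongrightarrow> x"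
    have "(\<lambda>n. \<integral>h. second_diff f (X n) h / \<bar>h\<bar> powr (1 + 2 * s) \<partial>lborel) \<longlonglongrightarrow> (\<integral>h. second_diff f x h / \<bar>h\<bar> powr (1 + 2 * s) \<partial>lborel)"
    proof (rule integral_dominated_convergence[where w = D])
      show "AE h in lborel. (\<lambda>n. second_diff f (X n) h / \<bar>h\<bar> powr (1 + 2 * s)) \<longlonglongrightarrow> second_diff f x h / \<bar>h\<bar> powr (1 + 2 * s)"
        unfolding second_diff_def divide_inverse
        by (intro AE_I2 tendsto_intros isCont_tendsto_compose[OF ct] X)
    qed (use second_diff_measurable(2)[OF m] D in auto)
    then show "(sym_frac s f \<circ> X) \<longlonglongrightarrow> sym_frac s f x"
      unfolding sym_frac_def o_def by (intro tendsto_intros)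
  qed
qed

lemma sym_frac_periodic:
  assumes per: "\<And>t. f (t + 2 * pi) = f t"
  shows "sym_frac s f (t + 2 * pi) = sym_frac s f t"
proof -
  have "second_diff f (t + 2 * pi) h = second_diff f t h" for h
    using per[of t] per[of "t + h"] per[of "t - h"] by (simp add: second_diff_def algebra_simps)
  then show ?thesis by (simp add: sym_frac_def)
qed

section \<open>The fractional Laplacian as a Fourier multiplier\<close>

lemma fourier_coeff_shift:
  assumes c: "continuous_on UNIV f" and per: "\<And>t. f (t + 2 * pi) = f t"
  shows "fourier_coeff k (\<lambda>t. f (t + h)) = cis (real k * h) * fourier_coeff k f"
proof -
  define g where "g t = of_real (f t) * cis (- (real k * t))" for t
  have cg: "continuous_on UNIV g" unfolding g_def by (intro continuous_intros c)
  have "cis (- (real k * (t + 2 * pi))) = cis (- (real k * t))" for t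
  proof -
    have "cis (- (real k * (t + 2 * pi))) = cis (- (real k * t)) * cis (2 * pi * of_int (- int k))"
      unfolding cis_mult by (simp add: algebra_simps)
    also have "cis (2 * pi * of_int (- int k)) = 1" by (intro cis_multiple_2pi) auto
    finally show ?thesis by simp
  qed
  then have gper: "g (t + 2 * pi) = g t" for t by (simp add: g_def per)
  have "of_real (f (t + h)) * cis (- (real k * t)) = cis (real k * h) * g (t + h)" for t
    by (simp add: g_def cis_mult algebra_simps)
  then have "fourier_coeff k (\<lambda>t. f (t + h)) = (1 / (2 * pi)) *\<^sub>R (cis (real k * h) * integral {0..2 * pi} (\<lambda>t. g (t + h)))"
    by (simp add: fourier_coeff_def)
  also have "integral {0..2 * pi} (\<lambda>t. g (t + h)) = integral {h..h + 2 * pi} g"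
    using integral_shift_Icc_real[of 0 "2 * pi" g h] by (simp add: o_def add.commute)
  also have "\<dots> = integral {0..2 * pi} g" by (rule integral_periodic_shift[OF cg gper])
  finally show ?thesis by (simp add: fourier_coeff_def g_def[abs_def])
qed

lemma fourier_coeff_second_diff:
  assumes c: "continuous_on UNIV f" and per: "\<And>t. f (t + 2 * pi) = f t"
  shows "fourier_coeff k (\<lambda>t. second_diff f t h) = of_real (2 * (1 - cos (real k * h))) * fourier_coeff k f"
proof -
  have cs: "continuous_on S (\<lambda>t. f (t + h))" for S h
    by (rule continuous_on_compose2[OF c]) (auto intro: continuous_intros)
  have cf: "continuous_on S f" for S using c continuous_on_subset by blast
  have "fourier_coeff k (\<lambda>t. second_diff f t h) = fourier_coeff k (\<lambda>t. 2 * f t + (- 1 * f (t + h) + - 1 * f (t + - h)))"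
    by (simp add: second_diff_def algebra_simps)
  also have "\<dots> = 2 * fourier_coeff k f + (- fourier_coeff k (\<lambda>t. f (t + h)) + - fourier_coeff k (\<lambda>t. f (t + - h)))"
    by (subst fourier_coeff_add fourier_coeff_cmult; (intro continuous_intros cs cf)?)+ (simp add: fourier_coeff_cmult)
  also have "\<dots> = (2 - (cis (real k * h) + cis (- (real k * h)))) * fourier_coeff k f"
    unfolding fourier_coeff_shift[OF assms] by (simp add: algebra_simps)
  also have "2 - (cis (real k * h) + cis (- (real k * h))) = of_real (2 * (1 - cos (real k * h)))"
    by (simp add: complex_eq_iff)
  finally show ?thesis .
qed

text \<open>The integral whose reciprocal is \<open>C1\<close>; it is the factor by which the
  multiplier of \<open>sym_frac\<close> differs from |k|^(2s).\<close>

definition frac_const :: "real \<Rightarrow> real" where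
  "frac_const s = (\<integral>h. (1 - cos h) / \<bar>h\<bar> powr (1 + 2 * s) \<partial>lborel)"

text \<open>The integrand is half the one formed with the second difference of cosine at 0. The
  derivative of cosine is Lipschitz, so the general majorant applies with g = 1 and 2s < 2.\<close>

lemma one_minus_cos_integrable:
  fixes s :: real
  assumes s: "0 < s" "s < 1"
  shows "integrable lborel (\<lambda>h. (1 - cos h) / \<bar>h\<bar> powr (1 + 2 * s))"
proof -
  have "\<bar>- sin t - - sin u\<bar> \<le> 1 * \<bar>t - u\<bar> powr 1" for t u :: real
  proof -
    have "norm (sin t - sin u) \<le> 1 * norm (t - u)"
      by (rule field_differentiable_bound[of UNIV sin cos]) (auto intro!: derivative_eq_intros)
    then show ?thesis by (cases "t = u") auto
  qed
  then obtain D where D: "integrable lborel D" "\<And>x h. \<bar>second_diff cos x h / \<bar>h\<bar> powr (1 + 2 * s)\<bar> \<le> D h"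
    using second_diff_dominated[of cos "\<lambda>t. - sin t" 1 1 s 1] s by (auto intro!: derivative_eq_intros)
  from D(1) show ?thesis
  proof (rule Bochner_Integration.integrable_bound)
    show "AE h in lborel. norm ((1 - cos h) / \<bar>h\<bar> powr (1 + 2 * s)) \<le> norm (D h)"
    proof (rule AE_I2)
      fix h :: real
      have "\<bar>(1 - cos h) / \<bar>h\<bar> powr (1 + 2 * s)\<bar> \<le> \<bar>second_diff cos 0 h / \<bar>h\<bar> powr (1 + 2 * s)\<bar>"
        unfolding abs_divide by (intro divide_right_mono) (auto simp: second_diff_def)
      then show "norm ((1 - cos h) / \<bar>h\<bar> powr (1 + 2 * s)) \<le> norm (D h)" using D(2)[of 0 h] by simp
    qed
  qed measurable
qed

text \<open>Positivity is what makes \<open>C1 s * frac_const s = 1\<close>, given that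
  \<open>inverse 0 = 0\<close>. The interval [1, 2] suffices for a lower bound, since cosine
  decreases there.\<close>

lemma frac_const_pos:
  assumes s: "0 < s" "s < 1"
  shows "0 < frac_const s"
proof -
  define c where "c = (1 - cos 1) / 2 powr (1 + 2 * s)"
  have "cos 1 < cos (0::real)" using pi_gt3 by (intro cos_monotone_0_pi) auto
  then have c: "0 < c" by (simp add: c_def)
  have "c = (\<integral>h. indicator {1..2::real} h *\<^sub>R c \<partial>lborel)" by simp
  also have "\<dots> \<le> frac_const s" unfolding frac_const_def
  proof (rule integral_mono)
    show "integrable lborel (\<lambda>h. indicator {1..2::real} h *\<^sub>R c)" by simp
    show "integrable lborel (\<lambda>h. (1 - cos h) / \<bar>h\<bar> powr (1 + 2 * s))" by (rule one_minus_cos_integrable[OF s])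
    fix h :: real
    show "indicator {1..2} h *\<^sub>R c \<le> (1 - cos h) / \<bar>h\<bar> powr (1 + 2 * s)"
    proof (cases "h \<in> {1..2}")
      case True
      have "cos h \<le> cos 1" using True pi_gt3 by (intro cos_monotone_0_pi_le) auto
      moreover have "\<bar>h\<bar> powr (1 + 2 * s) \<le> 2 powr (1 + 2 * s)" using True s by (intro powr_mono2) auto
      ultimately show ?thesis using True unfolding c_def by (simp add: frac_le)
    qed simp
  qed
  finally show ?thesis using c by simp
qed

lemma one_minus_cos_scaled:
  fixes s :: real
  shows "(1 - cos (0 + k * h)) / \<bar>0 + k * h\<bar> powr (1 + 2 * s) =
     \<bar>k\<bar> powr - (1 + 2 * s) * ((1 - cos (k * h)) / \<bar>h\<bar> powr (1 + 2 * s))"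
proof -
  have "\<bar>k\<bar> powr - (1 + 2 * s) = 1 / \<bar>k\<bar> powr (1 + 2 * s)" by (rule powr_minus_divide)
  then show ?thesis by (simp add: abs_mult powr_mult del: minus_add_distrib)
qed

text \<open>Replacing h by kh produces |k| from dh and |k|^-(1 + 2s) from the kernel; solving for
  the integral leaves |k|^(2s).\<close>

lemma frac_const_scaled:
  fixes s :: real
  assumes s: "0 < s" "s < 1" and k: "k \<noteq> 0"
  shows "has_bochner_integral lborel (\<lambda>h. (1 - cos (k * h)) / \<bar>h\<bar> powr (1 + 2 * s)) (\<bar>k\<bar> powr (2 * s) * frac_const s)"
proof -
  have pk: "\<bar>k\<bar> powr (2 * s) * (\<bar>k\<bar> * \<bar>k\<bar> powr - (1 + 2 * s)) = 1"
  proof -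
    have "\<bar>k\<bar> powr - (1 + 2 * s) = 1 / \<bar>k\<bar> powr (1 + 2 * s)" by (rule powr_minus_divide)
    moreover have "\<bar>k\<bar> powr (1 + 2 * s) = \<bar>k\<bar> * \<bar>k\<bar> powr (2 * s)" using k by (simp add: powr_add)
    ultimately show ?thesis using k by (simp del: minus_add_distrib)
  qed
  have "frac_const s = \<bar>k\<bar> *\<^sub>R (\<integral>h. (1 - cos (0 + k * h)) / \<bar>0 + k * h\<bar> powr (1 + 2 * s) \<partial>lborel)"
    unfolding frac_const_def by (intro lborel_integral_real_affine k)
  also have "(\<integral>h. (1 - cos (0 + k * h)) / \<bar>0 + k * h\<bar> powr (1 + 2 * s) \<partial>lborel) =
      (\<integral>h. \<bar>k\<bar> powr - (1 + 2 * s) * ((1 - cos (k * h)) / \<bar>h\<bar> powr (1 + 2 * s)) \<partial>lborel)"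
    by (intro Bochner_Integration.integral_cong refl one_minus_cos_scaled)
  also have "\<dots> = \<bar>k\<bar> powr - (1 + 2 * s) * (\<integral>h. (1 - cos (k * h)) / \<bar>h\<bar> powr (1 + 2 * s) \<partial>lborel)"
    by (rule integral_mult_right_zero)
  finally have "frac_const s = \<bar>k\<bar> * (\<bar>k\<bar> powr - (1 + 2 * s) * (\<integral>h. (1 - cos (k * h)) / \<bar>h\<bar> powr (1 + 2 * s) \<partial>lborel))"
    unfolding real_scaleR_def .
  then have eq: "(\<integral>h. (1 - cos (k * h)) / \<bar>h\<bar> powr (1 + 2 * s) \<partial>lborel) = \<bar>k\<bar> powr (2 * s) * frac_const s"
  proof -
    have "X = p * F" if "p * (a * b) = 1" "F = a * (b * X)" for X p F a b :: real
    proof -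
      have "p * F = (p * (a * b)) * X" unfolding that(2) by (simp only: mult.assoc)
      then show ?thesis using that(1) by simp
    qed
    from this[OF pk \<open>frac_const s = _ * (_ * _)\<close>] show ?thesis .
  qed
  have "integrable lborel (\<lambda>h. \<bar>k\<bar> powr - (1 + 2 * s) * ((1 - cos (k * h)) / \<bar>h\<bar> powr (1 + 2 * s)))"
    using lborel_integrable_real_affine[OF one_minus_cos_integrable[OF s] k, of 0] unfolding one_minus_cos_scaled .
  then have "integrable lborel (\<lambda>h. (1 - cos (k * h)) / \<bar>h\<bar> powr (1 + 2 * s))"
    using integrable_mult_left_iff[of lborel "\<bar>k\<bar> powr - (1 + 2 * s)" "\<lambda>h. (1 - cos (k * h)) / \<bar>h\<bar> powr (1 + 2 * s)"] k
    by (simp only: powr_eq_0_iff abs_eq_0 simp_thms)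
  then show ?thesis unfolding has_bochner_integral_iff eq by simp
qed

lemma C1_eq: "C1 s = inverse (frac_const s)"
  by (simp add: C1_def frac_const_def)

text \<open>Fubini, justified by the x-independent majorant \<open>D\<close> on one period, moves
  the x-integral inside. There the second difference acts on the coefficient as 2(1 - cos kh), and
  the h-integral is the scaled constant.\<close>

lemma fourier_coeff_sym_frac:
  fixes s :: real
  assumes c: "continuous_on UNIV f" and per: "\<And>t. f (t + 2 * pi) = f t" and s: "0 < s" "s < 1"
    and D: "integrable lborel D" "\<And>x h. \<bar>second_diff f x h / \<bar>h\<bar> powr (1 + 2 * s)\<bar> \<le> D h"
  shows "fourier_coeff k (sym_frac s f) = of_real (real k powr (2 * s) * frac_const s) * fourier_coeff k f"
proof -
  have m [measurable]: "f \<in> borel_measurable borel" using c by (rule borel_measurable_continuous_onI)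
  define w where "w h = 1 / \<bar>h\<bar> powr (1 + 2 * s)" for h :: real
  have wm [measurable]: "w \<in> borel_measurable borel" unfolding w_def by measurable
  define \<Phi> where "\<Phi> x h = (indicator {0..2 * pi} x * (second_diff f x h * w h)) *\<^sub>R cis (- (real k * x))" for x h
  have cism [measurable]: "(\<lambda>x. cis (- (real k * x))) \<in> borel_measurable borel"
    by (intro borel_measurable_continuous_onI continuous_intros)
  have \<Phi>m: "(\<lambda>(x, h). \<Phi> x h) \<in> borel_measurable (lborel \<Otimes>\<^sub>M lborel)"
    unfolding \<Phi>_def second_diff_def by measurable
  have D': "\<bar>second_diff f x h * w h\<bar> \<le> D h" for x h using D(2)[of x h] by (simp add: w_def)
  have Dnn: "0 \<le> D h" for h using D'[of 0 h] by linarith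
  have \<Phi>b: "norm (\<Phi> x h) \<le> indicator {0..2 * pi} x * D h" for x h
    using D'[of x h] by (auto simp: \<Phi>_def indicator_def)
  have int2: "integrable lborel (\<lambda>h. \<Phi> x h)" for x
    by (rule Bochner_Integration.integrable_bound[OF integrable_mult_right[OF D(1), of "indicator {0..2 * pi} x"]])
      (use \<Phi>m \<Phi>b Dnn in \<open>auto intro!: measurable_Pair2'\<close>)
  have \<Phi>i: "integrable (lborel \<Otimes>\<^sub>M lborel) (\<lambda>(x, h). \<Phi> x h)"
  proof (rule lborel_pair.Fubini_integrable[OF \<Phi>m])
    show "AE x in lborel. integrable lborel (\<lambda>h. case (x, h) of (x, h) \<Rightarrow> \<Phi> x h)" using int2 by simp
    have "integrable lborel (\<lambda>x. indicator {0..2 * pi} x * (\<integral>h. D h \<partial>lborel))"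
      by (intro integrable_mult_left) simp
    then show "integrable lborel (\<lambda>x. \<integral>h. norm (case (x, h) of (x, h) \<Rightarrow> \<Phi> x h) \<partial>lborel)"
    proof (rule Bochner_Integration.integrable_bound)
      show "(\<lambda>x. \<integral>h. norm (case (x, h) of (x, h) \<Rightarrow> \<Phi> x h) \<partial>lborel) \<in> borel_measurable lborel"
        by (rule lborel.borel_measurable_lebesgue_integral) (use \<Phi>m in \<open>simp add: case_prod_beta\<close>)
      show "AE x in lborel. norm (\<integral>h. norm (case (x, h) of (x, h) \<Rightarrow> \<Phi> x h) \<partial>lborel) \<le> norm (indicator {0..2 * pi} x * (\<integral>h. D h \<partial>lborel))"
      proof (rule AE_I2)
        fix x
        have "(\<integral>h. norm (\<Phi> x h) \<partial>lborel) \<le> (\<integral>h. indicator {0..2 * pi} x * D h \<partial>lborel)"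
          by (intro integral_mono integrable_norm int2 integrable_mult_right D \<Phi>b)
        then show "norm (\<integral>h. norm (case (x, h) of (x, h) \<Rightarrow> \<Phi> x h) \<partial>lborel) \<le> norm (indicator {0..2 * pi} x * (\<integral>h. D h \<partial>lborel))"
          by (simp add: Bochner_Integration.integral_nonneg Dnn)
      qed
    qed
  qed
  have leb: "fourier_coeff k g = (1 / (2 * pi)) *\<^sub>R (\<integral>x. indicator {0..2 * pi} x *\<^sub>R (of_real (g x) * cis (- (real k * x))) \<partial>lborel)"
    if "continuous_on UNIV g" for g
  proof -
    have "set_integrable lborel {0..2 * pi} (\<lambda>x. of_real (g x) * cis (- (real k * x)))"
      by (intro borel_integrable_atLeastAtMost' continuous_intros continuous_on_subset[OF that]) auto
    from set_borel_integral_eq_integral(2)[OF this] show ?thesis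
      by (simp add: fourier_coeff_def set_lebesgue_integral_def)
  qed
  have "fourier_coeff k (sym_frac s f) = (1 / (2 * pi)) *\<^sub>R (\<integral>x. indicator {0..2 * pi} x *\<^sub>R (of_real (sym_frac s f x) * cis (- (real k * x))) \<partial>lborel)"
    by (rule leb[OF sym_frac_continuous[OF c D]])
  also have "(\<lambda>x. indicator {0..2 * pi} x *\<^sub>R (of_real (sym_frac s f x) * cis (- (real k * x)))) = (\<lambda>x. (1 / 2) *\<^sub>R (\<integral>h. \<Phi> x h \<partial>lborel))"
  proof
    fix x
    have i: "integrable lborel (\<lambda>h. second_diff f x h * w h)"
      by (rule Bochner_Integration.integrable_bound[OF D(1)])
        (use D' Dnn second_diff_measurable(2)[OF m, of x s] in \<open>auto simp: w_def\<close>)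
    have "(\<integral>h. \<Phi> x h \<partial>lborel) = (\<integral>h. (second_diff f x h * w h) *\<^sub>R (indicator {0..2 * pi} x *\<^sub>R cis (- (real k * x))) \<partial>lborel)"
      by (intro Bochner_Integration.integral_cong) (auto simp: \<Phi>_def mult.commute)
    also have "\<dots> = (\<integral>h. second_diff f x h * w h \<partial>lborel) *\<^sub>R (indicator {0..2 * pi} x *\<^sub>R cis (- (real k * x)))"
      by (intro integral_scaleR_left i)
    finally show "indicator {0..2 * pi} x *\<^sub>R (of_real (sym_frac s f x) * cis (- (real k * x))) = (1 / 2) *\<^sub>R (\<integral>h. \<Phi> x h \<partial>lborel)"
      by (simp add: sym_frac_def w_def scaleR_conv_of_real)
  qed
  also have "(\<integral>x. (1 / 2) *\<^sub>R (\<integral>h. \<Phi> x h \<partial>lborel) \<partial>lborel) = (1 / 2) *\<^sub>R (\<integral>x. (\<integral>h. \<Phi> x h \<partial>lborel) \<partial>lborel)"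
    by simp
  also have "(\<integral>x. (\<integral>h. \<Phi> x h \<partial>lborel) \<partial>lborel) = (\<integral>h. (\<integral>x. \<Phi> x h \<partial>lborel) \<partial>lborel)"
    using lborel_pair.Fubini_integral[OF \<Phi>i] by simp
  \<comment> \<open>4 pi is 2 pi from the normalisation of the coefficient times 2 from 2(1 - cos
    kh); the outer factors 1/(2 pi) and 1/2 cancel it.\<close>
  also have "(\<lambda>h. \<integral>x. \<Phi> x h \<partial>lborel) = (\<lambda>h. (((1 - cos (real k * h)) / \<bar>h\<bar> powr (1 + 2 * s))) *\<^sub>R ((4 * pi) *\<^sub>R fourier_coeff k f))"
  proof
    fix h
    have cD: "continuous_on UNIV (\<lambda>x. second_diff f x h)"
      unfolding second_diff_def by (intro continuous_intros continuous_on_compose2[OF c]) auto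
    have "(\<integral>x. \<Phi> x h \<partial>lborel) = (\<integral>x. w h *\<^sub>R (indicator {0..2 * pi} x *\<^sub>R (of_real (second_diff f x h) * cis (- (real k * x)))) \<partial>lborel)"
      by (intro Bochner_Integration.integral_cong) (auto simp: \<Phi>_def mult_ac scaleR_conv_of_real)
    also have "\<dots> = w h *\<^sub>R (\<integral>x. indicator {0..2 * pi} x *\<^sub>R (of_real (second_diff f x h) * cis (- (real k * x))) \<partial>lborel)"
      by (rule Bochner_Integration.integral_scaleR_right)
    also have "(\<integral>x. indicator {0..2 * pi} x *\<^sub>R (of_real (second_diff f x h) * cis (- (real k * x))) \<partial>lborel) = (2 * pi) *\<^sub>R fourier_coeff k (\<lambda>x. second_diff f x h)"
      by (subst leb[OF cD]) simp
    also have "fourier_coeff k (\<lambda>x. second_diff f x h) = of_real (2 * (1 - cos (real k * h))) * fourier_coeff k f" by (rule fourier_coeff_second_diff[OF c per])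
    finally show "(\<integral>x. \<Phi> x h \<partial>lborel) = (((1 - cos (real k * h)) / \<bar>h\<bar> powr (1 + 2 * s))) *\<^sub>R ((4 * pi) *\<^sub>R fourier_coeff k f)"
      by (simp add: w_def scaleR_conv_of_real mult_ac)
  qed
  also have "(\<integral>h. ((1 - cos (real k * h)) / \<bar>h\<bar> powr (1 + 2 * s)) *\<^sub>R ((4 * pi) *\<^sub>R fourier_coeff k f) \<partial>lborel)
     = (\<bar>real k\<bar> powr (2 * s) * frac_const s) *\<^sub>R ((4 * pi) *\<^sub>R fourier_coeff k f)"
  proof (cases "k = 0")
    case False
    then have hb: "has_bochner_integral lborel (\<lambda>h. (1 - cos (real k * h)) / \<bar>h\<bar> powr (1 + 2 * s)) (\<bar>real k\<bar> powr (2 * s) * frac_const s)"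
      by (intro frac_const_scaled s) auto
    have "has_bochner_integral lborel (\<lambda>h. ((1 - cos (real k * h)) / \<bar>h\<bar> powr (1 + 2 * s)) *\<^sub>R ((4 * pi) *\<^sub>R fourier_coeff k f))
       ((\<bar>real k\<bar> powr (2 * s) * frac_const s) *\<^sub>R ((4 * pi) *\<^sub>R fourier_coeff k f))"
      by (intro has_bochner_integral_scaleR_left hb)
    then show ?thesis by (rule has_bochner_integral_integral_eq)
  qed (use s in simp)
  finally show ?thesis by (simp add: scaleR_conv_of_real)
qed

subsection \<open>Bootstrap\<close>

lemma exp_series_add:
  assumes "disc_summable a" "disc_summable b" "0 < Im z"
  shows "exp_series (\<lambda>k. a k + b k) z = exp_series a z + exp_series b z"
proof -
  note s = summable_norm_cancel[OF exp_series_abs_summable[OF assms(1,3)]]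
    summable_norm_cancel[OF exp_series_abs_summable[OF assms(2,3)]]
  show ?thesis unfolding exp_series_def using suminf_add[OF s] by (simp add: distrib_right)
qed

lemma exp_series_cmult:
  assumes "disc_summable a" "0 < Im z"
  shows "exp_series (\<lambda>k. c * a k) z = c * exp_series a z"
  unfolding exp_series_def
  using suminf_mult[OF summable_norm_cancel[OF exp_series_abs_summable[OF assms]], of c] by (simp add: mult.assoc)

section \<open>Hoelder functions on the line\<close>

lemma holder_real_iff:
  fixes f :: "real \<Rightarrow> 'a::real_normed_vector"
  shows "holder b f \<longleftrightarrow> (\<exists>K. \<forall>t u. norm (f t - f u) \<le> K * \<bar>t - u\<bar> powr b)"
  by (simp add: holder_def dist_real_def)

lemma holder_imp_continuous_on:
  fixes f :: "real \<Rightarrow> 'a::real_normed_vector"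
  assumes "holder b f" "0 < b"
  shows "continuous_on S f"
proof -
  obtain K where "\<And>t u. norm (f t - f u) \<le> K * \<bar>t - u\<bar> powr b"
    using assms(1) by (auto simp: holder_real_iff)
  from holder_continuous_on[OF this assms(2)] show ?thesis by (rule continuous_on_subset) simp
qed

text \<open>Lowering the exponent weakens the bound only at distances up to 1; beyond, periodicity
  supplies a sup bound.\<close>

lemma holder_antimono:
  fixes f :: "real \<Rightarrow> 'a::real_normed_vector"
  assumes h: "holder a f" and per: "\<And>t. f (t + 2 * pi) = f t" and b: "0 < b" "b \<le> a"
  shows "holder b f"
proof -
  obtain K where K: "\<And>t u. norm (f t - f u) \<le> K * \<bar>t - u\<bar> powr a"
    using h by (auto simp: holder_real_iff)
  have Knn: "0 \<le> K" using order_trans[OF norm_ge_zero K[of 1 0]] by simp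
  have loc: "norm (f t - f u) \<le> K * \<bar>t - u\<bar> powr b" if "\<bar>t - u\<bar> \<le> 1" for t u
  proof -
    have "\<bar>t - u\<bar> powr a \<le> \<bar>t - u\<bar> powr b" using that b by (intro powr_mono') auto
    from mult_left_mono[OF this Knn] K[of t u] show ?thesis by linarith
  qed
  obtain B where B: "\<And>t. norm (f t) \<le> B"
    using periodic_continuous_bounded[OF holder_imp_continuous_on[OF h] per] b by auto
  have "norm (f t - f u) \<le> max K (2 * B) * \<bar>t - u\<bar> powr b" for t u
    by (rule holder_local_to_global[OF loc B]) (use b in auto)
  then show ?thesis by (auto simp: holder_real_iff)
qed

lemma holder_add:
  fixes f g :: "real \<Rightarrow> 'a::real_normed_vector"
  assumes "holder b f" "holder b g"
  shows "holder b (\<lambda>t. f t + g t)"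
proof -
  obtain K L where K: "\<And>t u. norm (f t - f u) \<le> K * \<bar>t - u\<bar> powr b"
    and L: "\<And>t u. norm (g t - g u) \<le> L * \<bar>t - u\<bar> powr b"
    using assms by (auto simp: holder_real_iff)
  have "norm (f t + g t - (f u + g u)) \<le> (K + L) * \<bar>t - u\<bar> powr b" for t u
    using norm_triangle_mono[OF K[of t u] L[of t u]] by (simp add: algebra_simps)
  then show ?thesis by (auto simp: holder_real_iff)
qed

lemma holder_bounded_linear:
  fixes f :: "real \<Rightarrow> 'a::real_normed_vector" and T :: "'a \<Rightarrow> 'b::real_normed_vector"
  assumes "holder b f" "bounded_linear T"
  shows "holder b (\<lambda>t. T (f t))"
proof -
  interpret bounded_linear T by fact
  obtain K where K: "\<And>t u. norm (f t - f u) \<le> K * \<bar>t - u\<bar> powr b"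
    using assms(1) by (auto simp: holder_real_iff)
  obtain C where C: "0 \<le> C" "\<And>x. norm (T x) \<le> norm x * C" using nonneg_bounded by blast
  have "norm (T (f t) - T (f u)) \<le> (K * C) * \<bar>t - u\<bar> powr b" for t u
    using order_trans[OF C(2)[of "f t - f u"] mult_right_mono[OF K[of t u] C(1)]]
    by (simp add: diff mult_ac)
  then show ?thesis by (auto simp: holder_real_iff)
qed

lemma holder_vec:
  fixes f :: "real \<Rightarrow> real^'n::finite"
  assumes "\<And>i. holder b (\<lambda>t. f t $ i)"
  shows "holder b f"
proof -
  have "\<forall>i. \<exists>K. \<forall>t u. \<bar>f t $ i - f u $ i\<bar> \<le> K * \<bar>t - u\<bar> powr b"
    using assms by (auto simp: holder_real_iff)
  then obtain K where K: "\<And>i t u. \<bar>f t $ i - f u $ i\<bar> \<le> K i * \<bar>t - u\<bar> powr b" by metis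
  have "norm (f t - f u) \<le> (\<Sum>i\<in>UNIV. K i) * \<bar>t - u\<bar> powr b" for t u
  proof -
    have "norm (f t - f u) \<le> (\<Sum>i\<in>UNIV. \<bar>(f t - f u) $ i\<bar>)" by (rule norm_le_l1_cart)
    also have "\<dots> \<le> (\<Sum>i\<in>UNIV. K i * \<bar>t - u\<bar> powr b)" by (intro sum_mono) (simp add: K)
    finally show ?thesis by (simp add: sum_distrib_right)
  qed
  then show ?thesis by (auto simp: holder_real_iff)
qed

lemma holder_nth: "holder b f \<Longrightarrow> holder b (\<lambda>t. (f t :: real^'n::finite) $ i)" for f :: "real \<Rightarrow> real^'n::finite"
  by (rule holder_bounded_linear[OF _ bounded_linear_vec_nth])

text \<open>Growth exponents in 1/Im z: Hardy--Littlewood gives 1 - \<beta> for the first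
  derivative, Cauchy adds one for the second, and fractional integration of order \<open>p\<close>
  subtracts p. The last step needs p < 2 - \<beta>.\<close>

lemma fractional_gain:
  assumes p: "1 \<le> p" and a: "holder \<beta> a" "\<And>t. a (t + 2 * pi) = a t" and \<beta>: "0 < \<beta>" "\<beta> < 1" "\<beta> + p < 2"
  shows "\<exists>C\<ge>0. \<forall>z. 0 < Im z \<longrightarrow>
    norm (exp_series (\<lambda>k. of_real (real k powr - p) * (of_nat k * (of_nat k * fourier_coeff k a))) z) \<le> C * Im z powr (p - (1 - \<beta> + 1))"
proof -
  have ca: "continuous_on S a" for S using holder_imp_continuous_on a(1) \<beta> by blast
  define a1 where "a1 = (\<lambda>k. of_nat k * fourier_coeff k a)"
  define a2 where "a2 = (\<lambda>k. of_nat k * a1 k)"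
  have adm1: "disc_summable a1" unfolding a1_def by (intro disc_summable_of_nat_mult disc_summable_fourier_coeff ca)
  have adm2: "disc_summable a2" unfolding a2_def by (intro disc_summable_of_nat_mult adm1)
  obtain K where K: "\<And>t u. \<bar>a t - a u\<bar> \<le> K * \<bar>t - u\<bar> powr \<beta>" using a(1) by (auto simp: holder_real_iff)
  define C1 where "C1 = 8 * K / (pi * (1 - \<beta>))"
  have C1: "norm (exp_series a1 z) \<le> C1 * Im z powr - (1 - \<beta>)" if "0 < Im z" for z
    unfolding a1_def C1_def by (rule hardy_littlewood[OF ca a(2) K \<beta>(1,2) that])
  have C1': "norm (exp_series a2 z) \<le> (2 powr (1 - \<beta> + 1) * C1) * Im z powr - (1 - \<beta> + 1)" if "0 < Im z" for z
    unfolding a2_def by (rule exp_series_bound_of_nat_mult[OF adm1 _ C1 that]) (use \<beta> in auto)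
  define E where "E = 2 powr (1 - \<beta> + 1) * C1 / (Gamma p * (1 - \<beta> + 1 - p))"
  have E: "norm (exp_series (\<lambda>k. of_real (real k powr - p) * a2 k) z) \<le> E * Im z powr (p - (1 - \<beta> + 1))" if "0 < Im z" for z
    unfolding E_def
    by (rule exp_series_fractional_integral_bound[OF adm2 _ p _ C1' that]) (use \<beta> in \<open>auto simp: a2_def\<close>)
  have "0 \<le> E" using order_trans[OF norm_ge_zero E[of \<i>]] by simp
  with E show ?thesis unfolding a2_def a1_def by blast
qed

text \<open>The term \<open>a\<close> gains p derivatives, while \<open>b\<close> enters through its
  time derivative and gains p - 1; hence the two upper limits on \<open>q\<close>. One more Cauchy
  estimate pays for the extra factor k at \<open>b\<close>, and Im z \<le> 1 allows both powers of
  Im z to be replaced by the exponent q - 2.\<close>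

lemma exp_series_second_derivative_bound:
  assumes eq: "\<And>k. 0 < k \<Longrightarrow> fourier_coeff k f = of_real (real k powr - p) * (fourier_coeff k a + \<i> * of_nat k * fourier_coeff k b)"
    and c: "continuous_on {0..2 * pi} f" and p: "1 \<le> p"
    and a: "holder \<beta>' a" "\<And>t. a (t + 2 * pi) = a t" and \<beta>': "0 < \<beta>'" "\<beta>' < 1" "\<beta>' + p < 2"
    and b: "holder \<beta> b" "\<And>t. b (t + 2 * pi) = b t" and \<beta>: "0 < \<beta>" "\<beta> < 1" "\<beta> + p < 3"
    and q: "q \<le> \<beta>' + p" "q \<le> \<beta> + p - 1"
  shows "\<exists>C. \<forall>z. 0 < Im z \<longrightarrow> Im z \<le> 1 \<longrightarrow> norm (exp_series (\<lambda>k. of_nat k * (of_nat k * fourier_coeff k f)) z) \<le> C * Im z powr (q - 2)"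
proof -
  have ca: "continuous_on S a" and cb: "continuous_on S b" for S
    using holder_imp_continuous_on a(1) b(1) \<beta>' \<beta> by blast+
  define a1 where "a1 = (\<lambda>k. of_nat k * fourier_coeff k a)"
  define a2 where "a2 = (\<lambda>k. of_nat k * a1 k)"
  define b1 where "b1 = (\<lambda>k. of_nat k * fourier_coeff k b)"
  define b2 where "b2 = (\<lambda>k. of_nat k * b1 k)"
  define b3 where "b3 = (\<lambda>k. of_nat k * b2 k)"
  have adm1: "disc_summable a1" "disc_summable b1" unfolding a1_def b1_def by (intro disc_summable_of_nat_mult disc_summable_fourier_coeff ca cb)+
  have adm2: "disc_summable a2" "disc_summable b2" unfolding a2_def b2_def by (intro disc_summable_of_nat_mult adm1)+
  have adm3: "disc_summable b3" unfolding b3_def by (intro disc_summable_of_nat_mult adm2)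
  obtain Kb where Kb: "\<And>t u. \<bar>b t - b u\<bar> \<le> Kb * \<bar>t - u\<bar> powr \<beta>" using b(1) by (auto simp: holder_real_iff)
  define C2 where "C2 = 8 * Kb / (pi * (1 - \<beta>))"
  have C2: "norm (exp_series b1 z) \<le> C2 * Im z powr - (1 - \<beta>)" if "0 < Im z" for z
    unfolding b1_def C2_def by (rule hardy_littlewood[OF cb b(2) Kb \<beta>(1,2) that])
  have C2': "norm (exp_series b2 z) \<le> (2 powr (1 - \<beta> + 1) * C2) * Im z powr - (1 - \<beta> + 1)" if "0 < Im z" for z
    unfolding b2_def by (rule exp_series_bound_of_nat_mult[OF adm1(2) _ C2 that]) (use \<beta> in auto)
  have C2'': "norm (exp_series b3 z) \<le> (2 powr (1 - \<beta> + 1 + 1) * (2 powr (1 - \<beta> + 1) * C2)) * Im z powr - (1 - \<beta> + 1 + 1)" if "0 < Im z" for z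
    unfolding b3_def by (rule exp_series_bound_of_nat_mult[OF adm2(2) _ C2' that]) (use \<beta> in auto)
  obtain E1 where E1nn: "0 \<le> E1" and
    "\<And>z. 0 < Im z \<Longrightarrow> norm (exp_series (\<lambda>k. of_real (real k powr - p) * (of_nat k * (of_nat k * fourier_coeff k a))) z)
       \<le> E1 * Im z powr (p - (1 - \<beta>' + 1))"
    using fractional_gain[OF p a \<beta>'] by blast
  then have E1: "norm (exp_series (\<lambda>k. of_real (real k powr - p) * a2 k) z) \<le> E1 * Im z powr (p - (1 - \<beta>' + 1))" if "0 < Im z" for z
    unfolding a2_def a1_def using that by blast
  define E2 where "E2 = 2 powr (1 - \<beta> + 1 + 1) * (2 powr (1 - \<beta> + 1) * C2) / (Gamma p * (1 - \<beta> + 1 + 1 - p))"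
  have E2: "norm (exp_series (\<lambda>k. of_real (real k powr - p) * b3 k) z) \<le> E2 * Im z powr (p - (1 - \<beta> + 1 + 1))" if "0 < Im z" for z
    unfolding E2_def
    by (rule exp_series_fractional_integral_bound[OF adm3 _ p _ C2'' that]) (use \<beta> in \<open>auto simp: b3_def\<close>)
  have le1: "real k powr - p \<le> 1" for k
  proof (cases "k = 0")
    case False
    then have "real k powr - p \<le> 1 powr - p" using p by (intro powr_mono2') auto
    then show ?thesis by simp
  qed simp
  have admr: "disc_summable (\<lambda>k. of_real (real k powr - p) * x k)" if "disc_summable x" for x
    by (rule disc_summable_mono[OF that]) (use le1 in \<open>auto simp: norm_mult intro!: mult_left_le_one_le\<close>)
  have admi: "disc_summable (\<lambda>k. \<i> * (of_real (real k powr - p) * b3 k))"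
    by (rule disc_summable_mono[OF admr[OF adm3]]) (simp add: norm_mult)
  have split: "exp_series (\<lambda>k. of_nat k * (of_nat k * fourier_coeff k f)) z =
     exp_series (\<lambda>k. of_real (real k powr - p) * a2 k) z + \<i> * exp_series (\<lambda>k. of_real (real k powr - p) * b3 k) z" if z: "0 < Im z" for z
  proof -
    have "(\<lambda>k. of_nat k * (of_nat k * fourier_coeff k f)) =
      (\<lambda>k. of_real (real k powr - p) * a2 k + \<i> * (of_real (real k powr - p) * b3 k))"
    proof
      fix k
      show "of_nat k * (of_nat k * fourier_coeff k f) = of_real (real k powr - p) * a2 k + \<i> * (of_real (real k powr - p) * b3 k)"
      proof (cases "k = 0")
        case False
        then have "fourier_coeff k f = of_real (real k powr - p) * (fourier_coeff k a + \<i> * of_nat k * fourier_coeff k b)" by (intro eq) simp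
        then show ?thesis by (simp only: a2_def a1_def b3_def b2_def b1_def distrib_left mult_ac)
      qed (simp add: a2_def b3_def)
    qed
    then show ?thesis
      by (simp only: exp_series_add[OF admr[OF adm2(1)] admi z] exp_series_cmult[OF admr[OF adm3] z])
  qed
  have E2nn: "0 \<le> E2" using order_trans[OF norm_ge_zero E2[of \<i>]] by simp
  have "norm (exp_series (\<lambda>k. of_nat k * (of_nat k * fourier_coeff k f)) z) \<le> (E1 + E2) * Im z powr (q - 2)" if z: "0 < Im z" "Im z \<le> 1" for z
  proof -
    have "Im z powr (p - (1 - \<beta>' + 1)) \<le> Im z powr (q - 2)" using q z by (intro powr_mono') auto
    then have "E1 * Im z powr (p - (1 - \<beta>' + 1)) \<le> E1 * Im z powr (q - 2)"
      using E1nn by (rule mult_left_mono)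
    moreover have "Im z powr (p - (1 - \<beta> + 1 + 1)) \<le> Im z powr (q - 2)" using q z by (intro powr_mono') auto
    then have "E2 * Im z powr (p - (1 - \<beta> + 1 + 1)) \<le> E2 * Im z powr (q - 2)"
      using E2nn by (rule mult_left_mono)
    moreover have "norm (exp_series (\<lambda>k. of_nat k * (of_nat k * fourier_coeff k f)) z) \<le>
       norm (exp_series (\<lambda>k. of_real (real k powr - p) * a2 k) z) + norm (exp_series (\<lambda>k. of_real (real k powr - p) * b3 k) z)"
      unfolding split[OF z(1)] by (rule order_trans[OF norm_triangle_ineq]) (simp add: norm_mult)
    ultimately show ?thesis using E1[OF z(1)] E2[OF z(1)] unfolding distrib_right by linarith
  qed
  then show ?thesis by blast
qed

lemma fourier_coeff_deriv:
  assumes d: "\<And>t. (f has_real_derivative f' t) (at t)" and c: "continuous_on UNIV f'"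
    and per: "\<And>t. f (t + 2 * pi) = f t"
  shows "fourier_coeff k f' = \<i> * of_nat k * fourier_coeff k f"
proof -
  have cf: "continuous_on S f" for S
    using DERIV_isCont[OF d] by (intro continuous_at_imp_continuous_on) blast
  have cf': "continuous_on S f'" for S using c by (rule continuous_on_subset) simp
  have e: "cis (- (real k * t)) = exp (t *\<^sub>R (- \<i> * of_nat k))" for t
    by (simp add: cis_conv_exp scaleR_conv_of_real mult_ac)
  have "((\<lambda>t. of_real (f' t) * cis (- (real k * t)) + (- \<i> * of_nat k) * (of_real (f t) * cis (- (real k * t)))) has_integral 0) {0..2 * pi}"
  proof (rule integral_deriv_periodic)
    fix t
    have 1: "((\<lambda>t. complex_of_real (f t)) has_vector_derivative of_real (f' t)) (at t)"
      using d[of t] by (intro has_vector_derivative_of_real) (simp add: has_real_derivative_iff_has_vector_derivative)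
    have 2: "((\<lambda>t. cis (- (real k * t))) has_vector_derivative cis (- (real k * t)) * (- \<i> * of_nat k)) (at t)"
      unfolding e by (rule exp_scaleR_has_vector_derivative_right)
    have "of_real (f t) * (cis (- (real k * t)) * (- \<i> * of_nat k)) + of_real (f' t) * cis (- (real k * t)) =
       of_real (f' t) * cis (- (real k * t)) + (- \<i> * of_nat k) * (of_real (f t) * cis (- (real k * t)))"
      by (simp only: mult_ac add.commute)
    with has_vector_derivative_mult[OF 1 2]
    show "((\<lambda>t. of_real (f t) * cis (- (real k * t))) has_vector_derivative
       of_real (f' t) * cis (- (real k * t)) + (- \<i> * of_nat k) * (of_real (f t) * cis (- (real k * t)))) (at t)"
      by (simp only:)
  next
    have "cis (- (real k * (2 * pi))) = 1"
      using cis_multiple_2pi[of "- real k"] by (simp add: mult_ac)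
    then show "of_real (f (2 * pi)) * cis (- (real k * (2 * pi))) = of_real (f 0) * cis (- (real k * 0))"
      using per[of 0] by simp
  qed
  moreover have "((\<lambda>t. of_real (f' t) * cis (- (real k * t)) + (- \<i> * of_nat k) * (of_real (f t) * cis (- (real k * t)))) has_integral
     integral {0..2 * pi} (\<lambda>t. of_real (f' t) * cis (- (real k * t))) + (- \<i> * of_nat k) * integral {0..2 * pi} (\<lambda>t. of_real (f t) * cis (- (real k * t)))) {0..2 * pi}"
    by (rule has_integral_add[OF integrable_integral[OF fourier_coeff_integrable[OF cf']]
          has_integral_mult_right[OF integrable_integral[OF fourier_coeff_integrable[OF cf]]]])
  ultimately have eq: "integral {0..2 * pi} (\<lambda>t. of_real (f' t) * cis (- (real k * t)))
     + (- \<i> * of_nat k) * integral {0..2 * pi} (\<lambda>t. of_real (f t) * cis (- (real k * t))) = 0"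
    using has_integral_unique by blast
  have "X = \<i> * of_nat k * Y" if "X + (- \<i> * of_nat k) * Y = 0" for X Y :: complex
    using that by (simp add: add_eq_0_iff2)
  from this[OF eq] show ?thesis unfolding fourier_coeff_def by (simp only: mult_scaleR_right)
qed

lemma trig_coeff_integrable:
  "continuous_on {0..2 * pi} f \<Longrightarrow> (\<lambda>t. f t * trig k t) integrable_on {0..2 * pi}"
  by (intro integrable_continuous_interval continuous_intros)

lemma trig_coeff_diff:
  assumes "continuous_on {0..2 * pi} f" "continuous_on {0..2 * pi} g"
  shows "trig_coeff k (\<lambda>t. f t - g t) = trig_coeff k f - trig_coeff k g"
  unfolding trig_coeff_def left_diff_distrib
  using integral_diff[OF trig_coeff_integrable[OF assms(1)] trig_coeff_integrable[OF assms(2)], of k k]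
  by (simp add: right_diff_distrib)

lemma trig_coeff_matrix:
  fixes w :: "real \<Rightarrow> real^'n::finite" and A :: "real^'n^'n"
  assumes "continuous_on {0..2 * pi} w"
  shows "trig_coeff k (\<lambda>t. (A *v w t) $ i) = (\<Sum>j\<in>UNIV. A $ i $ j * trig_coeff k (\<lambda>t. w t $ j))"
proof -
  have "((\<lambda>t. \<Sum>j\<in>UNIV. A $ i $ j * (w t $ j * trig k t)) has_integral
     (\<Sum>j\<in>UNIV. A $ i $ j * integral {0..2 * pi} (\<lambda>t. w t $ j * trig k t))) {0..2 * pi}"
    by (intro has_integral_sum has_integral_mult_right integrable_integral integrable_continuous_interval
        continuous_intros assms) auto
  then have "integral {0..2 * pi} (\<lambda>t. (A *v w t) $ i * trig k t)
     = (\<Sum>j\<in>UNIV. A $ i $ j * integral {0..2 * pi} (\<lambda>t. w t $ j * trig k t))"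
    by (simp add: matrix_vector_mult_def sum_distrib_right mult.assoc integral_unique)
  then show ?thesis by (simp add: trig_coeff_def sum_distrib_left mult_ac)
qed

section \<open>Composition with the gradient and the Hessian of H\<close>

lemma C2alpha_has_gradient:
  assumes "C2alpha \<alpha> H"
  shows "(H has_derivative (\<lambda>h. grad H x \<bullet> h)) (at x)"
proof -
  let ?D = "frechet_derivative H (at x)"
  have D: "(H has_derivative ?D) (at x)"
    using assms by (auto simp: C2alpha_def frechet_derivative_works)
  then have lin: "linear ?D" by (rule has_derivative_linear)
  have "?D h = grad H x \<bullet> h" for h
  proof -
    have "?D h = ?D (\<Sum>i\<in>UNIV. (h $ i) *\<^sub>R axis i 1)"
      using basis_expansion[of h] by (simp add: scalar_mult_eq_scaleR)
    also have "\<dots> = (\<Sum>i\<in>UNIV. (h $ i) *\<^sub>R ?D (axis i 1))"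
      by (simp add: linear_sum[OF lin] linear_scale[OF lin])
    finally show ?thesis by (simp add: grad_def inner_vec_def mult.commute)
  qed
  then have "?D = (\<lambda>h. grad H x \<bullet> h)" by (rule ext)
  with D show ?thesis by simp
qed

definition hess :: "(real^'n::finite \<Rightarrow> real) \<Rightarrow> real^'n \<Rightarrow> real^'n \<Rightarrow> real^'n" where
  "hess H x = frechet_derivative (grad H) (at x)"

lemma C2alpha_has_hessian:
  assumes "C2alpha \<alpha> H"
  shows "(grad H has_derivative hess H x) (at x)"
  using assms by (auto simp: C2alpha_def hess_def frechet_derivative_works)

lemma hess_holder:
  assumes "C2alpha \<alpha> H" "bounded K"
  shows "\<exists>C\<ge>0. \<forall>x\<in>K. \<forall>y\<in>K. \<forall>h. norm (hess H x h - hess H y h) \<le> C * dist x y powr \<alpha> * norm h"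
proof -
  obtain C where C: "\<And>x y. x \<in> K \<Longrightarrow> y \<in> K \<Longrightarrow> onorm (\<lambda>h. hess H x h - hess H y h) \<le> C * dist x y powr \<alpha>"
    using assms unfolding C2alpha_def hess_def by meson
  have "norm (hess H x h - hess H y h) \<le> \<bar>C\<bar> * dist x y powr \<alpha> * norm h" if "x \<in> K" "y \<in> K" for x y h
  proof -
    have "bounded_linear (\<lambda>h. hess H x h - hess H y h)"
      by (intro bounded_linear_sub has_derivative_bounded_linear[OF C2alpha_has_hessian[OF assms(1)]])
    then have "norm (hess H x h - hess H y h) \<le> onorm (\<lambda>h. hess H x h - hess H y h) * norm h" by (rule onorm)
    also have "\<dots> \<le> C * dist x y powr \<alpha> * norm h" by (intro mult_right_mono C that) auto
    also have "\<dots> \<le> \<bar>C\<bar> * dist x y powr \<alpha> * norm h" by (intro mult_right_mono) auto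
    finally show ?thesis .
  qed
  then show ?thesis by (intro exI[of _ "\<bar>C\<bar>"]) auto
qed

text \<open>The Hoelder condition against the centre 0 bounds the variation of the Hessian over the
  ball; its operator norm at 0 does the rest.\<close>

lemma hess_bounded:
  assumes H: "C2alpha \<alpha> H" and \<alpha>: "0 < \<alpha>"
  shows "\<exists>C\<ge>0. \<forall>x\<in>cball 0 R. \<forall>h. norm (hess H x h) \<le> C * norm h"
proof (cases "0 \<le> R")
  case True
  have "bounded (cball (0 :: real^'a) R)" by simp
  from hess_holder[OF H this] obtain C where C: "0 \<le> C"
    "\<And>x y h. x \<in> cball 0 R \<Longrightarrow> y \<in> cball 0 R \<Longrightarrow> norm (hess H x h - hess H y h) \<le> C * dist x y powr \<alpha> * norm h"
    by blast
  have bl: "bounded_linear (hess H 0)" by (rule has_derivative_bounded_linear[OF C2alpha_has_hessian[OF H]])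
  have "norm (hess H x h) \<le> (C * R powr \<alpha> + onorm (hess H 0)) * norm h" if x: "x \<in> cball 0 R" for x h
  proof -
    have "norm (hess H x h - hess H 0 h) \<le> C * dist x 0 powr \<alpha> * norm h" by (rule C) (use x True in auto)
    also have "\<dots> \<le> C * R powr \<alpha> * norm h" using x C(1) \<alpha>
      by (intro mult_right_mono mult_left_mono powr_mono2) (auto simp: dist_commute)
    finally have "norm (hess H x h) \<le> C * R powr \<alpha> * norm h + norm (hess H 0 h)"
      using norm_triangle_ineq2[of "hess H x h" "hess H 0 h"] by linarith
    also have "norm (hess H 0 h) \<le> onorm (hess H 0) * norm h" by (rule onorm[OF bl])
    finally show ?thesis by (simp add: distrib_right)
  qed
  moreover have "0 \<le> C * R powr \<alpha> + onorm (hess H 0)" using C(1) onorm_pos_le[OF bl] by simp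
  ultimately show ?thesis by blast
qed (auto intro!: exI[of _ 0])

text \<open>The range of \<open>u\<close> lies in a ball on which the Hessian is bounded, so
  \<open>grad H\<close> is Lipschitz there and composition keeps the exponent.\<close>

lemma holder_grad_compose:
  fixes u :: "real \<Rightarrow> real^'n::finite"
  assumes H: "C2alpha \<alpha> H" and \<alpha>: "0 < \<alpha>" and R: "\<And>t. norm (u t) \<le> R" and u: "holder b u"
  shows "holder b (\<lambda>t. grad H (u t))"
proof -
  obtain C where C: "0 \<le> C" "\<And>x h. x \<in> cball 0 R \<Longrightarrow> norm (hess H x h) \<le> C * norm h"
    using hess_bounded[OF H \<alpha>] by blast
  obtain K where K: "\<And>t r. norm (u t - u r) \<le> K * \<bar>t - r\<bar> powr b" using u by (auto simp: holder_real_iff)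
  have "norm (grad H (u t) - grad H (u r)) \<le> (C * K) * \<bar>t - r\<bar> powr b" for t r
  proof -
    have "norm (grad H (u t) - grad H (u r)) \<le> C * norm (u t - u r)"
    proof (rule differentiable_bound[of "cball 0 R"])
      show "(grad H has_derivative hess H x) (at x within cball 0 R)" for x
        by (rule has_derivative_at_withinI[OF C2alpha_has_hessian[OF H]])
      show "onorm (hess H x) \<le> C" if "x \<in> cball 0 R" for x by (rule onorm_le) (rule C(2)[OF that])
    qed (use R in auto)
    also have "\<dots> \<le> C * (K * \<bar>t - r\<bar> powr b)" by (intro mult_left_mono K C)
    finally show ?thesis by (simp add: mult.assoc)
  qed
  then show ?thesis by (auto simp: holder_real_iff)
qed

lemma periodic_deriv:
  fixes f :: "real \<Rightarrow> 'a::real_normed_vector"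
  assumes "\<And>t. (f has_vector_derivative f' t) (at t)" "\<And>t. f (t + 2 * pi) = f t"
  shows "f' (t + 2 * pi) = f' t"
proof -
  have "((\<lambda>t. t + 2 * pi) has_real_derivative 1) (at t)" by (auto intro!: derivative_eq_intros)
  from vector_diff_chain_at[OF this[unfolded has_real_derivative_iff_has_vector_derivative] assms(1)]
  have "(f has_vector_derivative f' (t + 2 * pi)) (at t)" by (simp add: o_def assms(2))
  then show ?thesis using assms(1)[of t] by (rule vector_derivative_unique_at)
qed

text \<open>Split as for a product: the Hessian along \<open>u\<close> varies with order b \<alpha>
  and \<open>u'\<close> with order m, while the other factor stays bounded; \<theta> is below both
  orders. The estimate is made for |t - r| \<le> 1 and extended by boundedness.\<close>

lemma grad_compose_C1:
  fixes u :: "real \<Rightarrow> real^'n::finite"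
  assumes H: "C2alpha \<alpha> H" and \<alpha>: "0 < \<alpha>"
    and per: "\<And>t. u (t + 2 * pi) = u t" and hu: "holder b u" and b: "0 < b"
    and d: "\<And>t. (u has_vector_derivative u' t) (at t)" and hu': "holder m u'" and m: "0 < m"
    and \<theta>: "0 < \<theta>" "\<theta> \<le> m" "\<theta> \<le> b * \<alpha>"
  shows "((\<lambda>t. grad H (u t)) has_vector_derivative hess H (u t) (u' t)) (at t)"
    and "holder \<theta> (\<lambda>t. hess H (u t) (u' t))"
proof -
  have dG: "((\<lambda>t. grad H (u t)) has_vector_derivative hess H (u t) (u' t)) (at t)" for t
  proof -
    have lin: "linear (hess H (u t))" by (rule has_derivative_linear[OF C2alpha_has_hessian[OF H]])
    from diff_chain_at[OF d[of t, unfolded has_vector_derivative_def] C2alpha_has_hessian[OF H]]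
    show ?thesis by (simp add: has_vector_derivative_def o_def linear_scale[OF lin])
  qed
  then show "((\<lambda>t. grad H (u t)) has_vector_derivative hess H (u t) (u' t)) (at t)" .
  have per': "u' (t + 2 * pi) = u' t" for t by (rule periodic_deriv[OF d per])
  obtain R where R: "\<And>t. norm (u t) \<le> R"
    using periodic_continuous_bounded[OF holder_imp_continuous_on[OF hu b] per] by blast
  obtain R' where R': "\<And>t. norm (u' t) \<le> R'"
    using periodic_continuous_bounded[OF holder_imp_continuous_on[OF hu' m] per'] by blast
  have R'0: "0 \<le> R'" by (rule order_trans[OF norm_ge_zero R'])
  obtain C where C: "0 \<le> C" "\<And>x h. x \<in> cball 0 R \<Longrightarrow> norm (hess H x h) \<le> C * norm h"
    using hess_bounded[OF H \<alpha>] by blast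
  have "bounded (cball (0 :: real^'n) R)" by simp
  from hess_holder[OF H this] obtain E where E: "0 \<le> E"
    "\<And>x y h. x \<in> cball 0 R \<Longrightarrow> y \<in> cball 0 R \<Longrightarrow> norm (hess H x h - hess H y h) \<le> E * dist x y powr \<alpha> * norm h"
    by blast
  obtain K where K: "\<And>t r. norm (u t - u r) \<le> K * \<bar>t - r\<bar> powr b" using hu by (auto simp: holder_real_iff)
  obtain K' where K': "\<And>t r. norm (u' t - u' r) \<le> K' * \<bar>t - r\<bar> powr m" using hu' by (auto simp: holder_real_iff)
  have K0: "0 \<le> K" using order_trans[OF norm_ge_zero K[of 1 0]] by simp
  have K'0: "0 \<le> K'" using order_trans[OF norm_ge_zero K'[of 1 0]] by simp
  have uR: "u t \<in> cball 0 R" for t using R[of t] by simp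
  have loc: "norm (hess H (u t) (u' t) - hess H (u r) (u' r)) \<le> (E * K powr \<alpha> * R' + C * K') * \<bar>t - r\<bar> powr \<theta>"
    if tr: "\<bar>t - r\<bar> \<le> 1" for t r
  proof -
    have lin: "linear (hess H (u r))" by (rule has_derivative_linear[OF C2alpha_has_hessian[OF H]])
    have "dist (u t) (u r) powr \<alpha> \<le> (K * \<bar>t - r\<bar> powr b) powr \<alpha>"
      using K[of t r] \<alpha> by (intro powr_mono2) (auto simp: dist_norm)
    also have "\<dots> = K powr \<alpha> * \<bar>t - r\<bar> powr (b * \<alpha>)" using K0 by (simp add: powr_mult powr_powr)
    also have "\<dots> \<le> K powr \<alpha> * \<bar>t - r\<bar> powr \<theta>" using tr \<theta> by (intro mult_left_mono powr_mono') auto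
    finally have "E * dist (u t) (u r) powr \<alpha> * norm (u' t) \<le> E * (K powr \<alpha> * \<bar>t - r\<bar> powr \<theta>) * R'"
      using E(1) R' R'0 by (intro mult_mono mult_nonneg_nonneg) auto
    then have 1: "norm (hess H (u t) (u' t) - hess H (u r) (u' t)) \<le> E * (K powr \<alpha> * \<bar>t - r\<bar> powr \<theta>) * R'"
      using E(2)[OF uR[of t] uR[of r], of "u' t"] by linarith
    have "\<bar>t - r\<bar> powr m \<le> \<bar>t - r\<bar> powr \<theta>" using tr \<theta> by (intro powr_mono') auto
    then have "K' * \<bar>t - r\<bar> powr m \<le> K' * \<bar>t - r\<bar> powr \<theta>" using K'0 by (rule mult_left_mono)
    then have "norm (u' t - u' r) \<le> K' * \<bar>t - r\<bar> powr \<theta>" using K'[of t r] by linarith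
    then have "C * norm (u' t - u' r) \<le> C * (K' * \<bar>t - r\<bar> powr \<theta>)" using C(1) by (rule mult_left_mono)
    then have 2: "norm (hess H (u r) (u' t) - hess H (u r) (u' r)) \<le> C * (K' * \<bar>t - r\<bar> powr \<theta>)"
      using C(2)[OF uR[of r], of "u' t - u' r"] by (simp add: linear_diff[OF lin])
    have "norm (hess H (u t) (u' t) - hess H (u r) (u' r)) \<le>
       norm (hess H (u t) (u' t) - hess H (u r) (u' t)) + norm (hess H (u r) (u' t) - hess H (u r) (u' r))"
      using norm_triangle_ineq[of "hess H (u t) (u' t) - hess H (u r) (u' t)" "hess H (u r) (u' t) - hess H (u r) (u' r)"] by simp
    also have "\<dots> \<le> E * (K powr \<alpha> * \<bar>t - r\<bar> powr \<theta>) * R' + C * (K' * \<bar>t - r\<bar> powr \<theta>)" using 1 2 by linarith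
    also have "\<dots> = (E * K powr \<alpha> * R' + C * K') * \<bar>t - r\<bar> powr \<theta>" by (simp add: algebra_simps)
    finally show ?thesis .
  qed
  have B: "norm (hess H (u t) (u' t)) \<le> C * R'" for t
    by (rule order_trans[OF C(2)[OF uR] mult_left_mono[OF R' C(1)]])
  have "norm (hess H (u t) (u' t) - hess H (u r) (u' r)) \<le> max (E * K powr \<alpha> * R' + C * K') (2 * (C * R')) * \<bar>t - r\<bar> powr \<theta>" for t r
    by (rule holder_local_to_global[OF loc B]) (use \<theta> in auto)
  then show "holder \<theta> (\<lambda>t. hess H (u t) (u' t))" by (auto simp: holder_real_iff)
qed

text \<open>The real equations at k and -k are the cosine and sine halves of one complex equation:
  d/dt exchanges the two kinds of coefficients with a sign, so the terms in \<open>b\<close> combine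
  to multiplication by ik.\<close>

lemma fourier_coeff_from_trig_coeff:
  assumes c: "continuous_on {0..2 * pi} f" "continuous_on {0..2 * pi} a" "continuous_on {0..2 * pi} b" and k: "0 < k"
    and 1: "r * trig_coeff (int k) f = real k * trig_coeff (- int k) b + trig_coeff (int k) a"
    and 2: "r * trig_coeff (- int k) f = - real k * trig_coeff (int k) b + trig_coeff (- int k) a"
  shows "of_real r * fourier_coeff k f = fourier_coeff k a + \<i> * of_nat k * fourier_coeff k b"
proof -
  have "of_real r * fourier_coeff k f = (of_real (r * trig_coeff (int k) f) - \<i> * of_real (r * trig_coeff (- int k) f)) / 2"
    unfolding fourier_coeff_eq_trig_coeff[OF c(1) k] by (simp add: algebra_simps)
  also have "\<dots> = fourier_coeff k a + \<i> * of_nat k * fourier_coeff k b"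
    unfolding 1 2 fourier_coeff_eq_trig_coeff[OF c(2) k] fourier_coeff_eq_trig_coeff[OF c(3) k] by (simp add: field_simps)
  finally show ?thesis .
qed

text \<open>Inverting the operator and paying for d/dt gains p_i - 1 \<ge> \<sigma> in each round.
  The term \<open>a\<close> is only of order \<beta>', but it gains the full p_i \<ge> 1 + \<sigma>
  and is never the bottleneck.\<close>

lemma regularity_bootstrap:
  fixes u :: "real \<Rightarrow> real^'n::finite"
  assumes per: "\<And>t. u (t + 2 * pi) = u t" and hu: "holder (\<sigma> / 4) u" and \<sigma>: "0 < \<sigma>" "\<sigma> \<le> 1"
    and p: "\<And>i. 1 + \<sigma> \<le> p i" "\<And>i. \<beta>' + p i < 2" and \<beta>': "0 < \<beta>'" "\<beta>' < 1"
    and a: "\<And>i. holder \<beta>' (a i)" "\<And>i t. a i (t + 2 * pi) = a i t"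
    and g: "\<And>b. 0 < b \<Longrightarrow> holder b u \<Longrightarrow> holder b (\<lambda>t. G (u t))"
    and eq: "\<And>i k. 0 < k \<Longrightarrow> fourier_coeff k (\<lambda>t. u t $ i) =
       of_real (real k powr - p i) * (fourier_coeff k (a i) + \<i> * of_nat k * fourier_coeff k (\<lambda>t. G (u t) $ i))"
  shows "\<exists>u'. (\<forall>t. (u has_vector_derivative u' t) (at t)) \<and> holder (\<sigma> / 2) u' \<and> holder (1 - \<sigma> / 2) u"
proof -
  have cu: "continuous_on S (\<lambda>t. u t $ i)" for S i
    by (rule holder_imp_continuous_on[OF holder_nth[OF hu]]) (use \<sigma> in auto)
  have bound: "\<exists>C. \<forall>z. 0 < Im z \<longrightarrow> Im z \<le> 1 \<longrightarrow> norm (exp_series (\<lambda>k. of_nat k * (of_nat k * fourier_coeff k (\<lambda>t. u t $ i))) z) \<le> C * Im z powr (q - 2)"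
    if b: "0 < b" "b < 1" "holder b u" and q: "q \<le> \<beta>' + p i" "q \<le> b + p i - 1" for b q i
    by (rule exp_series_second_derivative_bound[OF eq cu, where \<beta>' = \<beta>' and \<beta> = b])
      (use p[of i] \<beta>' a b q \<sigma> per in \<open>auto intro!: holder_nth g\<close>)
  \<comment> \<open>Steps of \<sigma>/2 stay within the available gain \<sigma>. The cap 1 -
    \<sigma>/2 keeps all orders below 1, and a last gain of \<sigma> leads to 1 + \<sigma>/2, past
    the integer without landing on it.\<close>
  define \<beta> where "\<beta> n = min (\<sigma> / 4 + real n * (\<sigma> / 2)) (1 - \<sigma> / 2)" for n
  have "holder (\<beta> n) u" for n
  proof (induction n)
    case 0
    have "\<beta> 0 = \<sigma> / 4" using \<sigma> by (simp add: \<beta>_def)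
    then show ?case using hu by (simp only:)
  next
    case (Suc n)
    have b: "0 < \<beta> n" "\<beta> n < 1" using \<sigma> by (auto simp: \<beta>_def add_pos_nonneg)
    have q: "0 < \<beta> (Suc n)" "\<beta> (Suc n) < 1" using \<sigma> by (auto simp: \<beta>_def add_pos_nonneg)
    have "real (Suc n) * (\<sigma> / 2) = real n * (\<sigma> / 2) + \<sigma> / 2" by (simp add: algebra_simps add_divide_distrib)
    then have st: "\<beta> (Suc n) \<le> \<beta> n + \<sigma>" using \<sigma> unfolding \<beta>_def by linarith
    show ?case
    proof (rule holder_vec)
      fix i
      have "\<beta> (Suc n) \<le> \<beta>' + p i" "\<beta> (Suc n) \<le> \<beta> n + p i - 1" using q st p(1)[of i] \<beta>' \<sigma> by linarith+
      from bound[OF b Suc.IH this] obtain C where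
        "\<And>z. 0 < Im z \<Longrightarrow> Im z \<le> 1 \<Longrightarrow> norm (exp_series (\<lambda>k. of_nat k * (of_nat k * fourier_coeff k (\<lambda>t. u t $ i))) z) \<le> C * Im z powr (\<beta> (Suc n) - 2)"
        by blast
      from holder_from_second_derivative[OF cu _ q this] per show "holder (\<beta> (Suc n)) (\<lambda>t. u t $ i)"
        by (simp add: holder_real_iff)
    qed
  qed
  moreover obtain n :: nat where "1 / (\<sigma> / 2) < real n" using reals_Archimedean2 by blast
  then have "1 < real n * (\<sigma> / 2)" using \<sigma> by (simp add: field_simps)
  then have "\<beta> n = 1 - \<sigma> / 2" using \<sigma> by (simp add: \<beta>_def)
  ultimately have hol: "holder (1 - \<sigma> / 2) u" by metis
  have "\<exists>f'. (\<forall>t. ((\<lambda>t. u t $ i) has_real_derivative f' t) (at t)) \<and> holder (\<sigma> / 2) f'" for i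
  proof -
    have "1 + \<sigma> / 2 \<le> \<beta>' + p i" "1 + \<sigma> / 2 \<le> (1 - \<sigma> / 2) + p i - 1" using p(1)[of i] \<beta>' \<sigma> by linarith+
    from bound[OF _ _ hol this] \<sigma> obtain C where
      "\<And>z. 0 < Im z \<Longrightarrow> Im z \<le> 1 \<Longrightarrow> norm (exp_series (\<lambda>k. of_nat k * (of_nat k * fourier_coeff k (\<lambda>t. u t $ i))) z) \<le> C * Im z powr (1 + \<sigma> / 2 - 2)"
      by auto
    then have C: "\<And>z. 0 < Im z \<Longrightarrow> Im z \<le> 1 \<Longrightarrow> norm (exp_series (\<lambda>k. of_nat k * (of_nat k * fourier_coeff k (\<lambda>t. u t $ i))) z) \<le> C * Im z powr (\<sigma> / 2 - 1)"
      by simp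
    have "0 < \<sigma> / 2" "\<sigma> / 2 < 1" using \<sigma> by auto
    from C1_from_second_derivative[OF cu _ this C] per show ?thesis
      by (auto simp: holder_real_iff)
  qed
  then obtain f' where f': "\<And>i t. ((\<lambda>t. u t $ i) has_real_derivative f' i t) (at t)" "\<And>i. holder (\<sigma> / 2) (f' i)"
    by metis
  define u' where "u' t = (\<chi> i. f' i t)" for t
  have "(u has_vector_derivative u' t) (at t)" for t
    unfolding has_vector_derivative_vec by (simp add: u'_def f')
  moreover have "holder (\<sigma> / 2) u'" by (rule holder_vec) (simp add: u'_def f')
  ultimately show ?thesis using hol by blast
qed

text \<open>Since \<open>a\<close> has order \<theta>, \<open>f\<close> has order \<theta> + 2s,
  strictly above 2s, so the symmetric integral converges absolutely. C1 times that integral minus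
  \<open>a\<close> is then continuous and periodic with all coefficients 0, and therefore vanishes
  pointwise.\<close>

lemma frac_lap_from_fourier_coeff:
  assumes c: "continuous_on UNIV f" and per: "\<And>t. f (t + 2 * pi) = f t" and s: "1 / 2 < s" "s < 1"
    and a: "holder \<theta> a" "\<And>t. a (t + 2 * pi) = a t" and \<theta>: "0 < \<theta>" "\<theta> + 2 * s < 2"
    and eq: "\<And>k. of_real (real k powr (2 * s)) * fourier_coeff k f = fourier_coeff k a"
  shows "frac_lap_exists s f t" "frac_lap s f t = - a t"
proof -
  have \<theta>1: "\<theta> < 1" using \<theta> s by linarith
  have ca: "continuous_on S a" for S by (rule holder_imp_continuous_on[OF a(1) \<theta>(1)])
  have cf: "continuous_on S f" for S using c continuous_on_subset by blast
  have eq': "of_nat k * (of_nat k * fourier_coeff k f) = of_real (real k powr - (2 * s)) * (of_nat k * (of_nat k * fourier_coeff k a))" for k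
  proof (cases "k = 0")
    case False
    then have "real k powr - (2 * s) * real k powr (2 * s) = 1" by (simp flip: powr_add)
    then have "of_real (real k powr - (2 * s)) * (of_real (real k powr (2 * s)) * fourier_coeff k f) = fourier_coeff k f"
      by (metis mult.assoc mult_1_left of_real_1 of_real_mult)
    then show ?thesis unfolding eq by (metis mult.left_commute)
  qed simp
  \<comment> \<open>The Hoelder order of \<open>f'\<close>: \<theta> > 0 gives 2s < 1 + m, and
    \<theta> + 2s < 2 gives m < 1.\<close>
  define m where "m = \<theta> + 2 * s - 1"
  have m: "0 < m" "m < 1" "2 * s < 1 + m" using \<theta> s by (auto simp: m_def)
  have s2: "1 \<le> 2 * s" using s by simp
  obtain C where C: "\<And>z. 0 < Im z \<Longrightarrow>
      norm (exp_series (\<lambda>k. of_real (real k powr - (2 * s)) * (of_nat k * (of_nat k * fourier_coeff k a))) z) \<le> C * Im z powr (2 * s - (1 - \<theta> + 1))"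
    using fractional_gain[OF s2 a \<theta>(1) \<theta>1 \<theta>(2)] by blast
  have ms: "2 * s - (1 - \<theta> + 1) = m - 1" by (simp add: m_def)
  have "norm (exp_series (\<lambda>k. of_nat k * (of_nat k * fourier_coeff k f)) z) \<le> C * Im z powr (m - 1)" if "0 < Im z" "Im z \<le> 1" for z
    unfolding eq' using C[OF that(1)] unfolding ms .
  from C1_from_second_derivative[OF c per m(1,2) this] obtain f' K
    where d: "\<And>t. (f has_real_derivative f' t) (at t)" and K: "\<And>t u. \<bar>f' t - f' u\<bar> \<le> K * \<bar>t - u\<bar> powr m"
    by blast
  obtain B where B: "\<And>t. \<bar>f t\<bar> \<le> B" using periodic_continuous_bounded[OF c per] by auto
  have s0: "0 < s" using s by simp
  obtain D where D: "integrable lborel D" "\<And>x h. \<bar>second_diff f x h / \<bar>h\<bar> powr (1 + 2 * s)\<bar> \<le> D h"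
    using second_diff_dominated[OF d K m(1) _ m(3) s0 B] m(2) by auto
  have lim: "(trunc_int s f t \<longlongrightarrow> sym_frac s f t) (at_right 0)" for t
    by (rule trunc_int_tendsto[OF c B s0 D])
  show "frac_lap_exists s f t"
    unfolding frac_lap_exists_def using truncated_set_integrable[OF c B s0] lim by blast
  have fpos: "0 < frac_const s" by (rule frac_const_pos[OF s0 s(2)])
  define \<Lambda> where "\<Lambda> = (\<lambda>x. C1 s * sym_frac s f x + - 1 * a x)"
  have csf: "continuous_on S (sym_frac s f)" for S
    by (rule continuous_on_subset[OF sym_frac_continuous[OF c D]]) simp
  have "\<Lambda> t = 0"
  proof (rule fourier_coeff_eq_0_imp_zero[of \<Lambda>])
    show "continuous_on UNIV \<Lambda>" unfolding \<Lambda>_def by (intro continuous_intros csf ca)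
    show "\<Lambda> (t + 2 * pi) = \<Lambda> t" for t
      using sym_frac_periodic[of f s t] per a(2)[of t] by (simp add: \<Lambda>_def)
    show "fourier_coeff k \<Lambda> = 0" for k
    proof -
      have "fourier_coeff k \<Lambda> = fourier_coeff k (\<lambda>x. C1 s * sym_frac s f x) + fourier_coeff k (\<lambda>x. - 1 * a x)"
        unfolding \<Lambda>_def by (rule fourier_coeff_add) (intro continuous_intros csf ca)+
      also have "\<dots> = of_real (C1 s) * fourier_coeff k (sym_frac s f) + of_real (- 1) * fourier_coeff k a" unfolding fourier_coeff_cmult ..
      also have "fourier_coeff k (sym_frac s f) = of_real (real k powr (2 * s) * frac_const s) * fourier_coeff k f"
        by (rule fourier_coeff_sym_frac[OF c per s0 s(2) D])
      also have "of_real (C1 s) * (of_real (real k powr (2 * s) * frac_const s) * fourier_coeff k f) =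
          of_real (C1 s * (real k powr (2 * s) * frac_const s)) * fourier_coeff k f"
        by (simp only: of_real_mult mult.assoc)
      also have "C1 s * (real k powr (2 * s) * frac_const s) = real k powr (2 * s)"
        using fpos by (simp add: C1_eq)
      finally show ?thesis unfolding eq by simp
    qed
  qed
  moreover have "neg_frac_lap s f t = C1 s * sym_frac s f t"
    unfolding neg_frac_lap_def by (subst tendsto_Lim[OF _ lim]) auto
  ultimately show "frac_lap s f t = - a t" by (simp add: frac_lap_def \<Lambda>_def)
qed

subsection \<open>Existence of periodic solutions\<close>

theorem theorem1p3:
  fixes \<alpha> :: real and s :: "'n::finite \<Rightarrow> real" and H :: "real^'n \<Rightarrow> real"
    and A :: "real^'n^'n" and e :: "real \<Rightarrow> real^'n"
  assumes "0 < \<alpha>" "\<alpha> < 1"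
    and "\<forall>i. 1/2 < s i \<and> s i < 1"
    and "C2alpha \<alpha> H"
    and "holder \<alpha> e"
    and "\<forall>t. e (t + 2 * pi) = e t"
    and "(1 / (2 * pi)) *\<^sub>R integral {0..2 * pi} e \<in> range (\<lambda>y. A *v y)"
    and "(SUP y\<in>{y. norm y = 1}. (A *v y) \<bullet> y) < 1"
  shows "\<exists>u. periodic_classical_solution s H A e u"
proof -
  note \<alpha> = assms(1,2) and H = assms(4) and he = assms(5)
  have s: "1 / 2 < s i" "s i < 1" for i using assms(3) by auto
  have eper: "e (t + 2 * pi) = e t" for t using assms(6) by blast
  have ce: "continuous_on S e" for S by (rule holder_imp_continuous_on[OF he \<alpha>(1)])
  define G where "G = grad H"
  have cG: "continuous_on S G" for S
    unfolding G_def using C2alpha_has_hessian[OF H] has_derivative_continuous continuous_at_imp_continuous_on by blast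

  \<comment> \<open>The supremum may be negative, but the energy estimate enlarges the sum of
    squares to the energy under the factor M, which needs M \<ge> 0.\<close>
  define M where "M = max 0 (SUP y\<in>{y. norm y = 1}. (A *v y) \<bullet> y)"
  have M: "0 \<le> M" "M < 1" using assms(8) by (auto simp: M_def)
  have AM: "(A *v y) \<bullet> y \<le> M * (y \<bullet> y)" for y
  proof (cases "y = 0")
    case False
    define z where "z = (1 / norm y) *\<^sub>R y"
    have z: "norm z = 1" "y = norm y *\<^sub>R z" using False by (auto simp: z_def)
    have "bdd_above ((\<lambda>y. (A *v y) \<bullet> y) ` {y. norm y = 1})"
    proof -
      have "{y :: real^'n. norm y = 1} = sphere 0 1" by auto
      then have "compact ((\<lambda>y. (A *v y) \<bullet> y) ` {y. norm y = 1})"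
        by (intro compact_continuous_image continuous_intros) auto
      then show ?thesis by (intro bounded_imp_bdd_above compact_imp_bounded)
    qed
    then have "(A *v z) \<bullet> z \<le> (SUP y\<in>{y. norm y = 1}. (A *v y) \<bullet> y)" using z by (intro cSUP_upper) auto
    then have "(A *v z) \<bullet> z \<le> M" by (simp add: M_def)
    then have "(norm y)\<^sup>2 * ((A *v z) \<bullet> z) \<le> (norm y)\<^sup>2 * M" by (intro mult_left_mono) auto
    moreover have "(A *v y) \<bullet> y = (norm y)\<^sup>2 * ((A *v z) \<bullet> z)"
      by (subst (1 2) z(2)) (simp add: matrix_vector_mult_scaleR power2_eq_square)
    ultimately show ?thesis by (simp add: power2_norm_eq_inner mult.commute)
  qed simp

  \<comment> \<open>The net gain of the worst component, used for all of them.\<close>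
  define \<sigma> where "\<sigma> = Min (range (\<lambda>i. 2 * s i - 1))"
  have \<sigma>le: "\<sigma> \<le> 2 * s i - 1" for i by (simp add: \<sigma>_def)
  have "\<sigma> \<in> range (\<lambda>i. 2 * s i - 1)" unfolding \<sigma>_def by (intro Min_in) auto
  then obtain i0 where "\<sigma> = 2 * s i0 - 1" by blast
  then have \<sigma>: "0 < \<sigma>" "\<sigma> \<le> 1" using s[of i0] by auto
  \<comment> \<open>Half of the least 2 - 2 s_i, so that \<epsilon> + 2 s_i stays strictly below
    2.\<close>
  define \<epsilon> where "\<epsilon> = Min (range (\<lambda>i. 2 - 2 * s i)) / 2"
  have "Min (range (\<lambda>i. 2 - 2 * s i)) \<in> range (\<lambda>i. 2 - 2 * s i)" by (intro Min_in) auto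
  then have \<epsilon>: "0 < \<epsilon>" using s by (auto simp: \<epsilon>_def)
  have \<epsilon>le: "2 * \<epsilon> \<le> 2 - 2 * s i" for i by (simp add: \<epsilon>_def)

  obtain y0 where y0: "A *v y0 = (1 / (2 * pi)) *\<^sub>R integral {0..2 * pi} e" using assms(7) by auto
  have p: "1 + \<sigma> \<le> 2 * s i" for i using \<sigma>le[of i] by simp
  obtain w C where wper: "\<And>t. w (t + 2 * pi) = w t"
    and wh: "\<And>t r. norm (w t - w r) \<le> C * \<bar>t - r\<bar> powr (\<sigma> / 4)"
    and w0: "\<And>i. integral {0..2 * pi} (\<lambda>t. w t $ i) = 0"
    and wk: "\<And>i k. k \<noteq> 0 \<Longrightarrow> \<bar>of_int k\<bar> powr (2 * s i) * trig_coeff k (\<lambda>t. w t $ i) = of_int k * trig_coeff (- k) (\<lambda>t. G (y0 + w t) $ i)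
        + (\<Sum>j\<in>UNIV. A $ i $ j * trig_coeff k (\<lambda>t. w t $ j)) - trig_coeff k (\<lambda>t. e t $ i)"
  proof -
    have "\<exists>w C. (\<forall>t. w (t + 2 * pi) = w t) \<and>
     (\<forall>t u. norm (w t - w u) \<le> C * \<bar>t - u\<bar> powr (\<sigma> / 4)) \<and>
     (\<forall>i. integral {0..2 * pi} (\<lambda>t. w t $ i) = 0) \<and>
     (\<forall>i k. k \<noteq> 0 \<longrightarrow> \<bar>of_int k\<bar> powr (2 * s i) * trig_coeff k (\<lambda>t. w t $ i) = of_int k * trig_coeff (- k) (\<lambda>t. G (y0 + w t) $ i)
        + (\<Sum>j\<in>UNIV. A $ i $ j * trig_coeff k (\<lambda>t. w t $ j)) - trig_coeff k (\<lambda>t. e t $ i))"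
    proof (rule weak_solution_exists[where H = H and p = "\<lambda>i. 2 * s i" and M = M])
      show "(H has_derivative (\<lambda>h. G x \<bullet> h)) (at x)" for x
        unfolding G_def by (rule C2alpha_has_gradient[OF H])
    qed (use cG ce p \<sigma> AM M in auto)
    then show ?thesis using that by blast
  qed
  have hw: "holder (\<sigma> / 4) w" using wh by (auto simp: holder_real_iff)
  have cw: "continuous_on S w" for S by (rule holder_imp_continuous_on[OF hw]) (use \<sigma> in auto)
  define u where "u = (\<lambda>t. y0 + w t)"
  have uper: "u (t + 2 * pi) = u t" for t by (simp add: u_def wper)
  have hu: "holder (\<sigma> / 4) u" using wh by (auto simp: u_def holder_real_iff)
  have cu: "continuous_on S u" for S unfolding u_def by (intro continuous_intros cw)
  have cGu: "continuous_on S (\<lambda>t. G (u t))" for S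
    by (rule continuous_on_compose2[OF cG cu]) auto
  obtain R where R: "\<And>t. norm (u t) \<le> R" using periodic_continuous_bounded[OF cu uper] by blast
  have hG: "holder b (\<lambda>t. G (u t))" if "holder b u" for b
    unfolding G_def by (rule holder_grad_compose[OF H \<alpha>(1) R that])

  \<comment> \<open>The equation reads (-\<Delta>)^s_i u_i = d/dt G_i(u) + a_i. Subtraction appears
    as adding \<open>- 1 *\<close>, so that the lemmas on sums and linear images apply;
    \<open>a'\<close> omits the constant \<open>A *v y0\<close>, to match the weak equation for
    \<open>w\<close>.\<close>
  define a where "a i t = (A *v u t) $ i + - 1 * e t $ i" for i t
  define a' where "a' i t = (A *v w t) $ i - e t $ i" for i t
  have a_eq: "a i = (\<lambda>t. (A *v y0) $ i + a' i t)" for i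
    by (simp add: a_def a'_def u_def matrix_vector_right_distrib fun_eq_iff)
  have cAw: "continuous_on S (\<lambda>t. (A *v w t) $ i)" for S i
    by (intro continuous_intros bounded_linear.continuous_on[OF matrix_vector_mul_bounded_linear cw])
  have ca': "continuous_on S (a' i)" for S i unfolding a'_def by (intro continuous_intros cAw ce)
  have cwi: "continuous_on S (\<lambda>t. w t $ i)" for S i by (intro continuous_intros cw)
  have cei: "continuous_on S (\<lambda>t. e t $ i)" for S i by (intro continuous_intros ce)
  have cGi: "continuous_on S (\<lambda>t. G (u t) $ i)" for S i by (intro continuous_intros cGu)
  have u_fc: "fourier_coeff k (\<lambda>t. u t $ i) = fourier_coeff k (\<lambda>t. w t $ i)" if "0 < k" for k i
    using fourier_coeff_add[of "\<lambda>_. y0 $ i" "\<lambda>t. w t $ i" k] that by (simp add: u_def fourier_coeff_const cwi)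
  have a_fc: "fourier_coeff k (a i) = fourier_coeff k (a' i)" if "0 < k" for k i
    unfolding a_eq using fourier_coeff_add[of "\<lambda>_. (A *v y0) $ i" "a' i" k] that by (simp add: fourier_coeff_const ca')
  have main: "of_real (real k powr (2 * s i)) * fourier_coeff k (\<lambda>t. u t $ i) = fourier_coeff k (a i) + \<i> * of_nat k * fourier_coeff k (\<lambda>t. G (u t) $ i)"
    if k: "0 < k" for k i
    unfolding u_fc[OF k] a_fc[OF k]
  proof (rule fourier_coeff_from_trig_coeff[OF cwi ca' cGi k])
    have cka: "trig_coeff j (a' i) = (\<Sum>l\<in>UNIV. A $ i $ l * trig_coeff j (\<lambda>t. w t $ l)) - trig_coeff j (\<lambda>t. e t $ i)" for j
      unfolding a'_def trig_coeff_diff[OF cAw cei] trig_coeff_matrix[OF cw] ..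
    show "real k powr (2 * s i) * trig_coeff (int k) (\<lambda>t. w t $ i) = real k * trig_coeff (- int k) (\<lambda>t. G (u t) $ i) + trig_coeff (int k) (a' i)"
      using wk[of "int k" i] k unfolding cka u_def by simp
    show "real k powr (2 * s i) * trig_coeff (- int k) (\<lambda>t. w t $ i) = - real k * trig_coeff (int k) (\<lambda>t. G (u t) $ i) + trig_coeff (- int k) (a' i)"
      using wk[of "- int k" i] k unfolding cka u_def by simp
  qed
  have main': "fourier_coeff k (\<lambda>t. u t $ i) = of_real (real k powr - (2 * s i)) * (fourier_coeff k (a i) + \<i> * of_nat k * fourier_coeff k (\<lambda>t. G (u t) $ i))"
    if k: "0 < k" for k i
  proof -
    have "real k powr - (2 * s i) * real k powr (2 * s i) = 1" using k by (simp flip: powr_add)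
    then have "of_real (real k powr - (2 * s i)) * (of_real (real k powr (2 * s i)) * fourier_coeff k (\<lambda>t. u t $ i)) = fourier_coeff k (\<lambda>t. u t $ i)"
      by (metis mult.assoc mult_1_left of_real_1 of_real_mult)
    then show ?thesis unfolding main[OF k] by simp
  qed

  have hAu: "holder b (\<lambda>t. (A *v u t) $ i)" if "holder b u" for b i
    by (intro holder_nth holder_bounded_linear[OF that] matrix_vector_mul_bounded_linear)
  have ha: "holder b (a i)" if "0 < b" "b \<le> \<alpha>" "b \<le> \<sigma> / 4" for b i
  proof -
    have "holder b e" "holder b u" by (rule holder_antimono[OF he eper] holder_antimono[OF hu uper]; use that in auto)+
    then show ?thesis unfolding a_def
      by (intro holder_add hAu holder_bounded_linear[OF holder_nth] bounded_linear_mult_right)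
  qed
  have aper: "a i (t + 2 * pi) = a i t" for i t by (simp add: a_def uper eper)

  \<comment> \<open>Limits on the order of \<open>a\<close>: \<alpha> from \<open>e\<close>,
    \<sigma>/4 from what is known of \<open>u\<close> so far, and \<epsilon> to keep \<beta> + 2 s_i
    below 2.\<close>
  define \<beta> where "\<beta> = min \<epsilon> (min \<alpha> (\<sigma> / 4))"
  have \<beta>: "0 < \<beta>" "\<beta> < 1" "\<beta> \<le> \<alpha>" "\<beta> \<le> \<sigma> / 4" "\<beta> \<le> \<epsilon>" using \<alpha> \<sigma> \<epsilon> by (auto simp: \<beta>_def)
  have \<beta>s: "\<beta> + 2 * s i < 2" for i using \<epsilon>le[of i] \<epsilon> \<beta>(5) by linarith
  have "\<exists>u'. (\<forall>t. (u has_vector_derivative u' t) (at t)) \<and> holder (\<sigma> / 2) u' \<and> holder (1 - \<sigma> / 2) u"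
    by (rule regularity_bootstrap[OF uper hu \<sigma> p \<beta>s \<beta>(1,2) ha[OF \<beta>(1,3,4)] aper hG main'])
  then obtain u' where du: "\<And>t. (u has_vector_derivative u' t) (at t)" and hu': "holder (\<sigma> / 2) u'"
    and hu1: "holder (1 - \<sigma> / 2) u" by blast

  \<comment> \<open>The orders of the ingredients of the full right side: \<open>a\<close>, the
    derivative of \<open>u\<close>, and the Hessian along \<open>u\<close>, where \<open>u\<close>
    itself has order 1 - \<sigma>/2 by now.\<close>
  define \<theta> where "\<theta> = min \<beta> (min (\<sigma> / 2) ((1 - \<sigma> / 2) * \<alpha>))"
  have \<theta>: "0 < \<theta>" "\<theta> \<le> \<beta>" "\<theta> \<le> \<sigma> / 2" "\<theta> \<le> (1 - \<sigma> / 2) * \<alpha>" using \<beta> \<alpha> \<sigma> by (auto simp: \<theta>_def)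
  define g where "g t = hess H (u t) (u' t)" for t
  have \<sigma>2: "0 < 1 - \<sigma> / 2" "0 < \<sigma> / 2" using \<sigma> by auto
  note gC1 = grad_compose_C1[OF H \<alpha>(1) uper hu1 \<sigma>2(1) du hu' \<sigma>2(2) \<theta>(1,3,4), folded G_def g_def]
  have hg: "holder \<theta> g" by (rule gC1(2))
  have cg: "continuous_on S g" for S by (rule holder_imp_continuous_on[OF hg \<theta>(1)])
  have dG: "((\<lambda>t. G (u t)) has_vector_derivative g t) (at t)" for t by (rule gC1(1))
  have gper: "g (t + 2 * pi) = g t" for t by (rule periodic_deriv[OF dG]) (simp add: uper)
  define F where "F i t = g t $ i + a i t" for i t
  have Ffc: "of_real (real k powr (2 * s i)) * fourier_coeff k (\<lambda>t. u t $ i) = fourier_coeff k (F i)" for k i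
  proof -
    have dGi: "((\<lambda>t. G (u t) $ i) has_real_derivative g t $ i) (at t)" for t
      using dG by (simp add: has_vector_derivative_vec)
    have "fourier_coeff k (F i) = fourier_coeff k (\<lambda>t. g t $ i) + fourier_coeff k (a i)"
      unfolding F_def by (rule fourier_coeff_add) (auto intro!: continuous_intros cg simp: a_eq intro: ca')
    also have "fourier_coeff k (\<lambda>t. g t $ i) = \<i> * of_nat k * fourier_coeff k (\<lambda>t. G (u t) $ i)"
      by (rule fourier_coeff_deriv[OF dGi]) (auto intro!: continuous_intros cg simp: uper)
    finally have eq: "fourier_coeff k (F i) = \<i> * of_nat k * fourier_coeff k (\<lambda>t. G (u t) $ i) + fourier_coeff k (a i)" .
    show ?thesis
    proof (cases "k = 0")
      \<comment> \<open>The weak equation does not cover frequency 0. The mean of \<open>a i\<close>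
        vanishes because \<open>A *v y0\<close> is the mean of \<open>e\<close> and \<open>w\<close>
        has mean zero; the derivative part contributes nothing.\<close>
      case True
      have "integral {0..2 * pi} (a i) = 0"
      proof -
        have "((\<lambda>t. (A *v w t) $ i) has_integral (\<Sum>j\<in>UNIV. A $ i $ j * 0)) {0..2 * pi}"
          unfolding matrix_vector_mult_def vec_lambda_beta
        proof (intro has_integral_sum has_integral_mult_right)
          show "((\<lambda>t. w t $ j) has_integral 0) {0..2 * pi}" for j
            using w0[of j] integrable_integral[OF integrable_continuous_interval[OF cwi[of "{0..2 * pi}" j]]] by simp
        qed simp
        moreover have "((\<lambda>t. e t $ i) has_integral (integral {0..2 * pi} e) $ i) {0..2 * pi}"
          using has_integral_linear[OF integrable_integral[OF integrable_continuous_interval[OF ce]] bounded_linear_vec_nth[of i]]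
          by (simp add: o_def)
        ultimately have "((\<lambda>t. (A *v y0) $ i + ((A *v w t) $ i - e t $ i)) has_integral
           2 * pi * (A *v y0) $ i + (0 - (integral {0..2 * pi} e) $ i)) {0..2 * pi}"
          by (intro has_integral_add has_integral_diff)
            (use has_integral_const_real[of "(A *v y0) $ i" 0 "2 * pi"] in auto)
        then show ?thesis unfolding a_eq a'_def y0 by (simp add: integral_unique)
      qed
      then have "fourier_coeff 0 (a i) = 0" by (subst fourier_coeff_0) (auto simp: a_eq intro!: continuous_intros ca')
      then show ?thesis using eq True by simp
    next
      case False
      then show ?thesis using main[of k i] eq by simp
    qed
  qed
  have hF: "holder \<theta> (F i)" for i
    unfolding F_def by (intro holder_add holder_nth hg ha) (use \<theta> \<beta> in auto)
  have Fper: "F i (t + 2 * pi) = F i t" for i t by (simp add: F_def gper aper)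
  have \<theta>s: "\<theta> + 2 * s i < 2" for i using \<beta>s[of i] \<theta>(2) by linarith
  have cui: "continuous_on UNIV (\<lambda>t. u t $ i)" for i by (intro continuous_intros cu)
  have uiper: "u (t + 2 * pi) $ i = u t $ i" for t i by (simp add: uper)
  note fl = frac_lap_from_fourier_coeff[OF cui uiper s hF Fper \<theta>(1) \<theta>s Ffc]
  have "periodic_classical_solution s H A e u"
    unfolding periodic_classical_solution_def
  proof (intro conjI allI)
    show "u (t + 2 * pi) = u t" for t by (rule uper)
    show "\<exists>\<beta>. 0 < \<beta> \<and> \<beta> \<le> 1 \<and> holder \<beta> u" using hu \<sigma> by (intro exI[of _ "\<sigma> / 4"]) auto
    show "frac_lap_exists (s i) (\<lambda>\<tau>. u \<tau> $ i) t" for t i by (rule fl(1))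
    show "\<exists>D. ((\<lambda>\<tau>. grad H (u \<tau>)) has_vector_derivative D) (at t) \<and>
          (\<chi> i. frac_lap (s i) (\<lambda>\<tau>. u \<tau> $ i) t) + D + A *v u t = e t" for t
    proof (intro exI conjI)
      show "((\<lambda>\<tau>. grad H (u \<tau>)) has_vector_derivative g t) (at t)" using dG[of t] by (simp add: G_def)
      show "(\<chi> i. frac_lap (s i) (\<lambda>\<tau>. u \<tau> $ i) t) + g t + A *v u t = e t"
        by (simp add: vec_eq_iff fl(2) F_def a_def)
    qed
  qed
  then show ?thesis by blast
qed

end
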